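(* Let $\mathcal{G}=(V,E,\Phi,\{0,1\})$ be a random decision network with maximum degree $\Delta$ such that: for every edge $(u,v)\in E$ and every pair of actions $(x,y)\in\{0,1\}^2$, $\Phi_{u,v}(x,y)$ is a Gaussian random variable with mean $0$ and standard deviation $\sigma_e$; for every node $v\in V$, $\Phi_v(1)=0$ and $\Phi_v(0)$ is a Gaussian random variable with mean $0$ and standard deviation $\sigma_p$; and all rewards $\Phi_e(x,y)$ and $\Phi_v(x)$ are independent for all choices of $v,e,x,y$. Let $\beta=\sqrt{\frac{\sigma_e^2}{\sigma_e^2+\sigma_p^2}}$. If $\beta(\Delta-1)+\sqrt{\beta(\Delta-1)^3}<1$, then there exists an additive FPTAS for finding $J_{\mathcal{G}}$ with high probability.
   Context: A decision network $\mathcal{G}=(V,E,\Phi,\chi)$ consists of a finite undirected simple graph $(V,E)$, a finite action set $\chi=\{0,1,\ldots,T-1\}$, a potential function $\Phi_v:\chi\to\mathbb{R}$ for every $v\in V$ and an interaction function $\Phi_e:\chi^2\to\mathbb{R}\cup\{-\infty\}$ for every $e\in E$. For a solution $\mathbf{x}=(x_v)_{v\in V}\in\chi^V$ put $F_{\mathcal{G}}(\mathbf{x})=\sum_{(u,v)\in E}\Phi_{u,v}(x_u,x_v)+\sum_{v\in V}\Phi_v(x_v)$, and let $J_{\mathcal{G}}=\max_{\mathbf{x}}F_{\mathcal{G}}(\mathbf{x})$. When $\Phi$ is random, its realization is observed and is the input of the algorithm. The standard deviations $\sigma_e$ (the same for all edges) and $\sigma_p$ (the same for all nodes) and the degree bound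 $\Delta$ are treated as fixed constants. An algorithm is an additive FPTAS with high probability for finding $J_{\mathcal{G}}$ if for every $\epsilon>0$ it outputs, in time polynomial in $|V|$ and $1/\epsilon$, a solution $\hat x$ such that $\mathbb{P}(J_{\mathcal{G}}-F_{\mathcal{G}}(\hat x)>\epsilon)<\epsilon$. *)

theory Defs
  imports "HOL-Probability.Probability"
begin

section \<open>Decision networks\<close>

text \<open>
  The vertex set is \<open>{..<n}\<close>.  An undirected edge is represented by the unique pair
  \<open>(u, v)\<close> with \<open>u < v\<close>, so a set of such pairs is exactly a simple graph, every edge carries
  one interaction function, and its arguments are ordered by their endpoints.
\<close>

definition simple_graph :: "nat \<Rightarrow> (nat \<times> nat) set \<Rightarrow> bool" where
  "simple_graph n E \<longleftrightarrow> E \<subseteq> {(u, v). u < v \<and> v < n}"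

definition node_degree :: "(nat \<times> nat) set \<Rightarrow> nat \<Rightarrow> nat" where
  "node_degree E v = card {w. (v, w) \<in> E \<or> (w, v) \<in> E}"

text \<open>
  \<open>Edge_Reward u v x y\<close> indexes the value of the interaction function of the edge \<open>(u, v)\<close> at
  \<open>(x, y)\<close>, and \<open>Node_Reward v x\<close> the value of the potential function of \<open>v\<close> at \<open>x\<close>.
  All rewards are finite; the value minus infinity is not needed for Gaussian rewards.
\<close>

datatype reward_index = Edge_Reward nat nat nat nat | Node_Reward nat nat

definition reward_indices :: "nat \<Rightarrow> nat \<Rightarrow> (nat \<times> nat) set \<Rightarrow> reward_index set" where
  "reward_indices T n E =
     {Edge_Reward u v x y | u v x y. (u, v) \<in> E \<and> x < T \<and> y < T} \<union>
     {Node_Reward v x | v x. v < n \<and> x < T}"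

definition solutions :: "nat \<Rightarrow> nat \<Rightarrow> (nat \<Rightarrow> nat) set" where
  "solutions T n = {..<n} \<rightarrow>\<^sub>E {..<T}"

definition total_reward ::
    "nat \<Rightarrow> (nat \<times> nat) set \<Rightarrow> (reward_index \<Rightarrow> real) \<Rightarrow> (nat \<Rightarrow> nat) \<Rightarrow> real" where
  "total_reward n E \<phi> x =
     (\<Sum>(u, v)\<in>E. \<phi> (Edge_Reward u v (x u) (x v))) + (\<Sum>v<n. \<phi> (Node_Reward v (x v)))"

definition optimal_reward ::
    "nat \<Rightarrow> nat \<Rightarrow> (nat \<times> nat) set \<Rightarrow> (reward_index \<Rightarrow> real) \<Rightarrow> real" where
  "optimal_reward T n E \<phi> = Max (total_reward n E \<phi> ` solutions T n)"


section \<open>Algorithms over the reals\<close>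

text \<open>
  Inputs contain real numbers, so algorithms are programs of a real-number machine with
  exact unit-cost arithmetic and comparisons, as in the Blum--Shub--Smale model or the real RAM
  without rounding.  Data are S-expressions over the reals.  Every primitive below is a
  constant number of steps of a real RAM with heap-allocated pairs, and two lists used as stacks
  simulate a Blum--Shub--Smale tape, so polynomial time here agrees with polynomial time
  in those models.  Only rational constants may occur in a program.

  A program is a finite table of mutually recursive first-order functions, the first of which is
  the main function.  Variables are de Bruijn indices into the environment.
\<close>

datatype val = VNum real | VNil | VPair val val

datatype binop = Add | Sub | Mul | Div

datatype exp =
    Var nat
  | Const rat
  | Op binop exp exp
  | IfLess exp exp exp exp
  | MkNil
  | MkPair exp exp
  | First exp
  | Second exp
  | IfPair exp exp exp
  | LetIn exp exp
  | Call nat "exp list"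

type_synonym program = "exp list"

fun apply_op :: "binop \<Rightarrow> real \<Rightarrow> real \<Rightarrow> real" where
  "apply_op Add a b = a + b"
| "apply_op Sub a b = a - b"
| "apply_op Mul a b = a * b"
| "apply_op Div a b = a / b"

text \<open>
  \<open>eval P env e v t\<close>: in the environment \<open>env\<close>, the expression \<open>e\<close> terminates with value \<open>v\<close>
  after \<open>t\<close> steps.  There is no derivation for a computation that diverges or applies a
  primitive to a value of the wrong shape.
\<close>

inductive eval :: "program \<Rightarrow> val list \<Rightarrow> exp \<Rightarrow> val \<Rightarrow> nat \<Rightarrow> bool"
  and evals :: "program \<Rightarrow> val list \<Rightarrow> exp list \<Rightarrow> val list \<Rightarrow> nat \<Rightarrow> bool"
  for P :: program
where
  eval_Var: "i < length env \<Longrightarrow> eval P env (Var i) (env ! i) 1"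
| eval_Const: "eval P env (Const q) (VNum (of_rat q)) 1"
| eval_Op:
    "\<lbrakk>eval P env e1 (VNum a) s; eval P env e2 (VNum b) t\<rbrakk>
     \<Longrightarrow> eval P env (Op f e1 e2) (VNum (apply_op f a b)) (Suc (s + t))"
| eval_IfLess_True:
    "\<lbrakk>eval P env e1 (VNum a) r; eval P env e2 (VNum b) s; a < b; eval P env e3 v t\<rbrakk>
     \<Longrightarrow> eval P env (IfLess e1 e2 e3 e4) v (Suc (r + s + t))"
| eval_IfLess_False:
    "\<lbrakk>eval P env e1 (VNum a) r; eval P env e2 (VNum b) s; \<not> a < b; eval P env e4 v t\<rbrakk>
     \<Longrightarrow> eval P env (IfLess e1 e2 e3 e4) v (Suc (r + s + t))"
| eval_MkNil: "eval P env MkNil VNil 1"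
| eval_MkPair:
    "\<lbrakk>eval P env e1 v s; eval P env e2 w t\<rbrakk>
     \<Longrightarrow> eval P env (MkPair e1 e2) (VPair v w) (Suc (s + t))"
| eval_First: "eval P env e (VPair v w) t \<Longrightarrow> eval P env (First e) v (Suc t)"
| eval_Second: "eval P env e (VPair v w) t \<Longrightarrow> eval P env (Second e) w (Suc t)"
| eval_IfPair_True:
    "\<lbrakk>eval P env e1 (VPair v1 v2) s; eval P env e2 w t\<rbrakk>
     \<Longrightarrow> eval P env (IfPair e1 e2 e3) w (Suc (s + t))"
| eval_IfPair_False:
    "\<lbrakk>eval P env e1 v s; \<nexists>v1 v2. v = VPair v1 v2; eval P env e3 w t\<rbrakk>
     \<Longrightarrow> eval P env (IfPair e1 e2 e3) w (Suc (s + t))"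
| eval_LetIn:
    "\<lbrakk>eval P env e1 v s; eval P (v # env) e2 w t\<rbrakk>
     \<Longrightarrow> eval P env (LetIn e1 e2) w (Suc (s + t))"
| eval_Call:
    "\<lbrakk>f < length P; evals P env es vs s; eval P vs (P ! f) v t\<rbrakk>
     \<Longrightarrow> eval P env (Call f es) v (Suc (s + t))"
| evals_Nil: "evals P env [] [] 0"
| evals_Cons:
    "\<lbrakk>eval P env e v s; evals P env es vs t\<rbrakk>
     \<Longrightarrow> evals P env (e # es) (v # vs) (s + t)"

inductive_cases eval_VarE: "eval P env (Var i) v t"
inductive_cases eval_ConstE: "eval P env (Const q) v t"
inductive_cases eval_OpE: "eval P env (Op f e1 e2) v t"
inductive_cases eval_IfLessE: "eval P env (IfLess e1 e2 e3 e4) v t"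
inductive_cases eval_MkNilE: "eval P env MkNil v t"
inductive_cases eval_MkPairE: "eval P env (MkPair e1 e2) v t"
inductive_cases eval_FirstE: "eval P env (First e) v t"
inductive_cases eval_SecondE: "eval P env (Second e) v t"
inductive_cases eval_IfPairE: "eval P env (IfPair e1 e2 e3) v t"
inductive_cases eval_LetInE: "eval P env (LetIn e1 e2) v t"
inductive_cases eval_CallE: "eval P env (Call f es) v t"
inductive_cases evals_NilE: "evals P env [] vs t"
inductive_cases evals_ConsE: "evals P env (e # es) vs t"

lemma eval_deterministic:
  "eval P env e v t \<Longrightarrow> eval P env e v' t' \<Longrightarrow> v' = v \<and> t' = t"
  "evals P env es vs s \<Longrightarrow> evals P env es vs' s' \<Longrightarrow> vs' = vs \<and> s' = s"
proof (induction arbitrary: v' t' and vs' s' rule: eval_evals.inducts)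
  case (eval_Var i env)
  from eval_Var.prems show ?case by (rule eval_VarE) simp
next
  case (eval_Const env q)
  from eval_Const.prems show ?case by (rule eval_ConstE) simp
next
  case (eval_Op env e1 a s e2 b t f)
  from eval_Op.prems show ?case by (rule eval_OpE) (metis eval_Op.IH val.inject(1,2))+
next
  case (eval_IfLess_True env e1 a r e2 b s e3 v t e4)
  from eval_IfLess_True.prems show ?case
    by (rule eval_IfLessE) (metis eval_IfLess_True.IH eval_IfLess_True.hyps val.inject(1,2))+
next
  case (eval_IfLess_False env e1 a r e2 b s e4 v t e3)
  from eval_IfLess_False.prems show ?case
    by (rule eval_IfLessE) (metis eval_IfLess_False.IH eval_IfLess_False.hyps val.inject(1,2))+
next
  case (eval_MkNil env)
  from eval_MkNil.prems show ?case by (rule eval_MkNilE) simp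
next
  case (eval_MkPair env e1 v s e2 w t)
  from eval_MkPair.prems show ?case by (rule eval_MkPairE) (metis eval_MkPair.IH val.inject(1,2))+
next
  case (eval_First env e v w t)
  from eval_First.prems show ?case by (rule eval_FirstE) (metis eval_First.IH val.inject(1,2))+
next
  case (eval_Second env e v w t)
  from eval_Second.prems show ?case by (rule eval_SecondE) (metis eval_Second.IH val.inject(1,2))+
next
  case (eval_IfPair_True env e1 v1 v2 s e2 w t e3)
  from eval_IfPair_True.prems show ?case
    by (rule eval_IfPairE) (metis eval_IfPair_True.IH val.inject(1,2))+
next
  case (eval_IfPair_False env e1 v s e3 w t e2)
  from eval_IfPair_False.prems show ?case
    by (rule eval_IfPairE) (metis eval_IfPair_False.IH eval_IfPair_False.hyps val.inject(1,2))+
next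
  case (eval_LetIn env e1 v s e2 w t)
  from eval_LetIn.prems show ?case by (rule eval_LetInE) (metis eval_LetIn.IH val.inject(1,2))+
next
  case (eval_Call f env es vs s v t)
  from eval_Call.prems show ?case by (rule eval_CallE) (metis eval_Call.IH val.inject(1,2))+
next
  case (evals_Nil env)
  from evals_Nil.prems show ?case by (rule evals_NilE) simp
next
  case (evals_Cons env e v s es vs t)
  from evals_Cons.prems show ?case by (rule evals_ConsE) (metis evals_Cons.IH val.inject(1,2))+
qed

definition runs :: "program \<Rightarrow> val \<Rightarrow> val \<Rightarrow> nat \<Rightarrow> bool" where
  "runs P inp out t \<longleftrightarrow> P \<noteq> [] \<and> eval P [inp] (P ! 0) out t"

definition val_of_list :: "val list \<Rightarrow> val" where
  "val_of_list vs = foldr VPair vs VNil"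

text \<open>
  The input consists of the accuracy, the list of all nodes with their potentials, and the
  list of all edges with their endpoints and interactions, edges in lexicographic order.
\<close>

definition edge_list :: "nat \<Rightarrow> (nat \<times> nat) set \<Rightarrow> (nat \<times> nat) list" where
  "edge_list n E = filter (\<lambda>e. e \<in> E) (List.product [0..<n] [0..<n])"

definition encode_node :: "nat \<Rightarrow> (reward_index \<Rightarrow> real) \<Rightarrow> nat \<Rightarrow> val" where
  "encode_node T \<phi> v = val_of_list [VNum (\<phi> (Node_Reward v x)). x \<leftarrow> [0..<T]]"

definition encode_edge :: "nat \<Rightarrow> (reward_index \<Rightarrow> real) \<Rightarrow> nat \<times> nat \<Rightarrow> val" where
  "encode_edge T \<phi> = (\<lambda>(u, v). VPair (VNum (real u)) (VPair (VNum (real v))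
     (val_of_list [VNum (\<phi> (Edge_Reward u v x y)). x \<leftarrow> [0..<T], y \<leftarrow> [0..<T]])))"

definition encode_input ::
    "nat \<Rightarrow> nat \<Rightarrow> (nat \<times> nat) set \<Rightarrow> (reward_index \<Rightarrow> real) \<Rightarrow> real \<Rightarrow> val" where
  "encode_input T n E \<phi> \<epsilon> =
     VPair (VNum \<epsilon>)
       (VPair (val_of_list (map (encode_node T \<phi>) [0..<n]))
              (val_of_list (map (encode_edge T \<phi>) (edge_list n E))))"

definition encode_solution :: "nat \<Rightarrow> (nat \<Rightarrow> nat) \<Rightarrow> val" where
  "encode_solution n x = val_of_list (map (\<lambda>v. VNum (real (x v))) [0..<n])"


section \<open>Random decision networks and approximation schemes\<close>

text \<open>
  A random network on a sample space \<open>M\<close> has a deterministic graph and rewards \<open>\<Phi> i\<close> that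
  are functions of the outcome \<open>\<omega>\<close>; its realization at \<open>\<omega>\<close> is \<open>\<lambda>i. \<Phi> i \<omega>\<close>.  A class
  of random networks is a predicate on the sample space, the graph and the rewards.
\<close>

type_synonym 'w network_class =
  "'w measure \<Rightarrow> nat \<Rightarrow> (nat \<times> nat) set \<Rightarrow> (reward_index \<Rightarrow> 'w \<Rightarrow> real) \<Rightarrow> bool"

text \<open>
  The program and the time bound are uniform over the whole class and over \<open>\<epsilon>\<close>; the time bound
  holds for every outcome.  Every polynomial in \<open>n\<close> and \<open>1 / \<epsilon>\<close> is dominated by some
  \<open>C * (1 + n + 1 / \<epsilon>) ^ k\<close>.  Measurability of the failure event is part of the requirement,
  because \<^const>\<open>measure\<close> is 0 on sets that are not measurable.
\<close>

definition additive_fptas_whp :: "nat \<Rightarrow> 'w network_class \<Rightarrow> program \<Rightarrow> bool" where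
  "additive_fptas_whp T \<C> P \<longleftrightarrow>
     (\<exists>(C :: real) (k :: nat). \<forall>M n E \<Phi> (\<epsilon> :: real). \<C> M n E \<Phi> \<longrightarrow> \<epsilon> > 0 \<longrightarrow>
       (\<exists>xhat.
          (\<forall>\<omega>\<in>space M. xhat \<omega> \<in> solutions T n \<and>
             (\<exists>t. runs P (encode_input T n E (\<lambda>i. \<Phi> i \<omega>) \<epsilon>) (encode_solution n (xhat \<omega>)) t \<and>
                  real t \<le> C * (1 + real n + 1 / \<epsilon>) ^ k)) \<and>
          (let failure = {\<omega>\<in>space M. optimal_reward T n E (\<lambda>i. \<Phi> i \<omega>)
                            - total_reward n E (\<lambda>i. \<Phi> i \<omega>) (xhat \<omega>) > \<epsilon>}
           in failure \<in> sets M \<and> measure M failure < \<epsilon>)))"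

text \<open>
  Independence includes the constant rewards \<open>Node_Reward v 1\<close>, for which it is automatic.
\<close>

definition gaussian_network :: "nat \<Rightarrow> real \<Rightarrow> real \<Rightarrow> 'w network_class" where
  "gaussian_network \<Delta> \<sigma>\<^sub>e \<sigma>\<^sub>p M n E \<Phi> \<longleftrightarrow>
     prob_space M \<and> simple_graph n E \<and> (\<forall>v<n. node_degree E v \<le> \<Delta>) \<and>
     (\<forall>(u, v)\<in>E. \<forall>x<2. \<forall>y<2.
        distributed M lborel (\<Phi> (Edge_Reward u v x y)) (normal_density 0 \<sigma>\<^sub>e)) \<and>
     (\<forall>v<n. \<forall>\<omega>\<in>space M. \<Phi> (Node_Reward v 1) \<omega> = 0) \<and>
     (\<forall>v<n. distributed M lborel (\<Phi> (Node_Reward v 0)) (normal_density 0 \<sigma>\<^sub>p)) \<and>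
     prob_space.indep_vars M (\<lambda>_. borel) \<Phi> (reward_indices 2 n E)"

end

theory Submission
  imports Defs
begin

text \<open>
  Compare \<open>x\<^sub>v = 1\<close> with \<open>x\<^sub>v = 0\<close> at a node \<open>v\<close> while the neighbours of \<open>v\<close> act arbitrarily.
  The difference of the rewards is \<open>- \<Phi>\<^sub>v(0)\<close> plus one term for each edge at \<open>v\<close>, and it ranges over
  an interval whose width is the sum of \<open>\<bar>Y\<^sub>e\<bar>\<close> over the edges \<open>e\<close> at \<open>v\<close>, where
  \<open>Y\<^sub>e = \<Phi>\<^sub>e(0,0) - \<Phi>\<^sub>e(0,1) - \<Phi>\<^sub>e(1,0) + \<Phi>\<^sub>e(1,1)\<close>.  If all these differences are positive, or none is,
  then the best action at \<open>v\<close> does not depend on the neighbours, and \<open>v\<close> is called decided.  The proof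
  shows that long paths of undecided nodes are rare, and that the optimum can be computed locally
  when there are none.

  \<^bold>\<open>Undecided paths are rare.\<close>  Given the edge rewards, different nodes are undecided
  independently of each other, and since the density of \<open>\<Phi>\<^sub>v(0)\<close> is at most \<open>1 / (2 \<sigma>\<^sub>p)\<close>, the node
  \<open>v\<close> is undecided with probability at most \<open>1 / (2 \<sigma>\<^sub>p)\<close> times the width.  In the product of the
  widths over distinct nodes, every \<open>Y\<^sub>e\<close> occurs at most twice, because an edge has two endpoints;
  as \<open>Y\<^sub>e\<close> is Gaussian with standard deviation \<open>2 \<sigma>\<^sub>e\<close>, every occurrence costs a factor of at most
  \<open>2 \<sigma>\<^sub>e\<close> in expectation.  Hence \<open>k\<close> given nodes are all undecided with probability at most
  \<open>(\<Delta> \<sigma>\<^sub>e / \<sigma>\<^sub>p)\<^sup>k\<close> (\<open>prob_in_window\<close>).  There are at most \<open>n \<Delta> (\<Delta> - 1)\<^bsup>k - 2\<^esup>\<close> self-avoiding paths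
  with \<open>k \<ge> 2\<close> nodes (\<open>card_paths\<close>), and the hypothesis on \<open>\<beta>\<close> implies \<open>(\<Delta> - 1) \<Delta> \<sigma>\<^sub>e / \<sigma>\<^sub>p < 1\<close>
  (\<open>contraction_rate\<close>), so the probability of an undecided path with \<open>k\<close> nodes decays
  geometrically in \<open>k\<close>.

  \<^bold>\<open>Local computation.\<close>  The gain of \<open>v\<close>, that is, the best reward with \<open>x\<^sub>v = 1\<close> minus the best
  reward with \<open>x\<^sub>v = 0\<close>, satisfies a recursion along the self-avoiding walks that start at \<open>v\<close>:
  delete \<open>v\<close> and switch its action from \<open>0\<close> to \<open>1\<close> for one incident edge after the other
  (\<open>gain_eq_star_gain\<close>, \<open>star_gain_Cons\<close>).  An edge transmits the gain of the neighbour through a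
  clipping function that is constant on the gains a decided neighbour can have.  So,
  unless an undecided path of \<open>k\<close> nodes starts at \<open>v\<close>, the recursion that is cut off at depth \<open>k\<close> gives the
  exact gain of an undecided node (\<open>gap_exact\<close>) and at least the sign of the gain of a decided one
  (\<open>gap_sign\<close>).  Fixing the nodes one by one according to the sign of their gain
  gives an optimal solution (\<open>greedy_optimal\<close>).  The cost is about \<open>(2 \<Delta> + 2)\<^sup>k\<close>, and a depth \<open>k\<close>
  that is logarithmic in \<open>n / \<epsilon>\<close> makes both the cost polynomial and the failure probability less
  than \<open>\<epsilon>\<close>.
\<close>

section \<open>Networks as lists and the truncated recursion\<close>

text \<open>
  Binary actions are truth values, and a solution is the set of the nodes with action 1.  A list
  of fields records the reward for choosing 1 over 0; its entries for the same node add up,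
  so a field changes by prepending an entry.  A star is the list of the edges at a root, with
  the root as first argument of every weight.
\<close>
type_synonym weight = "bool \<Rightarrow> bool \<Rightarrow> real"
type_synonym fields = "(nat \<times> real) list"
type_synonym couplings = "(nat \<times> nat \<times> weight) list"
type_synonym star = "(nat \<times> weight) list"

definition field_at :: "fields \<Rightarrow> nat \<Rightarrow> real" where
  "field_at h v = (\<Sum>(u, d)\<leftarrow>h. if u = v then d else 0)"

fun incident :: "nat \<Rightarrow> couplings \<Rightarrow> star" where
  "incident v [] = []"
| "incident v ((a, b, w) # E) =
     (if a = v then (b, w) # incident v E
      else if b = v then (a, \<lambda>x y. w y x) # incident v E
      else incident v E)"

fun delete_vertex :: "nat \<Rightarrow> couplings \<Rightarrow> couplings" where
  "delete_vertex v [] = []"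
| "delete_vertex v ((a, b, w) # E) =
     (if a = v then delete_vertex v E else if b = v then delete_vertex v E
      else (a, b, w) # delete_vertex v E)"

definition slope :: "weight \<Rightarrow> bool \<Rightarrow> real" where
  "slope w b = w b True - w b False"

text \<open>
  When the root of a star gets the action \<open>b\<close>, an edge to \<open>u\<close> turns into a contribution to the field
  of \<open>u\<close>.
\<close>
fun push :: "bool \<Rightarrow> star \<Rightarrow> fields \<Rightarrow> fields" where
  "push b [] h = h"
| "push b ((u, w) # I) h = push b I ((u, slope w b) # h)"

text \<open>
  The change of the optimum when the first endpoint of an edge switches from 0 to 1 and the
  gain of the second endpoint, without this edge, is \<open>d\<close>.
\<close>
definition influence :: "weight \<Rightarrow> real \<Rightarrow> real" where
  "influence w d =
     (w True False - w False False) + max 0 (d + slope w True) - max 0 (d + slope w False)"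

text \<open>
  The root is thought of as split into one copy for each of its edges, and the copies switch
  from 0 to 1 in turn.  While the copy of the edge to \<open>u\<close> switches, the copies of the edges before it
  in the star have action 0 and those after it action 1.  The function \<open>f\<close> estimates the gains.
\<close>
fun star_sum :: "(fields \<Rightarrow> couplings \<Rightarrow> nat \<Rightarrow> real) \<Rightarrow> fields \<Rightarrow> couplings \<Rightarrow> star \<Rightarrow> real" where
  "star_sum f h E [] = 0"
| "star_sum f h E ((u, w) # I) =
     star_sum f ((u, slope w False) # h) E I + influence w (f (push True I h) E u)"

primrec gap :: "nat \<Rightarrow> fields \<Rightarrow> couplings \<Rightarrow> nat \<Rightarrow> real" where
  "gap 0 = (\<lambda>h E v. 0)"
| "gap (Suc k) = (\<lambda>h E v. field_at h v + star_sum (gap k) h (delete_vertex v E) (incident v E))"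

fun greedy :: "nat \<Rightarrow> nat list \<Rightarrow> fields \<Rightarrow> couplings \<Rightarrow> bool list" where
  "greedy k [] h E = []"
| "greedy k (v # vs) h E =
     (let b = gap k h E v > 0
      in b # greedy k vs (push b (incident v E) h) (delete_vertex v E))"

section \<open>The gain of a node\<close>

definition reward :: "fields \<Rightarrow> couplings \<Rightarrow> nat set \<Rightarrow> real" where
  "reward h E x = (\<Sum>(u, d)\<leftarrow>h. if u \<in> x then d else 0) + (\<Sum>(a, b, w)\<leftarrow>E. w (a \<in> x) (b \<in> x))"

definition best :: "nat set \<Rightarrow> fields \<Rightarrow> couplings \<Rightarrow> real" where
  "best V h E = Max (reward h E ` Pow V)"

definition gain :: "nat set \<Rightarrow> fields \<Rightarrow> couplings \<Rightarrow> nat \<Rightarrow> real" where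
  "gain V h E v =
     Max ((\<lambda>x. reward h E (insert v x)) ` Pow (V - {v})) - best (V - {v}) h E"

definition couplings_on :: "nat set \<Rightarrow> couplings \<Rightarrow> bool" where
  "couplings_on V E \<longleftrightarrow> (\<forall>(a, b, w)\<in>set E. a \<in> V \<and> b \<in> V \<and> a \<noteq> b)"

lemma couplings_on_simps [simp]:
  "couplings_on V []"
  "couplings_on V ((a, b, w) # E) \<longleftrightarrow> a \<in> V \<and> b \<in> V \<and> a \<noteq> b \<and> couplings_on V E"
  by (auto simp: couplings_on_def)

lemma couplings_on_delete_vertex:
  "couplings_on V E \<Longrightarrow> couplings_on (V - {v}) (delete_vertex v E)"
  by (induction v E rule: delete_vertex.induct) auto

lemma incident_in:
  "couplings_on V E \<Longrightarrow> (u, w) \<in> set (incident v E) \<Longrightarrow> u \<in> V - {v}"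
  by (induction v E rule: incident.induct) (auto split: if_splits)

lemma field_at_simps [simp]:
  "field_at [] v = 0"
  "field_at ((u, d) # h) v = (if u = v then d else 0) + field_at h v"
  by (auto simp: field_at_def)

lemma reward_Cons_field:
  "reward ((u, d) # h) E x = reward h E x + (if u \<in> x then d else 0)"
  by (simp add: reward_def)

lemma reward_push:
  "reward (push b I h) E x = reward h E x + (\<Sum>(u, w)\<leftarrow>I. if u \<in> x then slope w b else 0)"
  by (induction b I h rule: push.induct) (auto simp: reward_Cons_field)

lemma reward_field_insert:
  assumes "v \<notin> x"
  shows "(\<Sum>(u, d)\<leftarrow>h. if u \<in> insert v x then d else 0)
           = field_at h v + (\<Sum>(u, d)\<leftarrow>h. if u \<in> x then d else 0)"
  using assms by (induction h) auto

lemma reward_couplings_split: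
  assumes "couplings_on V E" "v \<notin> x"
  shows "(\<Sum>(a, b, w)\<leftarrow>E. w (a \<in> insert v x) (b \<in> insert v x)) =
           (\<Sum>(u, w)\<leftarrow>incident v E. w True (u \<in> x)) + (\<Sum>(a, b, w)\<leftarrow>delete_vertex v E. w (a \<in> x) (b \<in> x))"
    and "(\<Sum>(a, b, w)\<leftarrow>E. w (a \<in> x) (b \<in> x)) =
           (\<Sum>(u, w)\<leftarrow>incident v E. w False (u \<in> x)) + (\<Sum>(a, b, w)\<leftarrow>delete_vertex v E. w (a \<in> x) (b \<in> x))"
  using assms by (induction v E rule: incident.induct) auto

lemma star_reward:
  "(\<Sum>(u, w)\<leftarrow>I. w b (u \<in> x)) = (\<Sum>(u, w)\<leftarrow>I. w b False) + (\<Sum>(u, w)\<leftarrow>I. if u \<in> x then slope w b else 0)"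
  by (induction I) (auto simp: slope_def)

lemma reward_fix_vertex:
  assumes "couplings_on V E" "v \<notin> x"
  shows "reward h E (if b then insert v x else x) =
           (if b then field_at h v else 0) + (\<Sum>(u, w)\<leftarrow>incident v E. w b False)
           + reward (push b (incident v E) h) (delete_vertex v E) x"
proof (cases b)
  case True
  then have b: "b = True" by simp
  show ?thesis
    unfolding reward_push b
    using reward_field_insert[OF assms(2), of h] reward_couplings_split(1)[OF assms]
      star_reward[of True x "incident v E"]
    by (simp add: reward_def)
next
  case False
  then have b: "b = False" by simp
  show ?thesis
    unfolding reward_push b
    using reward_couplings_split(2)[OF assms] star_reward[of False x "incident v E"]
    by (simp add: reward_def)
qed

lemma Max_image_add_left:
  fixes f :: "'a \<Rightarrow> real"
  assumes "finite A" "A \<noteq> {}"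
  shows "Max ((\<lambda>x. c + f x) ` A) = c + Max (f ` A)"
  using assms Max_add_commute[of A f c] by (simp add: add.commute)

lemma best_fix_vertex:
  assumes "couplings_on V E" "finite V"
  shows "Max ((\<lambda>x. reward h E (if b then insert v x else x)) ` Pow (V - {v})) =
           (if b then field_at h v else 0) + (\<Sum>(u, w)\<leftarrow>incident v E. w b False)
           + best (V - {v}) (push b (incident v E) h) (delete_vertex v E)"
proof -
  have "(\<lambda>x. reward h E (if b then insert v x else x)) ` Pow (V - {v}) =
     (\<lambda>x. ((if b then field_at h v else 0) + (\<Sum>(u, w)\<leftarrow>incident v E. w b False))
           + reward (push b (incident v E) h) (delete_vertex v E) x) ` Pow (V - {v})"
    by (intro image_cong refl, subst reward_fix_vertex[OF assms(1)]) auto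
  then show ?thesis
    unfolding best_def using assms(2) by (simp only:) (subst Max_image_add_left, auto)
qed

text \<open>
  The exact counterpart of \<^const>\<open>star_sum\<close>: the change of the optimum when the root of the star
  switches from 0 to 1.
\<close>
definition star_gain :: "nat set \<Rightarrow> fields \<Rightarrow> couplings \<Rightarrow> star \<Rightarrow> real" where
  "star_gain V h E I = (\<Sum>(u, w)\<leftarrow>I. w True False - w False False)
     + best V (push True I h) E - best V (push False I h) E"

lemma gain_eq_star_gain:
  assumes "couplings_on V E" "finite V"
  shows "gain V h E v = field_at h v + star_gain (V - {v}) h (delete_vertex v E) (incident v E)"
proof -
  have "(\<Sum>(u, w)\<leftarrow>incident v E. w True False - w False False) =
     (\<Sum>(u, w)\<leftarrow>incident v E. w True False) - (\<Sum>(u, w)\<leftarrow>incident v E. w False False)"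
    by (simp add: split_def sum_list_subtractf)
  then show ?thesis
    using best_fix_vertex[OF assms, of h True v] best_fix_vertex[OF assms, of h False v]
    unfolding gain_def star_gain_def by (simp add: best_def)
qed

lemma Pow_split:
  assumes "v \<in> V"
  shows "Pow V = insert v ` Pow (V - {v}) \<union> Pow (V - {v})"
  using assms Pow_insert[of v "V - {v}"] by (auto simp: insert_absorb)

lemma best_split:
  assumes "v \<in> V" "finite V"
  shows "best V h E = max (Max ((\<lambda>x. reward h E (insert v x)) ` Pow (V - {v}))) (best (V - {v}) h E)"
  unfolding best_def using assms
  by (subst Pow_split[OF assms(1)], subst image_Un, subst Max_Un) (auto simp: image_image)

text \<open>
  The optimum as a function of one field: either \<open>u\<close> has action 0, or it has action 1 and collects
  its gain and \<open>d\<close>.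
\<close>
lemma best_add_field:
  assumes "u \<in> V" "finite V" "\<And>x. reward h' E x = reward h E x + (if u \<in> x then d else 0)"
  shows "best V h' E = best (V - {u}) h E + max 0 (gain V h E u + d)"
proof -
  have 1: "best (V - {u}) h' E = best (V - {u}) h E"
    unfolding best_def by (intro arg_cong[where f = Max] image_cong refl) (auto simp: assms(3))
  have "(\<lambda>x. reward h' E (insert u x)) ` Pow (V - {u}) = (\<lambda>x. d + reward h E (insert u x)) ` Pow (V - {u})"
    by (intro image_cong refl) (auto simp: assms(3))
  then have 2: "Max ((\<lambda>x. reward h' E (insert u x)) ` Pow (V - {u})) =
      d + Max ((\<lambda>x. reward h E (insert u x)) ` Pow (V - {u}))"
    using assms(2) by (simp only:) (subst Max_image_add_left, auto)
  show ?thesis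
    unfolding best_split[OF assms(1,2)] 1 2 gain_def by (simp add: max_def)
qed

text \<open>
  Telescoping: insert the configuration in which the first edge sees action 0 and all other
  edges see action 1.
\<close>
lemma star_gain_Cons:
  assumes "u \<in> V" "finite V"
  shows "star_gain V h E ((u, w) # I) =
     star_gain V ((u, slope w False) # h) E I + influence w (gain V (push True I h) E u)"
proof -
  have "best V (push True I ((u, d) # h)) E
          = best (V - {u}) (push True I h) E + max 0 (gain V (push True I h) E u + d)" for d
    by (rule best_add_field[OF assms]) (simp add: reward_push reward_Cons_field)
  then show ?thesis
    by (simp add: star_gain_def influence_def)
qed

section \<open>Ranges of gains and decided nodes\<close>

definition jump :: "weight \<Rightarrow> bool \<Rightarrow> real" where
  "jump w y = w True y - w False y"

definition lower_jump :: "weight \<Rightarrow> real" where "lower_jump w = min (jump w False) (jump w True)"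
definition upper_jump :: "weight \<Rightarrow> real" where "upper_jump w = max (jump w False) (jump w True)"

text \<open>
  The ends of the interval of all gains that arbitrary actions of the neighbours can cause at \<open>v\<close>.
\<close>
definition lower :: "fields \<Rightarrow> couplings \<Rightarrow> nat \<Rightarrow> real" where
  "lower h E v = field_at h v + (\<Sum>(u, w)\<leftarrow>incident v E. lower_jump w)"
definition upper :: "fields \<Rightarrow> couplings \<Rightarrow> nat \<Rightarrow> real" where
  "upper h E v = field_at h v + (\<Sum>(u, w)\<leftarrow>incident v E. upper_jump w)"

text \<open>
  Adding \<open>p\<close>, a difference of two positive parts of shifts of the same number lies between \<open>p\<close> and \<open>p\<close>
  plus the difference of the shifts.
\<close>
lemma influence_bounds: "influence w d \<in> {lower_jump w..upper_jump w}"
proof -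
  have clip: "min p (p + a - c) \<le> p + max 0 (d + a) - max 0 (d + c)"
    "p + max 0 (d + a) - max 0 (d + c) \<le> max p (p + a - c)" for p a c :: real
    by (simp_all add: max_def min_def)
  have "jump w True = jump w False + slope w True - slope w False"
    by (simp add: jump_def slope_def)
  then show ?thesis
    using clip[of "jump w False" "slope w True" "slope w False"]
    by (simp add: influence_def lower_jump_def upper_jump_def jump_def)
qed

lemma star_sum_bounds:
  "star_sum f h E I \<in> {(\<Sum>(u, w)\<leftarrow>I. lower_jump w)..(\<Sum>(u, w)\<leftarrow>I. upper_jump w)}"
proof (induction f h E I rule: star_sum.induct)
  case (2 f h E u w I)
  then show ?case using influence_bounds[of w "f (push True I h) E u"] by auto
qed simp

lemma gap_bounds: "gap (Suc k) h E v \<in> {lower h E v..upper h E v}"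
  using star_sum_bounds[of "gap k" h "delete_vertex v E" "incident v E"]
  by (auto simp: lower_def upper_def)

lemma star_gain_bounds:
  assumes "finite V" "\<forall>(u, w)\<in>set I. u \<in> V"
  shows "star_gain V h E I \<in> {(\<Sum>(u, w)\<leftarrow>I. lower_jump w)..(\<Sum>(u, w)\<leftarrow>I. upper_jump w)}"
  using assms(2)
proof (induction I arbitrary: h)
  case (Cons p I)
  obtain u w where [simp]: "p = (u, w)" by force
  have "u \<in> V" using Cons.prems by auto
  have "star_gain V ((u, slope w False) # h) E I \<in> {(\<Sum>(u, w)\<leftarrow>I. lower_jump w)..(\<Sum>(u, w)\<leftarrow>I. upper_jump w)}"
    using Cons by auto
  then show ?case
    using influence_bounds[of w "gain V (push True I h) E u"]
    by (auto simp: star_gain_Cons[OF \<open>u \<in> V\<close> assms(1)])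
qed (simp add: star_gain_def)

lemma gain_bounds:
  assumes "couplings_on V E" "finite V"
  shows "gain V h E v \<in> {lower h E v..upper h E v}"
proof -
  have "\<forall>(u, w)\<in>set (incident v E). u \<in> V - {v}"
    using incident_in[OF assms(1)] by auto
  from star_gain_bounds[OF _ this, of h "delete_vertex v E"] show ?thesis
    using assms by (auto simp: gain_eq_star_gain lower_def upper_def)
qed

text \<open>
  The contributions of the edges of a star to the range of the gain of a node \<open>v\<close> other than the
  root.
\<close>
definition star_lower :: "star \<Rightarrow> nat \<Rightarrow> real" where
  "star_lower I v = (\<Sum>(u, w)\<leftarrow>I. if u = v then min (slope w False) (slope w True) else 0)"
definition star_upper :: "star \<Rightarrow> nat \<Rightarrow> real" where
  "star_upper I v = (\<Sum>(u, w)\<leftarrow>I. if u = v then max (slope w False) (slope w True) else 0)"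

lemma lower_delete_vertex:
  "u \<noteq> v \<Longrightarrow> lower h E u = lower h (delete_vertex v E) u + star_lower (incident v E) u"
  by (induction v E rule: incident.induct)
     (auto simp: lower_def star_lower_def lower_jump_def jump_def slope_def)

lemma upper_delete_vertex:
  "u \<noteq> v \<Longrightarrow> upper h E u = upper h (delete_vertex v E) u + star_upper (incident v E) u"
  by (induction v E rule: incident.induct)
     (auto simp: upper_def star_upper_def upper_jump_def jump_def slope_def)

lemma lower_Cons: "lower ((u, d) # h) E v = (if u = v then d else 0) + lower h E v"
  by (simp add: lower_def)
lemma upper_Cons: "upper ((u, d) # h) E v = (if u = v then d else 0) + upper h E v"
  by (simp add: upper_def)

lemma star_bounds_Cons [simp]:
  "star_lower ((u, w) # I) v = (if u = v then min (slope w False) (slope w True) else 0) + star_lower I v"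
  "star_upper ((u, w) # I) v = (if u = v then max (slope w False) (slope w True) else 0) + star_upper I v"
  by (simp_all add: star_lower_def star_upper_def)

text \<open>
  Fixing the root can only shrink the ranges at the other nodes, since one of the values that
  an edge can contribute is selected.
\<close>
lemma push_bounds:
  "lower h E v + star_lower I v \<le> lower (push b I h) E v"
  "upper (push b I h) E v \<le> upper h E v + star_upper I v"
proof (induction b I h rule: push.induct)
  case (2 b u w I h)
  have "slope w b \<in> {min (slope w False) (slope w True)..max (slope w False) (slope w True)}"
    by (cases b) auto
  { case 1 then show ?case using 2(1) \<open>slope w b \<in> _\<close> by (auto simp: lower_Cons) }
  { case 2 then show ?case using \<open>slope w b \<in> _\<close> "2.IH"(2) by (auto simp: upper_Cons) }
qed (simp_all add: star_lower_def star_upper_def)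

text \<open>
  The boundary case \<open>upper h E v = 0\<close> counts as decided because ties are broken towards action 0.
\<close>
definition decided :: "fields \<Rightarrow> couplings \<Rightarrow> nat \<Rightarrow> bool" where
  "decided h E v \<longleftrightarrow> lower h E v > 0 \<or> upper h E v \<le> 0"

text \<open>
  Being decided in the network that still contains the root of the star.
\<close>
definition star_decided :: "fields \<Rightarrow> couplings \<Rightarrow> star \<Rightarrow> nat \<Rightarrow> bool" where
  "star_decided h E I v \<longleftrightarrow> lower h E v + star_lower I v > 0 \<or> upper h E v + star_upper I v \<le> 0"

lemma star_decided_incident:
  "u \<noteq> v \<Longrightarrow> decided h E u \<longleftrightarrow> star_decided h (delete_vertex v E) (incident v E) u"
  using lower_delete_vertex[of u v h E] upper_delete_vertex[of u v h E]
  by (simp add: decided_def star_decided_def)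

lemma decided_push: "star_decided h E I v \<Longrightarrow> decided (push b I h) E v"
  using push_bounds[where h = h and E = E and v = v and I = I and b = b] by (auto simp: decided_def star_decided_def)

lemma decided_fix_vertex:
  "u \<noteq> v \<Longrightarrow> decided h E u \<Longrightarrow> decided (push b (incident v E) h) (delete_vertex v E) u"
  using star_decided_incident[of u v h E] decided_push by blast

lemma star_decided_step:
  "star_decided h E ((u, w) # I) v \<Longrightarrow> star_decided ((u, slope w False) # h) E I v"
  by (auto simp: star_decided_def lower_Cons upper_Cons split: if_splits)

lemma star_decided_drop:
  assumes "star_decided h E ((u, w) # I) v" "v \<noteq> u" shows "star_decided h E I v"
  using assms by (auto simp: star_decided_def)

text \<open>
  The gain of \<open>u\<close> stays on one side of both clipping thresholds, so the clipped difference is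
  constant there.
\<close>
lemma influence_decided:
  assumes "star_decided h E ((u, w) # I) u"
    and "d \<in> {lower (push True I h) E u..upper (push True I h) E u}"
    and "d' \<in> {lower (push True I h) E u..upper (push True I h) E u}"
  shows "influence w d = influence w d'"
  using assms push_bounds[where h = h and E = E and v = u and I = I and b = True]
  by (auto simp: star_decided_def influence_def)

section \<open>Exactness without undecided paths\<close>

text \<open>
  A self-avoiding path of \<open>k\<close> nodes of \<open>U\<close> starts at \<open>v\<close>.  Deleting \<open>v\<close> mirrors the recursion of
  \<^const>\<open>gap\<close>.
\<close>
fun undecided_path :: "nat set \<Rightarrow> couplings \<Rightarrow> nat \<Rightarrow> nat \<Rightarrow> bool" where
  "undecided_path U E 0 v = True"
| "undecided_path U E (Suc 0) v = (v \<in> U)"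
| "undecided_path U E (Suc (Suc k)) v =
     (v \<in> U \<and> (\<exists>(u, w)\<in>set (incident v E). undecided_path U (delete_vertex v E) (Suc k) u))"


text \<open>
  The estimates may be wrong at neighbours outside of \<open>U\<close>, as long as they are in range: there the
  influence does not depend on them.
\<close>
lemma star_sum_eq_star_gain:
  assumes "finite V" "couplings_on V E" "\<forall>(u, w)\<in>set I. u \<in> V"
    and "\<And>u. u \<in> V \<Longrightarrow> u \<notin> U \<Longrightarrow> star_decided h E I u"
    and exact: "\<And>u w h. (u, w) \<in> set I \<Longrightarrow> u \<in> U \<Longrightarrow>
           (\<And>u. u \<in> V \<Longrightarrow> u \<notin> U \<Longrightarrow> decided h E u) \<Longrightarrow> f h E u = gain V h E u"
    and range: "\<And>h u. f h E u \<in> {lower h E u..upper h E u}"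
  shows "star_sum f h E I = star_gain V h E I"
  using assms(3-5)
proof (induction I arbitrary: h)
  case Nil
  then show ?case by (simp add: star_gain_def)
next
  case (Cons p I)
  obtain u w where [simp]: "p = (u, w)" by force
  have u: "u \<in> V" using Cons.prems(1) by auto
  have rest: "star_sum f ((u, slope w False) # h) E I = star_gain V ((u, slope w False) # h) E I"
    using Cons.prems by (intro Cons.IH) (auto intro: star_decided_step)
  have "influence w (f (push True I h) E u) = influence w (gain V (push True I h) E u)"
  proof (cases "u \<in> U")
    case True
    have "decided (push True I h) E u'" if "u' \<in> V" "u' \<notin> U" for u'
      using Cons.prems(2)[OF that] that True star_decided_drop decided_push by (metis \<open>p = (u, w)\<close>)
    then show ?thesis using Cons.prems(3)[of u w] True by auto
  next
    case False
    then have "star_decided h E ((u, w) # I) u" using Cons.prems(2) u by simp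
    then show ?thesis
      using influence_decided range gain_bounds[OF assms(2,1)] by blast
  qed
  then show ?case using rest by (simp add: star_gain_Cons[OF u assms(1)])
qed

text \<open>
  The base case is vacuous because the path with no nodes always exists.  As \<open>v\<close> is in \<open>U\<close>,
  a path of \<open>k\<close> nodes of \<open>U\<close> at a neighbour, in the network without \<open>v\<close>, would extend to one at \<open>v\<close>.
\<close>
lemma gap_exact:
  assumes "finite V" "couplings_on V E" "v \<in> V" "v \<in> U"
    and "\<And>u. u \<in> V \<Longrightarrow> u \<notin> U \<Longrightarrow> decided h E u"
    and "\<not> undecided_path U E k v"
  shows "gap k h E v = gain V h E v"
  using assms
proof (induction k arbitrary: V h E v)
  case 0
  then show ?case by simp
next
  case (Suc k)
  from Suc.prems(4,6) obtain j where k: "k = Suc j" by (cases k) auto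
  have no_path: "\<not> undecided_path U (delete_vertex v E) k u" if "(u, w) \<in> set (incident v E)" for u w
    using Suc.prems(4,6) that unfolding k by auto
  have "star_sum (gap k) h (delete_vertex v E) (incident v E) =
          star_gain (V - {v}) h (delete_vertex v E) (incident v E)"
  proof (rule star_sum_eq_star_gain[where U = U])
    show "couplings_on (V - {v}) (delete_vertex v E)"
      by (rule couplings_on_delete_vertex[OF Suc.prems(2)])
    show "\<forall>(u, w)\<in>set (incident v E). u \<in> V - {v}"
      using incident_in[OF Suc.prems(2)] by auto
    show "star_decided h (delete_vertex v E) (incident v E) u" if "u \<in> V - {v}" "u \<notin> U" for u
      using Suc.prems(5)[of u] that star_decided_incident by auto
    show "gap k h (delete_vertex v E) u = gain (V - {v}) h (delete_vertex v E) u"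
      if "(u, w) \<in> set (incident v E)" "u \<in> U"
        "\<And>u. u \<in> V - {v} \<Longrightarrow> u \<notin> U \<Longrightarrow> decided h (delete_vertex v E) u" for u w h
      using Suc.prems(1) that incident_in[OF Suc.prems(2)] no_path
      by (intro Suc.IH couplings_on_delete_vertex[OF Suc.prems(2)]) auto
    show "gap k h (delete_vertex v E) u \<in> {lower h (delete_vertex v E) u..upper h (delete_vertex v E) u}"
      for h u unfolding k by (rule gap_bounds)
  qed (use Suc.prems in auto)
  then show ?case by (simp add: gain_eq_star_gain[OF Suc.prems(2,1)])
qed

text \<open>
  At a decided node the estimate may be wrong, but it has the right sign.
\<close>
lemma gap_sign:
  assumes "finite V" "couplings_on V E" "v \<in> V"
    and "\<And>u. u \<in> V \<Longrightarrow> u \<notin> U \<Longrightarrow> decided h E u"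
    and "\<not> undecided_path U E k v"
  shows "gap k h E v > 0 \<longleftrightarrow> gain V h E v > 0"
proof (cases "v \<in> U")
  case True
  then show ?thesis using gap_exact[OF assms(1-3)] assms(4,5) by simp
next
  case False
  from assms(5) obtain j where k: "k = Suc j" by (cases k) auto
  show ?thesis
    using assms(4)[OF assms(3) False] gap_bounds[of j h E v] gain_bounds[OF assms(2,1), of h v]
    by (auto simp: k decided_def)
qed

lemma incident_delete_vertex: "set (incident u (delete_vertex v E)) \<subseteq> set (incident u E)"
  by (induction v E rule: delete_vertex.induct) auto

lemma delete_vertex_commute: "delete_vertex u (delete_vertex v E) = delete_vertex v (delete_vertex u E)"
  by (induction v E rule: delete_vertex.induct) auto

lemma undecided_path_delete_vertex:
  "undecided_path U (delete_vertex v E) k u \<Longrightarrow> undecided_path U E k u"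
proof (induction U E k u rule: undecided_path.induct)
  case (3 U E k u)
  then show ?case
    using incident_delete_vertex[of u v E] by (fastforce simp: delete_vertex_commute[of u v])
qed auto

lemma greedy_length [simp]: "length (greedy k vs h E) = length vs"
  by (induction k vs h E rule: greedy.induct) (simp_all add: Let_def)

definition chosen :: "nat list \<Rightarrow> bool list \<Rightarrow> nat set" where
  "chosen vs bs = {v. (v, True) \<in> set (zip vs bs)}"

lemma chosen_Cons: "chosen (v # vs) (b # bs) = (if b then insert v (chosen vs bs) else chosen vs bs)"
  by (auto simp: chosen_def)

lemma chosen_subset: "chosen vs bs \<subseteq> set vs"
  by (auto simp: chosen_def dest: set_zip_leftD)

lemma best_greedy_step:
  assumes "finite V" "couplings_on V E" "v \<in> V" "b \<longleftrightarrow> gain V h E v > 0"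
  shows "best V h E = (if b then field_at h v else 0) + (\<Sum>(u, w)\<leftarrow>incident v E. w b False)
           + best (V - {v}) (push b (incident v E) h) (delete_vertex v E)"
proof -
  have "best V h E = Max ((\<lambda>x. reward h E (if b then insert v x else x)) ` Pow (V - {v}))"
    using best_split[OF assms(3,1), of h E] assms(4) by (auto simp: gain_def best_def)
  then show ?thesis using best_fix_vertex[OF assms(2,1)] by simp
qed

text \<open>
  Fixing a node according to the sign of its gain loses nothing; the remaining nodes stay
  decided if they were, and no undecided path arises.  Ties need no attention because later gains
  refer to the network in which the earlier choices are fixed.
\<close>
theorem greedy_optimal:
  assumes "couplings_on (set vs) E" "distinct vs"
    and "\<And>v. v \<in> set vs \<Longrightarrow> v \<notin> U \<Longrightarrow> decided h E v"
    and "\<And>v. v \<in> set vs \<Longrightarrow> \<not> undecided_path U E k v"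
  shows "reward h E (chosen vs (greedy k vs h E)) = best (set vs) h E"
  using assms
proof (induction vs arbitrary: h E)
  case Nil
  then show ?case by (simp add: best_def chosen_def)
next
  case (Cons v vs)
  define b where "b \<longleftrightarrow> gap k h E v > 0"
  define h' E' where "h' = push b (incident v E) h" and "E' = delete_vertex v E"
  have V: "set (v # vs) - {v} = set vs" using Cons.prems(2) by auto
  have b: "b \<longleftrightarrow> gain (set (v # vs)) h E v > 0"
    unfolding b_def using Cons.prems by (intro gap_sign[where U = U]) auto
  have IH: "reward h' E' (chosen vs (greedy k vs h' E')) = best (set vs) h' E'"
  proof (rule Cons.IH)
    show "couplings_on (set vs) E'"
      unfolding E'_def using couplings_on_delete_vertex[OF Cons.prems(1), of v] V by simp
    show "decided h' E' u" if "u \<in> set vs" "u \<notin> U" for u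
      unfolding h'_def E'_def using Cons.prems(2,3) that by (intro decided_fix_vertex) auto
    show "\<not> undecided_path U E' k u" if "u \<in> set vs" for u
      using Cons.prems(4)[of u] that undecided_path_delete_vertex unfolding E'_def by auto
  qed (use Cons.prems in auto)
  have "v \<notin> chosen vs (greedy k vs h' E')" using chosen_subset Cons.prems(2) by fastforce
  from reward_fix_vertex[OF Cons.prems(1) this, of h b]
  have "reward h E (chosen (v # vs) (greedy k (v # vs) h E)) =
     (if b then field_at h v else 0) + (\<Sum>(u, w)\<leftarrow>incident v E. w b False)
           + reward h' E' (chosen vs (greedy k vs h' E'))"
    by (simp add: Let_def chosen_Cons b_def[symmetric] h'_def[symmetric] E'_def[symmetric])
  also have "\<dots> = best (set (v # vs)) h E"
    using best_greedy_step[OF _ Cons.prems(1) _ b] V IH by (simp add: h'_def E'_def)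
  finally show ?case .
qed

section \<open>Symbolic execution of programs\<close>

text \<open>
  Predicates of values and running times that hold for the outcome of an evaluation.  In this
  form the evaluation rules become equations, so a loop-free program text is executed by
  rewriting, and what remains are the calls and arithmetic on running times.
\<close>
definition wp :: "program \<Rightarrow> val list \<Rightarrow> exp \<Rightarrow> (val \<Rightarrow> nat \<Rightarrow> bool) \<Rightarrow> bool" where
  "wp P env e Q \<longleftrightarrow> (\<exists>v t. eval P env e v t \<and> Q v t)"

definition wps :: "program \<Rightarrow> val list \<Rightarrow> exp list \<Rightarrow> (val list \<Rightarrow> nat \<Rightarrow> bool) \<Rightarrow> bool" where
  "wps P env es Q \<longleftrightarrow> (\<exists>vs t. evals P env es vs t \<and> Q vs t)"

text \<open>
  A call is kept as a constant of its own so that rewriting stops there.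
\<close>
definition call :: "program \<Rightarrow> nat \<Rightarrow> val list \<Rightarrow> (val \<Rightarrow> nat \<Rightarrow> bool) \<Rightarrow> bool" where
  "call P f vs Q \<longleftrightarrow> f < length P \<and> wp P vs (P ! f) Q"

lemma wp_Var: "i < length env \<Longrightarrow> wp P env (Var i) Q \<longleftrightarrow> Q (env ! i) 1"
  unfolding wp_def
  by (auto simp del: One_nat_def elim!: eval_VarE intro!: exI[of _ "env ! i"] exI[of _ "1::nat"] eval_Var) simp

lemma wp_Const: "wp P env (Const q) Q \<longleftrightarrow> Q (VNum (of_rat q)) 1"
  unfolding wp_def
  by (auto simp del: One_nat_def elim!: eval_ConstE intro!: exI[of _ "VNum (of_rat q)"] exI[of _ "1::nat"] eval_Const) simp

lemma wp_MkNil: "wp P env MkNil Q \<longleftrightarrow> Q VNil 1"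
  unfolding wp_def
  by (auto simp del: One_nat_def elim!: eval_MkNilE intro!: exI[of _ "VNil"] exI[of _ "1::nat"] eval_MkNil) simp

lemma wp_Op:
  "wp P env (Op f e1 e2) Q \<longleftrightarrow>
     wp P env e1 (\<lambda>v s. \<exists>a. v = VNum a \<and> wp P env e2 (\<lambda>w t. \<exists>b. w = VNum b \<and>
       Q (VNum (apply_op f a b)) (Suc (s + t))))"
  unfolding wp_def by (blast intro: eval_Op elim: eval_OpE)

lemma wp_IfLess:
  "wp P env (IfLess e1 e2 e3 e4) Q \<longleftrightarrow>
     wp P env e1 (\<lambda>v r. \<exists>a. v = VNum a \<and> wp P env e2 (\<lambda>w s. \<exists>b. w = VNum b \<and>
       (if a < b then wp P env e3 (\<lambda>z t. Q z (Suc (r + s + t)))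
        else wp P env e4 (\<lambda>z t. Q z (Suc (r + s + t))))))"
  (is "?L \<longleftrightarrow> ?R")
proof
  assume ?L
  then obtain v t where "eval P env (IfLess e1 e2 e3 e4) v t" "Q v t" by (auto simp: wp_def)
  then show ?R
    by (elim eval_IfLessE) (unfold wp_def, (rule exI conjI refl | assumption | simp)+)
next
  assume ?R
  then show ?L unfolding wp_def
    by (force split: if_splits intro: eval_IfLess_True eval_IfLess_False)
qed

lemma wp_MkPair:
  "wp P env (MkPair e1 e2) Q \<longleftrightarrow>
     wp P env e1 (\<lambda>v s. wp P env e2 (\<lambda>w t. Q (VPair v w) (Suc (s + t))))"
  unfolding wp_def by (blast intro: eval_MkPair elim: eval_MkPairE)

lemma wp_First:
  "wp P env (First e) Q \<longleftrightarrow> wp P env e (\<lambda>x t. \<exists>v w. x = VPair v w \<and> Q v (Suc t))"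
  unfolding wp_def by (blast intro: eval_First elim: eval_FirstE)

lemma wp_Second:
  "wp P env (Second e) Q \<longleftrightarrow> wp P env e (\<lambda>x t. \<exists>v w. x = VPair v w \<and> Q w (Suc t))"
  unfolding wp_def by (blast intro: eval_Second elim: eval_SecondE)

lemma wp_IfPair:
  "wp P env (IfPair e1 e2 e3) Q \<longleftrightarrow>
     wp P env e1 (\<lambda>x s. if \<exists>v w. x = VPair v w then wp P env e2 (\<lambda>z t. Q z (Suc (s + t)))
       else wp P env e3 (\<lambda>z t. Q z (Suc (s + t))))"
  (is "?L \<longleftrightarrow> ?R")
proof
  assume ?L
  then obtain v t where "eval P env (IfPair e1 e2 e3) v t" "Q v t" by (auto simp: wp_def)
  then show ?R
    by (elim eval_IfPairE) (unfold wp_def, (rule exI conjI refl | assumption | simp)+)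
next
  assume ?R
  then obtain x s where x: "eval P env e1 x s"
    "if \<exists>v w. x = VPair v w then wp P env e2 (\<lambda>z t. Q z (Suc (s + t)))
       else wp P env e3 (\<lambda>z t. Q z (Suc (s + t)))" unfolding wp_def by blast
  show ?L
  proof (cases "\<exists>v w. x = VPair v w")
    case True
    then show ?thesis using x unfolding wp_def by simp (blast intro: eval_IfPair_True)
  next
    case False
    then show ?thesis using x unfolding wp_def by (simp only: if_False) (blast intro: eval_IfPair_False)
  qed
qed

lemma wp_LetIn:
  "wp P env (LetIn e1 e2) Q \<longleftrightarrow>
     wp P env e1 (\<lambda>v s. wp P (v # env) e2 (\<lambda>w t. Q w (Suc (s + t))))"
  unfolding wp_def by (blast intro: eval_LetIn elim: eval_LetInE)

lemma wp_Call:
  "wp P env (Call f es) Q \<longleftrightarrow> wps P env es (\<lambda>vs s. call P f vs (\<lambda>v t. Q v (Suc (s + t))))"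
  unfolding wp_def wps_def call_def by (blast intro: eval_Call elim: eval_CallE)

lemma wps_Nil: "wps P env [] Q \<longleftrightarrow> Q [] 0"
  unfolding wps_def by (auto intro: evals_Nil elim: evals_NilE)

lemma wps_Cons:
  "wps P env (e # es) Q \<longleftrightarrow> wp P env e (\<lambda>v s. wps P env es (\<lambda>vs t. Q (v # vs) (s + t)))"
  unfolding wp_def wps_def by (blast intro: evals_Cons elim: evals_ConsE)

lemmas wp_simps = wp_Var wp_Const wp_MkNil wp_Op wp_IfLess wp_MkPair wp_First wp_Second wp_IfPair
  wp_LetIn wp_Call wps_Nil wps_Cons

definition computes :: "program \<Rightarrow> nat \<Rightarrow> val list \<Rightarrow> val \<Rightarrow> nat \<Rightarrow> bool" where
  "computes P f vs v B \<longleftrightarrow> call P f vs (\<lambda>v' t. v' = v \<and> t \<le> B)"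

text \<open>
  Evaluation is deterministic, so the result of a call that is known to terminate can be
  substituted for it; this equation eliminates calls during symbolic execution.
\<close>
lemma computesE:
  assumes "computes P f vs v B"
  obtains t where "t \<le> B" "\<And>Q. call P f vs Q \<longleftrightarrow> Q v t"
proof -
  from assms obtain t where t: "f < length P" "eval P vs (P ! f) v t" "t \<le> B"
    unfolding computes_def call_def wp_def by auto
  have "call P f vs Q \<longleftrightarrow> Q v t" for Q
    unfolding call_def wp_def using t(1,2) eval_deterministic(1)[OF t(2)] by blast
  with t(3) that show thesis by blast
qed

lemma val_of_list_simps [simp]:
  "val_of_list [] = VNil" "val_of_list (v # vs) = VPair v (val_of_list vs)"
  by (simp_all add: val_of_list_def)

section \<open>The program\<close>

definition val_of_fields :: "fields \<Rightarrow> val" where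
  "val_of_fields h = val_of_list (map (\<lambda>(u, d). VPair (VNum (real u)) (VNum d)) h)"

definition val_of_couplings :: "couplings \<Rightarrow> val" where
  "val_of_couplings E = val_of_list (map (\<lambda>(a, b, w). VPair (VNum (real a)) (VPair (VNum (real b))
     (val_of_list [VNum (w False False), VNum (w False True), VNum (w True False), VNum (w True True)]))) E)"

text \<open>
  An edge of a star is stored by the two slopes and the jump, the only numbers that the recursion
  needs.
\<close>
definition val_of_star :: "star \<Rightarrow> val" where
  "val_of_star I = val_of_list (map (\<lambda>(u, w). VPair (VNum (real u))
     (VPair (VNum (slope w False)) (VPair (VNum (slope w True)) (VNum (jump w False))))) I)"

lemma val_of_simps [simp]:
  "val_of_fields [] = VNil"
  "val_of_fields ((u, d) # h) = VPair (VPair (VNum (real u)) (VNum d)) (val_of_fields h)"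
  "val_of_couplings [] = VNil"
  "val_of_couplings ((a, b, w) # E) = VPair (VPair (VNum (real a)) (VPair (VNum (real b))
     (val_of_list [VNum (w False False), VNum (w False True), VNum (w True False), VNum (w True True)])))
     (val_of_couplings E)"
  "val_of_star [] = VNil"
  "val_of_star ((u, w) # I) = VPair (VPair (VNum (real u))
     (VPair (VNum (slope w False)) (VPair (VNum (slope w True)) (VNum (jump w False))))) (val_of_star I)"
  by (simp_all add: val_of_fields_def val_of_couplings_def val_of_star_def)

abbreviation (input) "MAIN \<equiv> 0 :: nat"
abbreviation (input) "FIELD_AT \<equiv> Suc 0"
abbreviation (input) "INCIDENT \<equiv> 2 :: nat"
abbreviation (input) "DELETE \<equiv> 3 :: nat"
abbreviation (input) "PUSH \<equiv> 4 :: nat"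
abbreviation (input) "GAP \<equiv> 5 :: nat"
abbreviation (input) "STAR_SUM \<equiv> 6 :: nat"
abbreviation (input) "GREEDY \<equiv> 7 :: nat"
abbreviation (input) "FIELDS \<equiv> 8 :: nat"
abbreviation (input) "COUNT \<equiv> 9 :: nat"

definition if_equal :: "exp \<Rightarrow> exp \<Rightarrow> exp \<Rightarrow> exp \<Rightarrow> exp" where
  "if_equal a b e e' = IfLess a b e' (IfLess b a e' e)"

definition field_at_code :: exp where
  "field_at_code = IfPair (Var 0)
     (if_equal (First (First (Var 0))) (Var 1)
       (Op Add (Second (First (Var 0))) (Call FIELD_AT [Second (Var 0), Var 1]))
       (Call FIELD_AT [Second (Var 0), Var 1]))
     (Const 0)"

definition nth_code :: "exp \<Rightarrow> nat \<Rightarrow> exp" where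
  "nth_code e k = First ((Second ^^ k) e)"

lemma nth_code_simps [simp]:
  "nth_code e 0 = First e" "nth_code e (Suc 0) = First (Second e)"
  "nth_code e 2 = First (Second (Second e))" "nth_code e 3 = First (Second (Second (Second e)))"
  by (simp_all add: nth_code_def numeral_2_eq_2 numeral_3_eq_3)

text \<open>
  In the innermost environment, \<open>Var 0\<close> is the list of the four rewards of the first edge, \<open>Var 1\<close>
  that edge, \<open>Var 2\<close> the result for the remaining edges and \<open>Var 4\<close> the node.  An edge whose second
  endpoint is the node is transposed.
\<close>
definition incident_code :: exp where
  "incident_code = IfPair (Var 0)
     (LetIn (Call INCIDENT [Second (Var 0), Var 1])
       (LetIn (First (Var 1))
         (LetIn (Second (Second (Var 0)))
           (if_equal (nth_code (Var 1) 0) (Var 4)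
             (MkPair (MkPair (nth_code (Var 1) 1)
                (MkPair (Op Sub (nth_code (Var 0) 1) (nth_code (Var 0) 0))
                  (MkPair (Op Sub (nth_code (Var 0) 3) (nth_code (Var 0) 2))
                    (Op Sub (nth_code (Var 0) 2) (nth_code (Var 0) 0))))) (Var 2))
             (if_equal (nth_code (Var 1) 1) (Var 4)
               (MkPair (MkPair (nth_code (Var 1) 0)
                  (MkPair (Op Sub (nth_code (Var 0) 2) (nth_code (Var 0) 0))
                    (MkPair (Op Sub (nth_code (Var 0) 3) (nth_code (Var 0) 1))
                      (Op Sub (nth_code (Var 0) 1) (nth_code (Var 0) 0))))) (Var 2))
               (Var 2))))))
     MkNil"

definition delete_code :: exp where
  "delete_code = IfPair (Var 0)
     (LetIn (Call DELETE [Second (Var 0), Var 1])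
       (if_equal (nth_code (First (Var 1)) 0) (Var 2) (Var 0)
         (if_equal (nth_code (First (Var 1)) 1) (Var 2) (Var 0)
           (MkPair (First (Var 1)) (Var 0)))))
     MkNil"

definition push_code :: exp where
  "push_code = IfPair (Var 1)
     (Call PUSH [Var 0, Second (Var 1),
        MkPair (MkPair (nth_code (First (Var 1)) 0)
            (IfLess (Const 0) (Var 0) (nth_code (First (Var 1)) 2) (nth_code (First (Var 1)) 1)))
          (Var 2)])
     (Var 2)"

text \<open>
  The depth of the recursion is controlled by a real number that is multiplied by \<open>\<theta>\<close> on every
  level and stops the recursion when it falls below 1.  This replaces the computation of a logarithm.
\<close>
definition gap_code :: "rat \<Rightarrow> exp" where
  "gap_code \<theta> = IfLess (Var 0) (Const 1) (Const 0)
     (Op Add (Call FIELD_AT [Var 1, Var 3])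
       (Call STAR_SUM [Op Mul (Var 0) (Const \<theta>), Var 1, Call DELETE [Var 2, Var 3],
          Call INCIDENT [Var 2, Var 3]]))"

definition positive_part_code :: "exp \<Rightarrow> exp" where
  "positive_part_code e = IfLess (Const 0) e e (Const 0)"

definition star_sum_code :: exp where
  "star_sum_code = IfPair (Var 3)
     (LetIn (First (Var 3))
       (Op Add
         (Call STAR_SUM [Var 1, MkPair (MkPair (nth_code (Var 0) 0) (nth_code (Var 0) 1)) (Var 2),
            Var 3, Second (Var 4)])
         (LetIn (Call GAP [Var 1, Call PUSH [Const 1, Second (Var 4), Var 2], Var 3, nth_code (Var 0) 0])
           (Op Sub (Op Add (Second (Second (Second (Var 1))))
                (positive_part_code (Op Add (Var 0) (nth_code (Var 1) 2))))
             (positive_part_code (Op Add (Var 0) (nth_code (Var 1) 1)))))))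
     (Const 0)"

definition greedy_code :: exp where
  "greedy_code = IfPair (Var 0)
     (LetIn (IfLess (Const 0) (Call GAP [Var 4, Var 2, Var 3, Var 1]) (Const 1) (Const 0))
       (MkPair (Var 0)
         (Call GREEDY [Second (Var 1), Op Add (Var 2) (Const 1),
            Call PUSH [Var 0, Call INCIDENT [Var 4, Var 2], Var 3],
            Call DELETE [Var 4, Var 2], Var 5])))
     MkNil"

definition fields_code :: exp where
  "fields_code = IfPair (Var 0)
     (MkPair (MkPair (Var 1) (Op Sub (nth_code (First (Var 0)) 1) (nth_code (First (Var 0)) 0)))
       (Call FIELDS [Second (Var 0), Op Add (Var 1) (Const 1)]))
     MkNil"

definition count_code :: exp where
  "count_code = IfPair (Var 0) (Call COUNT [Second (Var 0), Op Add (Var 1) (Const 1)]) (Var 1)"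

text \<open>
  The initial control number is \<open>c * (n + 1) / \<epsilon>\<close>.
\<close>
definition main_code :: "rat \<Rightarrow> exp" where
  "main_code c = Call GREEDY [First (Second (Var 0)), Const 0,
     Call FIELDS [First (Second (Var 0)), Const 0], Second (Second (Var 0)),
     Op Div (Op Mul (Const c) (Call COUNT [First (Second (Var 0)), Const 1])) (First (Var 0))]"

definition optimizer :: "rat \<Rightarrow> rat \<Rightarrow> program" where
  "optimizer \<theta> c = [main_code c, field_at_code, incident_code, delete_code, push_code,
     gap_code \<theta>, star_sum_code, greedy_code, fields_code, count_code]"

lemma optimizer_nth [simp]:
  "length (optimizer \<theta> c) = 10"
  "optimizer \<theta> c ! MAIN = main_code c" "optimizer \<theta> c ! Suc 0 = field_at_code"
  "optimizer \<theta> c ! INCIDENT = incident_code" "optimizer \<theta> c ! DELETE = delete_code"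
  "optimizer \<theta> c ! PUSH = push_code" "optimizer \<theta> c ! GAP = gap_code \<theta>"
  "optimizer \<theta> c ! STAR_SUM = star_sum_code" "optimizer \<theta> c ! GREEDY = greedy_code"
  "optimizer \<theta> c ! FIELDS = fields_code" "optimizer \<theta> c ! COUNT = count_code"
  by (simp_all add: optimizer_def)


lemma computesI:
  assumes "f < length P" "wp P vs (P ! f) (\<lambda>v' t. v' = v \<and> t \<le> B)"
  shows "computes P f vs v B"
  using assms by (simp add: computes_def call_def)


lemma computes_field_at:
  "computes (optimizer \<theta> c) FIELD_AT [val_of_fields h, VNum (real v)] (VNum (field_at h v))
     (40 * (length h + 1))"
proof (induction h)
  case Nil
  show ?case
    by (rule computesI) (simp_all add: field_at_code_def wp_simps)
next
  case (Cons p h)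
  obtain u d where [simp]: "p = (u, d)" by force
  from Cons obtain t where t: "t \<le> 40 * (length h + 1)"
    "\<And>Q. call (optimizer \<theta> c) FIELD_AT [val_of_fields h, VNum (real v)] Q = Q (VNum (field_at h v)) t"
    by (elim computesE) blast
  show ?case
    using t(1) by (intro computesI) (simp_all add: field_at_code_def wp_simps t(2) if_equal_def)
qed

lemma computes_incident:
  "computes (optimizer \<theta> c) INCIDENT [val_of_couplings E, VNum (real v)] (val_of_star (incident v E))
     (100 * (length E + 1))"
proof (induction E)
  case Nil
  show ?case
    by (rule computesI) (simp_all add: incident_code_def wp_simps)
next
  case (Cons p E)
  obtain a b w where [simp]: "p = (a, b, w)" by (cases p)
  from Cons obtain t where t: "t \<le> 100 * (length E + 1)"
    "\<And>Q. call (optimizer \<theta> c) INCIDENT [val_of_couplings E, VNum (real v)] Q = Q (val_of_star (incident v E)) t"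
    by (elim computesE) blast
  show ?case
    using t(1)
    by (intro computesI) (simp_all add: incident_code_def wp_simps t(2) if_equal_def slope_def jump_def)
qed

lemma computes_delete:
  "computes (optimizer \<theta> c) DELETE [val_of_couplings E, VNum (real v)] (val_of_couplings (delete_vertex v E))
     (60 * (length E + 1))"
proof (induction E)
  case Nil
  show ?case
    by (rule computesI) (simp_all add: delete_code_def wp_simps)
next
  case (Cons p E)
  obtain a b w where [simp]: "p = (a, b, w)" by (cases p)
  from Cons obtain t where t: "t \<le> 60 * (length E + 1)"
    "\<And>Q. call (optimizer \<theta> c) DELETE [val_of_couplings E, VNum (real v)] Q = Q (val_of_couplings (delete_vertex v E)) t"
    by (elim computesE) blast
  show ?case
    using t(1)
    by (intro computesI) (simp_all add: delete_code_def wp_simps t(2) if_equal_def)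
qed

lemma computes_push:
  "computes (optimizer \<theta> c) PUSH [VNum (of_bool b), val_of_star I, val_of_fields h]
     (val_of_fields (push b I h)) (60 * (length I + 1))"
proof (induction I arbitrary: h)
  case Nil
  show ?case
    by (rule computesI) (simp_all add: push_code_def wp_simps)
next
  case (Cons p I)
  obtain u w where [simp]: "p = (u, w)" by force
  from Cons[of "(u, slope w b) # h"] obtain t where t: "t \<le> 60 * (length I + 1)"
    "\<And>Q. call (optimizer \<theta> c) PUSH [VNum (of_bool b), val_of_star I, val_of_fields ((u, slope w b) # h)] Q
        = Q (val_of_fields (push b I ((u, slope w b) # h))) t"
    by (elim computesE) blast
  show ?case
    using t by (intro computesI; cases b) (simp_all add: push_code_def wp_simps)
qed


lemma length_push [simp]: "length (push b I h) = length I + length h"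
  by (induction b I h rule: push.induct) auto

lemma length_incident_delete: "length (incident v E) + length (delete_vertex v E) \<le> length E"
  by (induction v E rule: incident.induct) auto

lemma length_incident_delete_vertex: "length (incident u (delete_vertex v E)) \<le> length (incident u E)"
  by (induction E) (auto intro: le_SucI)

text \<open>
  \<open>k\<close> is the number of multiplications by \<open>\<theta>\<close> after which the control number \<open>r\<close> falls below 1.
\<close>
primrec depth :: "rat \<Rightarrow> real \<Rightarrow> nat \<Rightarrow> bool" where
  "depth \<theta> r 0 \<longleftrightarrow> r < 1"
| "depth \<theta> r (Suc k) \<longleftrightarrow> r \<ge> 1 \<and> depth \<theta> (r * of_rat \<theta>) k"

text \<open>
  \<open>N\<close> bounds the number of fields: moving an edge of the star into the fields keeps
  \<open>length h + length I\<close> constant, so a single bound serves the whole loop.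
\<close>
lemma computes_star_sum:
  assumes rec: "\<And>h u. length h \<le> N \<Longrightarrow>
      computes (optimizer \<theta> c) GAP [VNum r, val_of_fields h, val_of_couplings E, VNum (real u)] (VNum (f h E u)) B"
    and "length h + length I \<le> N"
  shows "computes (optimizer \<theta> c) STAR_SUM [VNum r, val_of_fields h, val_of_couplings E, val_of_star I]
     (VNum (star_sum f h E I)) (length I * (200 * (N + 1) + B) + 10)"
  using assms(2)
proof (induction I arbitrary: h)
  case Nil
  show ?case
    by (rule computesI) (simp_all add: star_sum_code_def wp_simps)
next
  case (Cons p I)
  obtain u w where [simp]: "p = (u, w)" by force
  have "computes (optimizer \<theta> c) STAR_SUM [VNum r, val_of_fields ((u, slope w False) # h), val_of_couplings E, val_of_star I]
     (VNum (star_sum f ((u, slope w False) # h) E I)) (length I * (200 * (N + 1) + B) + 10)"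
    using Cons.prems by (intro Cons.IH) simp
  then obtain t1 where t1: "t1 \<le> length I * (200 * (N + 1) + B) + 10"
    "\<And>Q. call (optimizer \<theta> c) STAR_SUM [VNum r, val_of_fields ((u, slope w False) # h), val_of_couplings E, val_of_star I] Q
       = Q (VNum (star_sum f ((u, slope w False) # h) E I)) t1"
    by (elim computesE) blast
  have "computes (optimizer \<theta> c) PUSH [VNum 1, val_of_star I, val_of_fields h]
     (val_of_fields (push True I h)) (60 * (length I + 1))"
    using computes_push[of \<theta> c True I h] by simp
  then obtain t2 where t2: "t2 \<le> 60 * (length I + 1)"
    "\<And>Q. call (optimizer \<theta> c) PUSH [VNum 1, val_of_star I, val_of_fields h] Q
       = Q (val_of_fields (push True I h)) t2"
    by (elim computesE) blast
  have "length (push True I h) \<le> N" using Cons.prems by simp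
  from rec[OF this, of u] obtain t3 where t3: "t3 \<le> B"
    "\<And>Q. call (optimizer \<theta> c) GAP [VNum r, val_of_fields (push True I h), val_of_couplings E, VNum (real u)] Q
       = Q (VNum (f (push True I h) E u)) t3"
    by (elim computesE) blast
  have "t1 + t2 + t3 + 100 \<le> length (p # I) * (200 * (N + 1) + B) + 10"
    using t1(1) t2(1) t3(1) Cons.prems by simp
  moreover have "max 0 x = (if 0 < x then x else 0)" for x :: real
    by simp
  ultimately show ?case
    by (intro computesI)
       (simp_all add: star_sum_code_def positive_part_code_def wp_simps t1(2)[simplified] t2(2) t3(2)
          influence_def jump_def)
qed

text \<open>
  With cost \<open>T\<close> one level below, a level costs at most \<open>\<Delta> * T\<close> for its recursive calls, and
  at most \<open>(\<Delta> + 2) * T\<close> for the traversals of the lists because \<open>T\<close> is at least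
  \<open>400 * (N + 1)\<close>; this gives the base \<open>2 * \<Delta> + 2\<close>.  \<open>N\<close> bounds the number of fields and edges,
  which no step increases.
\<close>
definition gap_cost :: "nat \<Rightarrow> nat \<Rightarrow> nat \<Rightarrow> nat" where
  "gap_cost \<Delta> N k = 400 * (N + 1) * (2 * \<Delta> + 2) ^ k"

lemma gap_cost_ge: "400 * (N + 1) \<le> gap_cost \<Delta> N k"
  by (simp add: gap_cost_def)

lemma computes_gap:
  assumes "depth \<theta> r k" "\<And>u. length (incident u E) \<le> \<Delta>" "length h + length E \<le> N"
  shows "computes (optimizer \<theta> c) GAP [VNum r, val_of_fields h, val_of_couplings E, VNum (real v)]
     (VNum (gap k h E v)) (gap_cost \<Delta> N k)"
  using assms
proof (induction k arbitrary: r h E v)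
  case 0
  then show ?case
    by (intro computesI) (simp_all add: gap_code_def wp_simps gap_cost_def)
next
  case (Suc k)
  define E' I where "E' = delete_vertex v E" and "I = incident v E"
  have len: "length I + length E' \<le> length E" unfolding E'_def I_def by (rule length_incident_delete)
  have "computes (optimizer \<theta> c) STAR_SUM [VNum (r * of_rat \<theta>), val_of_fields h, val_of_couplings E', val_of_star I]
     (VNum (star_sum (gap k) h E' I)) (length I * (200 * (N - length E' + 1) + gap_cost \<Delta> N k) + 10)"
  proof (rule computes_star_sum)
    show "computes (optimizer \<theta> c) GAP [VNum (r * of_rat \<theta>), val_of_fields h', val_of_couplings E', VNum (real u)]
        (VNum (gap k h' E' u)) (gap_cost \<Delta> N k)" if "length h' \<le> N - length E'" for h' u
    proof (rule Suc.IH)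
      show "depth \<theta> (r * of_rat \<theta>) k" using Suc.prems(1) by simp
      show "length (incident u E') \<le> \<Delta>" for u
        unfolding E'_def by (rule order_trans[OF length_incident_delete_vertex Suc.prems(2)])
      show "length h' + length E' \<le> N" using that len Suc.prems(3) by simp
    qed
    show "length h + length I \<le> N - length E'" using len Suc.prems(3) by simp
  qed
  then obtain t where t: "t \<le> length I * (200 * (N - length E' + 1) + gap_cost \<Delta> N k) + 10"
    "\<And>Q. call (optimizer \<theta> c) STAR_SUM [VNum (r * of_rat \<theta>), val_of_fields h, val_of_couplings E', val_of_star I] Q
       = Q (VNum (star_sum (gap k) h E' I)) t"
    by (elim computesE) blast
  obtain t1 where t1: "t1 \<le> 40 * (length h + 1)"
    "\<And>Q. call (optimizer \<theta> c) FIELD_AT [val_of_fields h, VNum (real v)] Q = Q (VNum (field_at h v)) t1"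
    by (rule computesE[OF computes_field_at]) blast
  obtain t2 where t2: "t2 \<le> 100 * (length E + 1)"
    "\<And>Q. call (optimizer \<theta> c) INCIDENT [val_of_couplings E, VNum (real v)] Q = Q (val_of_star I) t2"
    unfolding I_def by (rule computesE[OF computes_incident]) blast
  obtain t3 where t3: "t3 \<le> 60 * (length E + 1)"
    "\<And>Q. call (optimizer \<theta> c) DELETE [val_of_couplings E, VNum (real v)] Q = Q (val_of_couplings E') t3"
    unfolding E'_def by (rule computesE[OF computes_delete]) blast
  have "length I * (200 * (N - length E' + 1) + gap_cost \<Delta> N k) \<le> \<Delta> * (200 * (N + 1) + gap_cost \<Delta> N k)"
    unfolding I_def by (intro mult_mono Suc.prems(2)) auto
  also have "\<dots> \<le> \<Delta> * (2 * gap_cost \<Delta> N k)"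
    using gap_cost_ge[of N \<Delta> k] by (intro mult_left_mono) auto
  finally have "t + 40 * (length h + 1) + 160 * (length E + 1) + 30 \<le> gap_cost \<Delta> N (Suc k)"
    using t(1) gap_cost_ge[of N \<Delta> k] Suc.prems(3)
    by (simp add: gap_cost_def algebra_simps)
  then show ?case
    using Suc.prems(1) t1(1) t2(1) t3(1)
    by (intro computesI)
       (simp_all add: gap_code_def wp_simps t1(2) t2(2) t3(2) t(2) E'_def[symmetric] I_def[symmetric])
qed

lemma computes_greedy:
  assumes "depth \<theta> r k" "\<And>u. length (incident u E) \<le> \<Delta>" "length h + length E \<le> N"
  shows "computes (optimizer \<theta> c) GREEDY
     [val_of_list vs, VNum (real v), val_of_fields h, val_of_couplings E, VNum r]
     (val_of_list (map (\<lambda>b. VNum (of_bool b)) (greedy k [v..<v + length vs] h E)))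
     ((length vs + 1) * (2 * gap_cost \<Delta> N k))"
  using assms(2,3)
proof (induction vs arbitrary: v h E)
  case Nil
  then show ?case
    using gap_cost_ge[of N \<Delta> k] by (intro computesI) (simp_all add: greedy_code_def wp_simps)
next
  case (Cons x vs)
  define E' I where "E' = delete_vertex v E" and "I = incident v E"
  define b where "b \<longleftrightarrow> gap k h E v > 0"
  have len: "length I + length E' \<le> length E" unfolding E'_def I_def by (rule length_incident_delete)
  obtain t1 where t1: "t1 \<le> gap_cost \<Delta> N k"
    "\<And>Q. call (optimizer \<theta> c) GAP [VNum r, val_of_fields h, val_of_couplings E, VNum (real v)] Q
       = Q (VNum (gap k h E v)) t1"
    by (rule computesE[OF computes_gap[OF assms(1) Cons.prems]]) blast
  obtain t2 where t2: "t2 \<le> 100 * (length E + 1)"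
    "\<And>Q. call (optimizer \<theta> c) INCIDENT [val_of_couplings E, VNum (real v)] Q = Q (val_of_star I) t2"
    unfolding I_def by (rule computesE[OF computes_incident]) blast
  obtain t3 where t3: "t3 \<le> 60 * (length E + 1)"
    "\<And>Q. call (optimizer \<theta> c) DELETE [val_of_couplings E, VNum (real v)] Q = Q (val_of_couplings E') t3"
    unfolding E'_def by (rule computesE[OF computes_delete]) blast
  obtain t4 where t4: "t4 \<le> 60 * (length I + 1)"
    "\<And>Q. call (optimizer \<theta> c) PUSH [VNum (of_bool b), val_of_star I, val_of_fields h] Q
       = Q (val_of_fields (push b I h)) t4"
    by (rule computesE[OF computes_push]) blast
  have "computes (optimizer \<theta> c) GREEDY
     [val_of_list vs, VNum (real (Suc v)), val_of_fields (push b I h), val_of_couplings E', VNum r]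
     (val_of_list (map (\<lambda>b. VNum (of_bool b)) (greedy k [Suc v..<Suc v + length vs] (push b I h) E')))
     ((length vs + 1) * (2 * gap_cost \<Delta> N k))"
  proof (rule Cons.IH)
    show "length (incident u E') \<le> \<Delta>" for u
      unfolding E'_def by (rule order_trans[OF length_incident_delete_vertex Cons.prems(1)])
    show "length (push b I h) + length E' \<le> N" using len Cons.prems(2) by simp
  qed
  moreover define bs where "bs = greedy k [Suc v..<Suc v + length vs] (push b I h) E'"
  ultimately obtain t where t: "t \<le> (length vs + 1) * (2 * gap_cost \<Delta> N k)"
    "\<And>Q. call (optimizer \<theta> c) GREEDY
     [val_of_list vs, VNum (1 + real v), val_of_fields (push b I h), val_of_couplings E', VNum r] Q
      = Q (val_of_list (map (\<lambda>b. VNum (of_bool b)) bs)) t"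
    by (elim computesE) simp
  have eq: "greedy k [v..<v + length (x # vs)] h E = b # bs"
    by (subst upt_rec) (simp add: Let_def b_def E'_def I_def bs_def)
  have time: "t + t1 + t2 + t3 + t4 + 30 \<le> (length (x # vs) + 1) * (2 * gap_cost \<Delta> N k)"
    using t(1) t1(1) t2(1) t3(1) t4(1) gap_cost_ge[of N \<Delta> k] len Cons.prems(2) by simp
  have "computes (optimizer \<theta> c) GREEDY
     [val_of_list (x # vs), VNum (real v), val_of_fields h, val_of_couplings E, VNum r]
     (val_of_list (map (\<lambda>b. VNum (of_bool b)) (b # bs)))
     ((length (x # vs) + 1) * (2 * gap_cost \<Delta> N k))"
  proof (cases "gap k h E v > 0")
    case True
    then have b: "b = True" by (simp add: b_def)
    from True time show ?thesis
      unfolding b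
      by (intro computesI)
         (simp_all add: greedy_code_def wp_simps t1(2) t2(2) t3(2) t4(2)[unfolded b, simplified]
          t(2)[unfolded b] add.commute[of "real v" 1])
  next
    case False
    then have b: "b = False" by (simp add: b_def)
    from False time show ?thesis
      unfolding b
      by (intro computesI)
         (simp_all add: greedy_code_def wp_simps t1(2) t2(2) t3(2) t4(2)[unfolded b, simplified]
          t(2)[unfolded b] add.commute[of "real v" 1])
  qed
  then show ?case by (simp only: eq)
qed

lemma computes_fields:
  "computes (optimizer \<theta> c) FIELDS [val_of_list (map (\<lambda>(a, b). val_of_list [VNum a, VNum b]) ps), VNum (real v)]
     (val_of_fields (zip [v..<v + length ps] (map (\<lambda>(a, b). b - a) ps))) (60 * (length ps + 1))"
proof (induction ps arbitrary: v)
  case Nil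
  show ?case
    by (rule computesI) (simp_all add: fields_code_def wp_simps)
next
  case (Cons p ps)
  obtain a b where [simp]: "p = (a, b)" by force
  obtain t where t: "t \<le> 60 * (length ps + 1)"
    "\<And>Q. call (optimizer \<theta> c) FIELDS [val_of_list (map (\<lambda>(a, b). val_of_list [VNum a, VNum b]) ps), VNum (real (Suc v))] Q
     = Q (val_of_fields (zip [Suc v..<Suc v + length ps] (map (\<lambda>(a, b). b - a) ps))) t"
    using Cons[of "Suc v"] by (elim computesE) blast
  have eq: "zip [v..<v + length (p # ps)] (map (\<lambda>(a, b). b - a) (p # ps)) =
     (v, b - a) # zip [Suc v..<Suc v + length ps] (map (\<lambda>(a, b). b - a) ps)"
    by (subst upt_rec) simp
  show ?case
    using t(1) unfolding eq
    by (intro computesI) (simp_all add: fields_code_def wp_simps t(2)[simplified] add.commute[of "real v" 1])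
qed

lemma computes_count:
  "computes (optimizer \<theta> c) COUNT [val_of_list vs, VNum x] (VNum (x + real (length vs)))
     (20 * (length vs + 1))"
proof (induction vs arbitrary: x)
  case Nil
  show ?case
    by (rule computesI) (simp_all add: count_code_def wp_simps)
next
  case (Cons v vs)
  obtain t where t: "t \<le> 20 * (length vs + 1)"
    "\<And>Q. call (optimizer \<theta> c) COUNT [val_of_list vs, VNum (x + 1)] Q = Q (VNum (x + 1 + real (length vs))) t"
    using Cons[of "x + 1"] by (elim computesE) blast
  show ?case
    using t(1) by (intro computesI) (simp_all add: count_code_def wp_simps t(2) add.assoc)
qed

lemma optimizer_runs:
  assumes "depth \<theta> (of_rat c * real (length ps + 1) / \<epsilon>) k"
    and "\<And>u. length (incident u E) \<le> \<Delta>"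
    and "h = zip [0..<length ps] (map (\<lambda>(a, b). b - a) ps)"
  shows "\<exists>t. runs (optimizer \<theta> c)
      (VPair (VNum \<epsilon>) (VPair (val_of_list (map (\<lambda>(a, b). val_of_list [VNum a, VNum b]) ps)) (val_of_couplings E)))
      (val_of_list (map (\<lambda>b. VNum (of_bool b)) (greedy k [0..<length ps] h E))) t
     \<and> t \<le> (length ps + 2) * (2 * gap_cost \<Delta> (length ps + length E) k)"
proof -
  define vs where "vs = map (\<lambda>(a, b). val_of_list [VNum a, VNum b]) ps"
  define N where "N = length ps + length E"
  have [simp]: "length vs = length ps" by (simp add: vs_def)
  obtain t1 where t1: "t1 \<le> 60 * (length ps + 1)"
    "\<And>Q. call (optimizer \<theta> c) FIELDS [val_of_list vs, VNum 0] Q = Q (val_of_fields h) t1"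
    using computes_fields[of \<theta> c ps 0] unfolding vs_def assms(3) by (elim computesE) auto
  obtain t2 where t2: "t2 \<le> 20 * (length ps + 1)"
    "\<And>Q. call (optimizer \<theta> c) COUNT [val_of_list vs, VNum 1] Q = Q (VNum (1 + real (length ps))) t2"
    using computes_count[of \<theta> c vs 1] by (elim computesE) auto
  have "depth \<theta> (of_rat c * (1 + real (length ps)) / \<epsilon>) k" using assms(1) by (simp add: add.commute)
  moreover have "length h + length E \<le> N" by (simp add: assms(3) N_def)
  ultimately have "computes (optimizer \<theta> c) GREEDY
       [val_of_list vs, VNum 0, val_of_fields h, val_of_couplings E, VNum (of_rat c * (1 + real (length ps)) / \<epsilon>)]
       (val_of_list (map (\<lambda>b. VNum (of_bool b)) (greedy k [0..<length ps] h E)))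
       ((length ps + 1) * (2 * gap_cost \<Delta> N k))"
    using computes_greedy[of \<theta> _ k E \<Delta> h N c vs 0, OF _ assms(2)] by simp
  then obtain t3 where t3: "t3 \<le> (length ps + 1) * (2 * gap_cost \<Delta> N k)"
    "\<And>Q. call (optimizer \<theta> c) GREEDY
       [val_of_list vs, VNum 0, val_of_fields h, val_of_couplings E, VNum (of_rat c * (1 + real (length ps)) / \<epsilon>)] Q
     = Q (val_of_list (map (\<lambda>b. VNum (of_bool b)) (greedy k [0..<length ps] h E))) t3"
    by (elim computesE) blast
  have "t1 + t2 + t3 + 50 \<le> (length ps + 2) * (2 * gap_cost \<Delta> N k)"
    using t1(1) t2(1) t3(1) gap_cost_ge[of N \<Delta> k] by (simp add: N_def)
  then have "wp (optimizer \<theta> c) [VPair (VNum \<epsilon>) (VPair (val_of_list vs) (val_of_couplings E))] (main_code c)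
    (\<lambda>v t. v = val_of_list (map (\<lambda>b. VNum (of_bool b)) (greedy k [0..<length ps] h E))
       \<and> t \<le> (length ps + 2) * (2 * gap_cost \<Delta> N k))"
    by (simp add: main_code_def wp_simps t1(2) t2(2) t3(2))
  then show ?thesis
    unfolding runs_def wp_def vs_def N_def by (auto simp: optimizer_def)
qed

section \<open>Decision networks in list form\<close>

definition fields_of :: "nat \<Rightarrow> (reward_index \<Rightarrow> real) \<Rightarrow> fields" where
  "fields_of n \<phi> = map (\<lambda>v. (v, \<phi> (Node_Reward v 1) - \<phi> (Node_Reward v 0))) [0..<n]"

definition edge_weight :: "(reward_index \<Rightarrow> real) \<Rightarrow> nat \<Rightarrow> nat \<Rightarrow> weight" where
  "edge_weight \<phi> u v x y = \<phi> (Edge_Reward u v (of_bool x) (of_bool y))"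

definition couplings_of :: "nat \<Rightarrow> (nat \<times> nat) set \<Rightarrow> (reward_index \<Rightarrow> real) \<Rightarrow> couplings" where
  "couplings_of n E \<phi> = map (\<lambda>(u, v). (u, v, edge_weight \<phi> u v)) (edge_list n E)"

definition neighbours :: "(nat \<times> nat) set \<Rightarrow> nat \<Rightarrow> nat set" where
  "neighbours E v = {w. (v, w) \<in> E \<or> (w, v) \<in> E}"

lemma simple_graphD:
  assumes "simple_graph n E" "(u, v) \<in> E" shows "u < v" "v < n" "u < n"
  using assms by (force simp: simple_graph_def)+

lemma set_edge_list: "simple_graph n E \<Longrightarrow> set (edge_list n E) = E"
  unfolding edge_list_def by (auto dest: simple_graphD)

lemma distinct_edge_list: "distinct (edge_list n E)"
  by (simp add: edge_list_def distinct_product)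

lemma finite_simple_graph: "simple_graph n E \<Longrightarrow> finite E"
  by (metis set_edge_list List.finite_set)

lemma length_edge_list: "length (edge_list n E) \<le> n * n"
  unfolding edge_list_def by (rule order_trans[OF length_filter_le]) simp

lemma neighbours_subset: "simple_graph n E \<Longrightarrow> neighbours E v \<subseteq> {..<n}"
  by (auto simp: neighbours_def dest: simple_graphD)

lemma finite_neighbours: "simple_graph n E \<Longrightarrow> finite (neighbours E v)"
  by (metis neighbours_subset finite_lessThan finite_subset)

lemma couplings_on_couplings_of: "simple_graph n E \<Longrightarrow> couplings_on {..<n} (couplings_of n E \<phi>)"
  by (force simp: couplings_on_def couplings_of_def set_edge_list dest: simple_graphD)

lemma incident_map:
  assumes "distinct L" "\<forall>(a, b)\<in>set L. a < b"
  shows "distinct (map fst (incident v (map (\<lambda>(a, b). (a, b, W a b)) L)))"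
    and "set (map fst (incident v (map (\<lambda>(a, b). (a, b, W a b)) L))) =
           {u. (v, u) \<in> set L \<or> (u, v) \<in> set L}"
proof -
  show set: "set (map fst (incident v (map (\<lambda>(a, b). (a, b, W a b)) L))) =
           {u. (v, u) \<in> set L \<or> (u, v) \<in> set L}" for L
  proof (induction L)
    case (Cons e L)
    obtain a b where e: "e = (a, b)" by force
    show ?case using Cons by (auto simp: e simp del: set_map)
  qed simp
  show "distinct (map fst (incident v (map (\<lambda>(a, b). (a, b, W a b)) L)))"
    using assms
  proof (induction L)
    case (Cons e L)
    obtain a b where e: "e = (a, b)" by force
    have "(b, a) \<notin> set L" using Cons.prems e by auto
    then show ?case
      using Cons set[of L] by (auto simp: e image_iff simp del: set_map)
  qed simp
qed

lemma incident_couplings_of: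
  assumes "simple_graph n E"
  shows "distinct (map fst (incident v (couplings_of n E \<phi>)))"
    and "fst ` set (incident v (couplings_of n E \<phi>)) = neighbours E v"
proof -
  have *: "\<forall>(a, b)\<in>set (edge_list n E). a < b"
    using assms by (auto simp: set_edge_list dest: simple_graphD)
  show "distinct (map fst (incident v (couplings_of n E \<phi>)))"
    unfolding couplings_of_def by (rule incident_map(1)[OF distinct_edge_list *])
  show "fst ` set (incident v (couplings_of n E \<phi>)) = neighbours E v"
    using incident_map(2)[OF distinct_edge_list *, of v "edge_weight \<phi>"] assms
    by (simp add: couplings_of_def neighbours_def set_edge_list)
qed

lemma length_incident_couplings_of:
  assumes "simple_graph n E" "\<forall>v<n. node_degree E v \<le> \<Delta>"
  shows "length (incident v (couplings_of n E \<phi>)) \<le> \<Delta>"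
proof -
  have "length (incident v (couplings_of n E \<phi>)) = card (neighbours E v)"
    using incident_couplings_of[OF assms(1), of v \<phi>] by (metis distinct_card length_map list.set_map)
  also have "\<dots> \<le> \<Delta>"
  proof (cases "v < n")
    case True
    then show ?thesis using assms(2) by (auto simp: node_degree_def neighbours_def)
  next
    case False
    then have "neighbours E v = {}" by (auto simp: neighbours_def dest: simple_graphD[OF assms(1)])
    then show ?thesis by simp
  qed
  finally show ?thesis .
qed

lemma encode_input_eq:
  "encode_input 2 n E \<phi> \<epsilon> = VPair (VNum \<epsilon>) (VPair
     (val_of_list (map (\<lambda>(a, b). val_of_list [VNum a, VNum b])
        (map (\<lambda>v. (\<phi> (Node_Reward v 0), \<phi> (Node_Reward v 1))) [0..<n])))
     (val_of_couplings (couplings_of n E \<phi>)))"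
proof -
  have two: "[0..<2] = [0, Suc 0]" by (simp add: upt_rec)
  show ?thesis
    by (simp add: encode_input_def encode_node_def[abs_def] encode_edge_def val_of_couplings_def
        couplings_of_def two comp_def split_def edge_weight_def)
qed

definition node_set :: "nat \<Rightarrow> (nat \<Rightarrow> nat) \<Rightarrow> nat set" where
  "node_set n x = {v. v < n \<and> x v = 1}"

text \<open>
  Fields record only the differences of node rewards, so the sum of all \<open>\<Phi>\<^sub>v(0)\<close> is a common offset.
\<close>
lemma total_reward_eq:
  assumes "simple_graph n E" "x \<in> solutions 2 n"
  shows "total_reward n E \<phi> x =
     reward (fields_of n \<phi>) (couplings_of n E \<phi>) (node_set n x) + (\<Sum>v<n. \<phi> (Node_Reward v 0))"
proof -
  have x: "x v = of_bool (v \<in> node_set n x)" if "v < n" for v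
    using assms(2) that by (auto simp: solutions_def node_set_def PiE_iff less_2_cases_iff)
  have nodes: "(\<Sum>(u, d)\<leftarrow>fields_of n \<phi>. if u \<in> node_set n x then d else 0) + (\<Sum>v<n. \<phi> (Node_Reward v 0))
      = (\<Sum>v<n. \<phi> (Node_Reward v (x v)))"
    unfolding fields_of_def
    by (simp add: comp_def interv_sum_list_conv_sum_set_nat flip: atLeast0LessThan sum.distrib)
       (rule sum.cong, auto simp: x)
  have "(\<Sum>(a, b, w)\<leftarrow>couplings_of n E \<phi>. w (a \<in> node_set n x) (b \<in> node_set n x)) =
      (\<Sum>(u, v)\<in>E. \<phi> (Edge_Reward u v (x u) (x v)))"
    using simple_graphD[OF assms(1)]
    by (auto simp: couplings_of_def comp_def split_def sum_list_distinct_conv_sum_set distinct_edge_list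
        set_edge_list[OF assms(1)] edge_weight_def x intro!: sum.cong)
  with nodes show ?thesis by (simp add: total_reward_def reward_def)
qed

lemma finite_solutions: "finite (solutions T n)"
  by (simp add: solutions_def finite_PiE)

lemma node_set_image: "node_set n ` solutions 2 n = Pow {..<n}"
proof
  show "Pow {..<n} \<subseteq> node_set n ` solutions 2 n"
  proof
    fix S assume "S \<in> Pow {..<n}"
    then have "S = node_set n (\<lambda>v\<in>{..<n}. of_bool (v \<in> S))"
      by (auto simp: node_set_def)
    moreover have "(\<lambda>v\<in>{..<n}. of_bool (v \<in> S)) \<in> solutions 2 n"
      by (auto simp: solutions_def)
    ultimately show "S \<in> node_set n ` solutions 2 n"
      by (rule image_eqI)
  qed
qed (auto simp: node_set_def)

lemma optimal_reward_eq:
  assumes "simple_graph n E"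
  shows "optimal_reward 2 n E \<phi> =
     best {..<n} (fields_of n \<phi>) (couplings_of n E \<phi>) + (\<Sum>v<n. \<phi> (Node_Reward v 0))"
proof -
  let ?c = "\<Sum>v<n. \<phi> (Node_Reward v 0)"
  have "total_reward n E \<phi> ` solutions 2 n =
     (\<lambda>S. ?c + reward (fields_of n \<phi>) (couplings_of n E \<phi>) S) ` node_set n ` solutions 2 n"
    unfolding image_image by (intro image_cong refl) (simp add: total_reward_eq[OF assms])
  then show ?thesis
    unfolding optimal_reward_def best_def node_set_image
    using Max_image_add_left[of "Pow {..<n}" ?c "reward (fields_of n \<phi>) (couplings_of n E \<phi>)"]
    by (simp add: Pow_not_empty)
qed

definition solution_of :: "nat \<Rightarrow> bool list \<Rightarrow> nat \<Rightarrow> nat" where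
  "solution_of n bs = (\<lambda>v\<in>{..<n}. of_bool (bs ! v))"

lemma solution_of_in: "solution_of n bs \<in> solutions 2 n"
  by (auto simp: solution_of_def solutions_def)

lemma node_set_solution_of: "length bs = n \<Longrightarrow> node_set n (solution_of n bs) = chosen [0..<n] bs"
  by (auto simp: node_set_def solution_of_def chosen_def in_set_zip split: if_splits)
     (metis add_0 nth_upt)

lemma encode_solution_of:
  "length bs = n \<Longrightarrow> encode_solution n (solution_of n bs) = val_of_list (map (\<lambda>b. VNum (of_bool b)) bs)"
  unfolding encode_solution_def solution_of_def
  by (rule arg_cong[where f = val_of_list]) (rule nth_equalityI, auto)

definition adjacent :: "(nat \<times> nat) set \<Rightarrow> nat \<Rightarrow> nat \<Rightarrow> bool" where
  "adjacent E u v \<longleftrightarrow> v \<in> neighbours E u"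

definition paths :: "nat \<Rightarrow> (nat \<times> nat) set \<Rightarrow> nat \<Rightarrow> nat list set" where
  "paths n E k = {p. length p = k \<and> distinct p \<and> set p \<subseteq> {..<n} \<and> successively (adjacent E) p}"

text \<open>
  The nodes are distinct because every visited node is deleted.
\<close>
lemma undecided_path_list:
  assumes "undecided_path U C (Suc k) v" "couplings_on V C" "v \<in> V"
  shows "\<exists>p. length p = Suc k \<and> hd p = v \<and> distinct p \<and> set p \<subseteq> U \<inter> V \<and>
     successively (\<lambda>a b. b \<in> fst ` set (incident a C)) p"
  using assms
proof (induction k arbitrary: C v V)
  case 0
  then show ?case by (intro exI[of _ "[v]"]) auto
next
  case (Suc k)
  from Suc.prems(1) obtain u w where u: "(u, w) \<in> set (incident v C)" "v \<in> U"
    "undecided_path U (delete_vertex v C) (Suc k) u" by auto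
  from Suc.IH[OF u(3) couplings_on_delete_vertex[OF Suc.prems(2)] incident_in[OF Suc.prems(2) u(1)]]
  obtain p where p: "length p = Suc k" "hd p = u" "distinct p" "set p \<subseteq> U \<inter> (V - {v})"
    "successively (\<lambda>a b. b \<in> fst ` set (incident a (delete_vertex v C))) p" by blast
  have "successively (\<lambda>a b. b \<in> fst ` set (incident a C)) p"
    using p(5) by (rule successively_mono) (use incident_delete_vertex in blast)
  moreover have "u \<in> fst ` set (incident v C)" using u(1) by force
  ultimately have "successively (\<lambda>a b. b \<in> fst ` set (incident a C)) (v # p)"
    using p(1,2) by (cases p) auto
  then show ?case
    using p u(2) Suc.prems(3) by (intro exI[of _ "v # p"]) auto
qed

definition run_greedy :: "nat \<Rightarrow> nat \<Rightarrow> (nat \<times> nat) set \<Rightarrow> (reward_index \<Rightarrow> real) \<Rightarrow> bool list" where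
  "run_greedy k n E \<phi> = greedy k [0..<n] (fields_of n \<phi>) (couplings_of n E \<phi>)"

text \<open>
  An instance of \<open>greedy_optimal\<close>, with \<open>U\<close> the set of the undecided nodes of the whole network.
\<close>
theorem greedy_solution_optimal:
  assumes "simple_graph n E"
    and "\<And>p. p \<in> paths n E k \<Longrightarrow> \<exists>v\<in>set p. decided (fields_of n \<phi>) (couplings_of n E \<phi>) v"
  shows "total_reward n E \<phi> (solution_of n (run_greedy k n E \<phi>)) = optimal_reward 2 n E \<phi>"
proof -
  let ?h = "fields_of n \<phi>" and ?C = "couplings_of n E \<phi>"
  define U where "U = {v. \<not> decided ?h ?C v}"
  have C: "couplings_on {..<n} ?C" by (rule couplings_on_couplings_of[OF assms(1)])
  have "\<not> undecided_path U ?C k v" if "v < n" for v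
  proof
    assume path: "undecided_path U ?C k v"
    have "k \<noteq> 0" using assms(2)[of "[]"] by (auto simp: paths_def)
    then obtain j where k: "k = Suc j" by (cases k) auto
    from undecided_path_list[OF path[unfolded k] C] that
    obtain p where p: "length p = k" "distinct p" "set p \<subseteq> U \<inter> {..<n}"
      "successively (\<lambda>a b. b \<in> fst ` set (incident a ?C)) p" unfolding k by auto
    then have "p \<in> paths n E k"
      by (auto simp: paths_def adjacent_def[abs_def] incident_couplings_of(2)[OF assms(1)])
    from assms(2)[OF this] p(3) show False by (auto simp: U_def)
  qed
  then have "reward ?h ?C (chosen [0..<n] (greedy k [0..<n] ?h ?C)) = best (set [0..<n]) ?h ?C"
    using C by (intro greedy_optimal[where U = U]) (auto simp: U_def atLeast0LessThan)
  then show ?thesis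
    using assms(1)
    by (simp add: total_reward_eq[OF _ solution_of_in] optimal_reward_eq run_greedy_def
        node_set_solution_of atLeast0LessThan)
qed

section \<open>Counting self-avoiding paths\<close>

lemma finite_paths: "finite (paths n E k)"
  by (rule finite_subset[OF _ finite_lists_length_eq[of "{..<n}" k]]) (auto simp: paths_def)

lemma card_paths_Suc:
  assumes "\<And>p. p \<in> paths n E k \<Longrightarrow> card {v. v # p \<in> paths n E (Suc k)} \<le> b"
  shows "card (paths n E (Suc k)) \<le> card (paths n E k) * b"
proof -
  have "paths n E (Suc k) \<subseteq> (\<Union>p\<in>paths n E k. (\<lambda>v. v # p) ` {v. v # p \<in> paths n E (Suc k)})"
  proof
    fix q assume q: "q \<in> paths n E (Suc k)"
    then obtain v p where [simp]: "q = v # p" by (cases q) (auto simp: paths_def)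
    have "p \<in> paths n E k" using q by (auto simp: paths_def successively_Cons)
    with q show "q \<in> (\<Union>p\<in>paths n E k. (\<lambda>v. v # p) ` {v. v # p \<in> paths n E (Suc k)})" by auto
  qed
  moreover have fin: "finite {v. v # p \<in> paths n E (Suc k)}" for p
    by (rule finite_subset[of _ "{..<n}"]) (auto simp: paths_def)
  ultimately have "card (paths n E (Suc k)) \<le> card (\<Union>p\<in>paths n E k. (\<lambda>v. v # p) ` {v. v # p \<in> paths n E (Suc k)})"
    by (intro card_mono) (auto simp: finite_paths)
  also have "\<dots> \<le> (\<Sum>p\<in>paths n E k. card ((\<lambda>v. v # p) ` {v. v # p \<in> paths n E (Suc k)}))"
    by (rule card_UN_le[OF finite_paths])
  also have "\<dots> \<le> (\<Sum>p\<in>paths n E k. b)"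
    by (intro sum_mono order_trans[OF card_image_le[OF fin]] assms)
  finally show ?thesis by simp
qed

text \<open>
  Paths grow at the front.  From the third node on, one of the at most \<open>\<Delta>\<close> neighbours of the
  current front node is already on the path.
\<close>
lemma card_paths:
  assumes "simple_graph n E" "\<forall>v<n. node_degree E v \<le> \<Delta>"
  shows "card (paths n E (k + 2)) \<le> n * \<Delta> * (\<Delta> - 1) ^ k"
proof (induction k)
  have nb: "card (neighbours E v) \<le> \<Delta>" if "v < n" for v
    using assms(2) that by (auto simp: node_degree_def neighbours_def)
  case 0
  have "paths n E 1 = (\<lambda>v. [v]) ` {..<n}"
    by (auto simp: paths_def length_Suc_conv)
  then have "card (paths n E 1) \<le> n" by (simp add: card_image_le[where A = "{..<n}", simplified])
  moreover have "card (paths n E (Suc 1)) \<le> card (paths n E 1) * \<Delta>"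
  proof (rule card_paths_Suc)
    fix p assume "p \<in> paths n E 1"
    then obtain u where p: "p = [u]" "u < n" by (auto simp: paths_def length_Suc_conv)
    have "{v. v # p \<in> paths n E (Suc 1)} \<subseteq> neighbours E u"
      by (auto simp: p paths_def adjacent_def neighbours_def)
    then show "card {v. v # p \<in> paths n E (Suc 1)} \<le> \<Delta>"
      using nb[OF p(2)] card_mono[OF finite_neighbours[OF assms(1)]] order_trans by blast
  qed
  ultimately have "card (paths n E (Suc 1)) \<le> n * \<Delta>"
    using mult_le_mono1 order_trans by blast
  then show ?case by (simp add: numeral_2_eq_2)
next
  case (Suc k)
  have nb: "card (neighbours E v) \<le> \<Delta>" if "v < n" for v
    using assms(2) that by (auto simp: node_degree_def neighbours_def)
  have "card (paths n E (Suc (k + 2))) \<le> card (paths n E (k + 2)) * (\<Delta> - 1)"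
  proof (rule card_paths_Suc)
    fix p assume p: "p \<in> paths n E (k + 2)"
    then obtain u w q where [simp]: "p = u # w # q"
      by (auto simp: paths_def numeral_2_eq_2 length_Suc_conv)
    have uw: "u < n" "w \<in> neighbours E u" using p by (auto simp: paths_def adjacent_def)
    have "{v. v # p \<in> paths n E (Suc (k + 2))} \<subseteq> neighbours E u - {w}"
      by (auto simp: paths_def adjacent_def neighbours_def)
    then have "card {v. v # p \<in> paths n E (Suc (k + 2))} \<le> card (neighbours E u - {w})"
      by (intro card_mono) (auto simp: finite_neighbours[OF assms(1)])
    also have "\<dots> = card (neighbours E u) - 1"
      using uw(2) by simp
    finally show "card {v. v # p \<in> paths n E (Suc (k + 2))} \<le> \<Delta> - 1"
      using nb[OF uw(1)] by linarith
  qed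
  also have "\<dots> \<le> n * \<Delta> * (\<Delta> - 1) ^ k * (\<Delta> - 1)"
    using Suc by (rule mult_le_mono1)
  finally show ?case by (simp add: mult_ac)
qed

section \<open>Measurability\<close>

text \<open>
  Lists that depend on the outcome, but whose lengths and node numbers do not.  All steps of
  the algorithm except for the greedy choice preserve this form, and the choice splits the sample
  space into two measurable parts.
\<close>
inductive random_fields :: "'w measure \<Rightarrow> ('w \<Rightarrow> fields) \<Rightarrow> bool" for M where
  "random_fields M (\<lambda>\<omega>. [])"
| "d \<in> borel_measurable M \<Longrightarrow> random_fields M h \<Longrightarrow> random_fields M (\<lambda>\<omega>. (u, d \<omega>) # h \<omega>)"

inductive random_star :: "'w measure \<Rightarrow> ('w \<Rightarrow> star) \<Rightarrow> bool" for M where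
  "random_star M (\<lambda>\<omega>. [])"
| "(\<And>x y. (\<lambda>\<omega>. w \<omega> x y) \<in> borel_measurable M) \<Longrightarrow> random_star M I \<Longrightarrow>
     random_star M (\<lambda>\<omega>. (u, w \<omega>) # I \<omega>)"

inductive random_couplings :: "'w measure \<Rightarrow> ('w \<Rightarrow> couplings) \<Rightarrow> bool" for M where
  "random_couplings M (\<lambda>\<omega>. [])"
| "(\<And>x y. (\<lambda>\<omega>. w \<omega> x y) \<in> borel_measurable M) \<Longrightarrow> random_couplings M C \<Longrightarrow>
     random_couplings M (\<lambda>\<omega>. (a, b, w \<omega>) # C \<omega>)"

lemma random_incident: "random_couplings M C \<Longrightarrow> random_star M (\<lambda>\<omega>. incident v (C \<omega>))"
proof (induction rule: random_couplings.induct)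
  case (2 w C a b)
  have "random_star M (\<lambda>\<omega>. (b, w \<omega>) # incident v (C \<omega>))"
    "random_star M (\<lambda>\<omega>. (a, \<lambda>x y. w \<omega> y x) # incident v (C \<omega>))"
    using 2 by (auto intro: random_star.intros)
  then show ?case using 2 by (cases "a = v"; cases "b = v") simp_all
qed (simp add: random_star.intros)

lemma random_delete_vertex:
  "random_couplings M C \<Longrightarrow> random_couplings M (\<lambda>\<omega>. delete_vertex v (C \<omega>))"
proof (induction rule: random_couplings.induct)
  case (2 w C a b)
  have "random_couplings M (\<lambda>\<omega>. (a, b, w \<omega>) # delete_vertex v (C \<omega>))"
    using 2 by (auto intro: random_couplings.intros)
  then show ?case using 2 by (cases "a = v"; cases "b = v") simp_all
qed (simp add: random_couplings.intros)

lemma random_push: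
  "random_star M I \<Longrightarrow> random_fields M h \<Longrightarrow> random_fields M (\<lambda>\<omega>. push b (I \<omega>) (h \<omega>))"
proof (induction arbitrary: h rule: random_star.induct)
  case (2 w I u)
  have "random_fields M (\<lambda>\<omega>. (u, slope (w \<omega>) b) # h \<omega>)"
    unfolding slope_def using 2 by (intro random_fields.intros borel_measurable_diff)
  from "2.IH"[OF this] show ?case by simp
qed simp

lemma measurable_field_at:
  "random_fields M h \<Longrightarrow> (\<lambda>\<omega>. field_at (h \<omega>) v) \<in> borel_measurable M"
proof (induction rule: random_fields.induct)
  case (2 d h u)
  then show ?case by (cases "u = v") simp_all
qed simp

lemma measurable_star_sum:
  assumes "random_star M I" "random_fields M h"
    and f: "\<And>h u. random_fields M h \<Longrightarrow> (\<lambda>\<omega>. f (h \<omega>) (C \<omega>) u) \<in> borel_measurable M"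
  shows "(\<lambda>\<omega>. star_sum f (h \<omega>) (C \<omega>) (I \<omega>)) \<in> borel_measurable M"
  using assms(1,2)
proof (induction arbitrary: h rule: random_star.induct)
  case (2 w I u)
  note [measurable] = 2(1)
  have "random_fields M (\<lambda>\<omega>. (u, slope (w \<omega>) False) # h \<omega>)"
    unfolding slope_def using 2 by (intro random_fields.intros borel_measurable_diff)
  from "2.IH"[OF this]
  have [measurable]: "(\<lambda>\<omega>. star_sum f ((u, slope (w \<omega>) False) # h \<omega>) (C \<omega>) (I \<omega>)) \<in> borel_measurable M" .
  have [measurable]: "(\<lambda>\<omega>. f (push True (I \<omega>) (h \<omega>)) (C \<omega>) u) \<in> borel_measurable M"
    using 2 by (intro f random_push)
  show ?case unfolding star_sum.simps influence_def slope_def[of _ True] slope_def[of _ False]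
    using \<open>(\<lambda>\<omega>. star_sum f ((u, slope (w \<omega>) False) # h \<omega>) (C \<omega>) (I \<omega>)) \<in> borel_measurable M\<close>
    unfolding slope_def by measurable
qed simp

lemma measurable_gap:
  assumes "random_fields M h" "random_couplings M C"
  shows "(\<lambda>\<omega>. gap k (h \<omega>) (C \<omega>) v) \<in> borel_measurable M"
  using assms
proof (induction k arbitrary: h C v)
  case (Suc k)
  then show ?case
    by (auto intro!: borel_measurable_add measurable_field_at measurable_star_sum random_incident
        random_delete_vertex)
qed simp

lemma measurable_greedy:
  assumes "random_fields M h" "random_couplings M C"
  shows "{\<omega> \<in> space M. greedy k vs (h \<omega>) (C \<omega>) = bs} \<in> sets M"
  using assms
proof (induction vs arbitrary: h C bs)
  case Nil
  show ?case by (cases bs) auto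
next
  case (Cons v vs)
  show ?case
  proof (cases bs)
    case (Cons b bs')
    let ?G = "\<lambda>b. {\<omega> \<in> space M. greedy k vs (push b (incident v (C \<omega>)) (h \<omega>)) (delete_vertex v (C \<omega>)) = bs'}"
    have G: "?G b \<in> sets M" for b
      using Cons.prems by (intro Cons.IH random_push random_incident random_delete_vertex)
    have [measurable]: "(\<lambda>\<omega>. gap k (h \<omega>) (C \<omega>) v) \<in> borel_measurable M"
      by (rule measurable_gap[OF Cons.prems])
    have "{\<omega> \<in> space M. (gap k (h \<omega>) (C \<omega>) v > 0) = b} \<in> sets M" by measurable
    moreover have "{\<omega> \<in> space M. greedy k (v # vs) (h \<omega>) (C \<omega>) = bs} =
        {\<omega> \<in> space M. (gap k (h \<omega>) (C \<omega>) v > 0) = b} \<inter> ?G b"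
      by (auto simp: Cons Let_def)
    ultimately show ?thesis using G by auto
  qed (simp add: Let_def)
qed

lemma Node_Reward_in: "v < n \<Longrightarrow> x < T \<Longrightarrow> Node_Reward v x \<in> reward_indices T n E"
  by (auto simp: reward_indices_def)

lemma Edge_Reward_in:
  "(u, v) \<in> E \<Longrightarrow> x < T \<Longrightarrow> y < T \<Longrightarrow> Edge_Reward u v x y \<in> reward_indices T n E"
  by (auto simp: reward_indices_def)

lemma random_fields_of:
  assumes "\<And>i. i \<in> reward_indices 2 n E \<Longrightarrow> \<Phi> i \<in> borel_measurable M"
  shows "random_fields M (\<lambda>\<omega>. fields_of n (\<lambda>i. \<Phi> i \<omega>))"
proof -
  have "random_fields M (\<lambda>\<omega>. map (\<lambda>v. (v, \<Phi> (Node_Reward v 1) \<omega> - \<Phi> (Node_Reward v 0) \<omega>)) vs)"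
    if "set vs \<subseteq> {..<n}" for vs
    using that
    by (induction vs)
       (auto intro!: random_fields.intros borel_measurable_diff assms Node_Reward_in)
  from this[of "[0..<n]"] show ?thesis by (simp add: fields_of_def atLeast0LessThan)
qed

lemma random_couplings_of:
  assumes "simple_graph n E" "\<And>i. i \<in> reward_indices 2 n E \<Longrightarrow> \<Phi> i \<in> borel_measurable M"
  shows "random_couplings M (\<lambda>\<omega>. couplings_of n E (\<lambda>i. \<Phi> i \<omega>))"
proof -
  have "random_couplings M (\<lambda>\<omega>. map (\<lambda>(u, v). (u, v, edge_weight (\<lambda>i. \<Phi> i \<omega>) u v)) es)"
    if "set es \<subseteq> E" for es
    using that
  proof (induction es)
    case (Cons e es)
    obtain u v where [simp]: "e = (u, v)" by force
    from Cons show ?case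
      by (auto intro!: random_couplings.intros assms Edge_Reward_in simp: edge_weight_def)
  qed (simp add: random_couplings.intros)
  then show ?thesis unfolding couplings_of_def using set_edge_list[OF assms(1)] by simp
qed

lemma measurable_total_reward:
  assumes "simple_graph n E" "\<And>i. i \<in> reward_indices 2 n E \<Longrightarrow> \<Phi> i \<in> borel_measurable M"
    and "x \<in> solutions 2 n"
  shows "(\<lambda>\<omega>. total_reward n E (\<lambda>i. \<Phi> i \<omega>) x) \<in> borel_measurable M"
proof -
  have "x v < 2" if "v < n" for v using assms(3) that by (auto simp: solutions_def)
  then show ?thesis
    unfolding total_reward_def split_def using simple_graphD[OF assms(1)]
    by (intro borel_measurable_add borel_measurable_sum assms(2) Node_Reward_in Edge_Reward_in) auto
qed

text \<open>
  The output takes finitely many values, so the failure event is a finite union of events in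
  which the solution is fixed.
\<close>
lemma measurable_failure:
  assumes "simple_graph n E" "\<And>i. i \<in> reward_indices 2 n E \<Longrightarrow> \<Phi> i \<in> borel_measurable M"
  shows "{\<omega>\<in>space M. optimal_reward 2 n E (\<lambda>i. \<Phi> i \<omega>)
     - total_reward n E (\<lambda>i. \<Phi> i \<omega>) (solution_of n (run_greedy k n E (\<lambda>i. \<Phi> i \<omega>))) > \<epsilon>} \<in> sets M"
proof -
  let ?F = "\<lambda>bs. {\<omega>\<in>space M. optimal_reward 2 n E (\<lambda>i. \<Phi> i \<omega>)
     - total_reward n E (\<lambda>i. \<Phi> i \<omega>) (solution_of n bs) > \<epsilon>}"
  let ?L = "{bs :: bool list. length bs = n}"
  have [measurable]: "(\<lambda>\<omega>. optimal_reward 2 n E (\<lambda>i. \<Phi> i \<omega>)) \<in> borel_measurable M"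
    unfolding optimal_reward_def
    by (rule borel_measurable_Max[OF finite_solutions measurable_total_reward[OF assms]])
  have [measurable]: "(\<lambda>\<omega>. total_reward n E (\<lambda>i. \<Phi> i \<omega>) (solution_of n bs)) \<in> borel_measurable M" for bs
    by (rule measurable_total_reward[OF assms solution_of_in])
  have F: "?F bs \<in> sets M" for bs by measurable
  have G: "{\<omega>\<in>space M. run_greedy k n E (\<lambda>i. \<Phi> i \<omega>) = bs} \<in> sets M" for bs
    unfolding run_greedy_def
    by (rule measurable_greedy[OF random_fields_of[OF assms(2)] random_couplings_of[OF assms]])
  have "finite ?L" using finite_lists_length_eq[of "UNIV :: bool set" n] by simp
  then have "(\<Union>bs\<in>?L. ?F bs \<inter> {\<omega>\<in>space M. run_greedy k n E (\<lambda>i. \<Phi> i \<omega>) = bs}) \<in> sets M"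
    using F G by auto
  also have "(\<Union>bs\<in>?L. ?F bs \<inter> {\<omega>\<in>space M. run_greedy k n E (\<lambda>i. \<Phi> i \<omega>) = bs}) =
    {\<omega>\<in>space M. optimal_reward 2 n E (\<lambda>i. \<Phi> i \<omega>)
     - total_reward n E (\<lambda>i. \<Phi> i \<omega>) (solution_of n (run_greedy k n E (\<lambda>i. \<Phi> i \<omega>))) > \<epsilon>}"
    by (auto simp: run_greedy_def)
  finally show ?thesis .
qed

section \<open>Coordinates in windows\<close>

lemma normal_density_le:
  assumes "\<sigma> > 0"
  shows "normal_density \<mu> \<sigma> x \<le> 1 / (2 * \<sigma>)"
proof -
  have "2 * \<sigma> = sqrt (4 * \<sigma>\<^sup>2)" using assms by (simp add: real_sqrt_mult)
  also have "\<dots> \<le> sqrt (2 * pi * \<sigma>\<^sup>2)"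
    using pi_ge_two by (intro real_sqrt_le_mono mult_right_mono) auto
  finally have "1 / sqrt (2 * pi * \<sigma>\<^sup>2) \<le> 1 / (2 * \<sigma>)"
    using assms by (intro divide_left_mono) auto
  moreover have "exp (- (x - \<mu>)\<^sup>2 / (2 * \<sigma>\<^sup>2)) \<le> 1" using assms by simp
  ultimately have "1 / sqrt (2 * pi * \<sigma>\<^sup>2) * exp (- (x - \<mu>)\<^sup>2 / (2 * \<sigma>\<^sup>2)) \<le> 1 / (2 * \<sigma>) * 1"
    using assms by (intro mult_mono) auto
  then show ?thesis by (simp add: normal_density_def)
qed

lemma emeasure_normal_window:
  assumes "distributed M lborel X (normal_density 0 \<sigma>)" "\<sigma> > 0"
  shows "emeasure (distr M borel X) {a..<b} \<le> ennreal (1 / (2 * \<sigma>) * (b - a))"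
proof (cases "a \<le> b")
  case True
  have "distr M borel X = distr M lborel X" by (intro distr_cong) auto
  also have "\<dots> = density lborel (normal_density 0 \<sigma>)"
    using distributed_distr_eq_density[OF assms(1)] by simp
  finally have "emeasure (distr M borel X) {a..<b} =
      (\<integral>\<^sup>+x. ennreal (normal_density 0 \<sigma> x) * indicator {a..<b} x \<partial>lborel)"
    by (simp add: emeasure_density)
  also have "\<dots> \<le> (\<integral>\<^sup>+x. ennreal (1 / (2 * \<sigma>)) * indicator {a..<b} x \<partial>lborel)"
    by (intro nn_integral_mono mult_right_mono ennreal_leI normal_density_le assms(2)) auto
  also have "\<dots> = ennreal (1 / (2 * \<sigma>)) * ennreal (b - a)"
    using True by (simp add: nn_integral_cmult)
  also have "\<dots> = ennreal (1 / (2 * \<sigma>) * (b - a))"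
    using True by (intro ennreal_mult''[symmetric]) simp
  finally show ?thesis .
qed simp

lemma component_in_window:
  fixes N :: "'i \<Rightarrow> real measure"
  assumes sets: "\<And>i. sets (N i) = sets borel" and "j \<in> I"
    and [measurable]: "lo \<in> borel_measurable (PiM I N)" "hi \<in> borel_measurable (PiM I N)"
  shows "(\<lambda>x. if lo x \<le> x j \<and> x j < hi x then 1 else 0 :: ennreal) \<in> borel_measurable (PiM I N)"
proof -
  define X where "X = (\<lambda>x :: 'i \<Rightarrow> real. x j)"
  have [measurable]: "X \<in> borel_measurable (PiM I N)"
    unfolding X_def by (subst measurable_cong_sets[OF refl sets[of j, symmetric]])
         (rule measurable_component_singleton[OF assms(2)])
  have "{x \<in> space (PiM I N). lo x \<le> X x \<and> X x < hi x} \<in> sets (PiM I N)"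
    by (intro sets.sets_Collect_conj borel_measurable_le borel_measurable_less) fact+
  then have "(\<lambda>x. if lo x \<le> X x \<and> X x < hi x then 1 else 0 :: ennreal) \<in> borel_measurable (PiM I N)"
    by (intro measurable_If) auto
  then show ?thesis by (simp add: X_def)
qed

text \<open>
  Integrate over the coordinate \<open>j\<close> first: the window and the factor \<open>k\<close> are constants for it.
\<close>
lemma nn_integral_window:
  fixes N :: "'i \<Rightarrow> real measure"
  assumes "\<And>i. prob_space (N i)" and sets [simp]: "\<And>i. sets (N i) = sets borel"
    and "finite I" "j \<in> I"
    and window: "\<And>a b. emeasure (N j) {a..<b} \<le> ennreal (c * (b - a))"
    and [measurable]: "lo \<in> borel_measurable (PiM I N)" "hi \<in> borel_measurable (PiM I N)"
      "k \<in> borel_measurable (PiM I N)"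
    and free: "\<And>x y. lo (x(j := y)) = lo x" "\<And>x y. hi (x(j := y)) = hi x" "\<And>x y. k (x(j := y)) = k x"
  shows "(\<integral>\<^sup>+x. (if lo x \<le> x j \<and> x j < hi x then 1 else 0) * k x \<partial>PiM I N)
          \<le> (\<integral>\<^sup>+x. ennreal (c * (hi x - lo x)) * k x \<partial>PiM I N)"
proof -
  interpret prob: prob_space "N i" for i by (rule assms(1))
  interpret product_sigma_finite N by standard
  define I' where "I' = I - {j}"
  have I: "I = insert j I'" "finite I'" "j \<notin> I'" using assms(3,4) by (auto simp: I'_def)
  have meas: "(\<lambda>x. (if lo x \<le> x j \<and> x j < hi x then 1 else 0) * k x) \<in> borel_measurable (PiM I N)"
    using component_in_window[OF sets assms(4)] by (intro borel_measurable_times_ennreal) simp_all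
  have meas': "(\<lambda>x. ennreal (c * (hi x - lo x)) * k x) \<in> borel_measurable (PiM I N)"
    by measurable
  have "(\<integral>\<^sup>+x. (if lo x \<le> x j \<and> x j < hi x then 1 else 0) * k x \<partial>PiM I N) =
     (\<integral>\<^sup>+x. \<integral>\<^sup>+y. (if lo x \<le> y \<and> y < hi x then 1 else 0) * k x \<partial>N j \<partial>PiM I' N)"
    using product_nn_integral_insert[OF I(2,3) meas[unfolded I(1)]] by (simp add: I(1) free)
  also have "\<dots> = (\<integral>\<^sup>+x. emeasure (N j) {lo x..<hi x} * k x \<partial>PiM I' N)"
  proof (rule nn_integral_cong)
    fix x
    have "(\<integral>\<^sup>+y. (if lo x \<le> y \<and> y < hi x then 1 else 0) * k x \<partial>N j) =
      (\<integral>\<^sup>+y. indicator {lo x..<hi x} y * k x \<partial>N j)"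
      by (intro nn_integral_cong) (auto split: split_indicator)
    then show "(\<integral>\<^sup>+y. (if lo x \<le> y \<and> y < hi x then 1 else 0) * k x \<partial>N j) =
      emeasure (N j) {lo x..<hi x} * k x"
      using nn_integral_multc[of "indicator {lo x..<hi x}" "N j" "k x"]
      by (simp add: borel_measurable_indicator)
  qed
  also have "\<dots> \<le> (\<integral>\<^sup>+x. ennreal (c * (hi x - lo x)) * k x \<partial>PiM I' N)"
    by (intro nn_integral_mono mult_right_mono window) auto
  also have "\<dots> = (\<integral>\<^sup>+x. \<integral>\<^sup>+y. ennreal (c * (hi x - lo x)) * k x \<partial>N j \<partial>PiM I' N)"
    by (simp add: prob.emeasure_space_1)
  also have "\<dots> = (\<integral>\<^sup>+x. ennreal (c * (hi x - lo x)) * k x \<partial>PiM I N)"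
    using product_nn_integral_insert[OF I(2,3) meas'[unfolded I(1)]] by (simp add: I(1) free)
  finally show ?thesis .
qed

text \<open>
  Replace the indicators by the widths one coordinate at a time.  The widths already obtained
  join the factor \<open>k\<close>, which is why it is arbitrary.
\<close>
lemma nn_integral_windows:
  fixes N :: "'i \<Rightarrow> real measure" and idx :: "'a \<Rightarrow> 'i"
  assumes "\<And>i. prob_space (N i)" and sets [simp]: "\<And>i. sets (N i) = sets borel"
    and I: "finite I"
    and A: "finite A" "idx ` A \<subseteq> I" "inj_on idx A"
    and window: "\<And>v a b. v \<in> A \<Longrightarrow> emeasure (N (idx v)) {a..<b} \<le> ennreal (c * (b - a))"
    and meas: "\<And>v. v \<in> A \<Longrightarrow> lo v \<in> borel_measurable (PiM I N)"
      "\<And>v. v \<in> A \<Longrightarrow> hi v \<in> borel_measurable (PiM I N)" "k \<in> borel_measurable (PiM I N)"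
    and free: "\<And>v u x y. v \<in> A \<Longrightarrow> u \<in> A \<Longrightarrow> lo v (x(idx u := y)) = lo v x"
      "\<And>v u x y. v \<in> A \<Longrightarrow> u \<in> A \<Longrightarrow> hi v (x(idx u := y)) = hi v x"
      "\<And>u x y. u \<in> A \<Longrightarrow> k (x(idx u := y)) = k x"
  shows "(\<integral>\<^sup>+x. (\<Prod>v\<in>A. if lo v x \<le> x (idx v) \<and> x (idx v) < hi v x then 1 else 0) * k x \<partial>PiM I N)
          \<le> (\<integral>\<^sup>+x. (\<Prod>v\<in>A. ennreal (c * (hi v x - lo v x))) * k x \<partial>PiM I N)"
  using A window meas free
proof (induction A arbitrary: k rule: finite_induct)
  case empty
  show ?case by simp
next
  case (insert v A)
  let ?I = "\<lambda>v x. if lo v x \<le> x (idx v) \<and> x (idx v) < hi v x then 1 else 0 :: ennreal"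
  let ?L = "\<lambda>v x. ennreal (c * (hi v x - lo v x))"
  have neq: "idx u \<noteq> idx v" if "u \<in> A" for u
    using insert.prems(2) insert.hyps(2) that by (auto simp: inj_on_def)
  note [measurable] = insert.prems(4,5,6)
  have [measurable]: "?I u \<in> borel_measurable (PiM I N)" if "u \<in> A" for u
    using insert.prems that by (intro component_in_window[OF sets]) auto
  have I_free: "?I u (x(idx v := y)) = ?I u x" if "u \<in> A" for u x y
  proof -
    have "lo u (x(idx v := y)) = lo u x" "hi u (x(idx v := y)) = hi u x"
      using insert.prems(7,8) that by blast+
    moreover have "(x(idx v := y)) (idx u) = x (idx u)" using neq[OF that] by (rule fun_upd_other)
    ultimately show ?thesis by (simp only:)
  qed
  have "(\<integral>\<^sup>+x. (\<Prod>v\<in>insert v A. ?I v x) * k x \<partial>PiM I N) = (\<integral>\<^sup>+x. ?I v x * ((\<Prod>u\<in>A. ?I u x) * k x) \<partial>PiM I N)"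
    using insert.hyps by (intro nn_integral_cong) (simp add: mult.assoc)
  also have "\<dots> \<le> (\<integral>\<^sup>+x. ?L v x * ((\<Prod>u\<in>A. ?I u x) * k x) \<partial>PiM I N)"
  proof (rule nn_integral_window[OF assms(1) sets I])
    show "idx v \<in> I" using insert.prems(1) by simp
    show "emeasure (N (idx v)) {a..<b} \<le> ennreal (c * (b - a))" for a b
      by (rule insert.prems(3)) simp
    show "(\<lambda>x. (\<Prod>u\<in>A. ?I u x) * k x) \<in> borel_measurable (PiM I N)"
      using insert.prems by (intro borel_measurable_times_ennreal borel_measurable_prod_ennreal component_in_window[OF sets]) auto
    show "(\<Prod>u\<in>A. ?I u (x(idx v := y))) * k (x(idx v := y)) = (\<Prod>u\<in>A. ?I u x) * k x" for x y
      by (intro arg_cong2[where f = "(*)"] prod.cong refl I_free insert.prems(9) insertI1)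
    show "lo v \<in> borel_measurable (PiM I N)" "hi v \<in> borel_measurable (PiM I N)"
      by (intro insert.prems insertI1)+
    show "lo v (x(idx v := y)) = lo v x" "hi v (x(idx v := y)) = hi v x" for x y
      by (intro insert.prems insertI1)+
  qed
  also have "\<dots> = (\<integral>\<^sup>+x. (\<Prod>u\<in>A. ?I u x) * (?L v x * k x) \<partial>PiM I N)"
    by (simp only: mult.left_commute)
  also have "\<dots> \<le> (\<integral>\<^sup>+x. (\<Prod>u\<in>A. ?L u x) * (?L v x * k x) \<partial>PiM I N)"
  proof (rule insert.IH)
    show "(\<lambda>x. ?L v x * k x) \<in> borel_measurable (PiM I N)" by measurable
    show "?L v (x(idx u := y)) * k (x(idx u := y)) = ?L v x * k x" if "u \<in> A" for u x y
      using that by (simp only: insert.prems(7-9) insertI1 insertI2)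
    show "idx ` A \<subseteq> I" "inj_on idx A" using insert.prems(1,2) by simp_all
    show "lo u \<in> borel_measurable (PiM I N)" "hi u \<in> borel_measurable (PiM I N)" if "u \<in> A" for u
      using that by (intro insert.prems insertI2; assumption)+
    show "lo w (x(idx u := y)) = lo w x" "hi w (x(idx u := y)) = hi w x"
      if "w \<in> A" "u \<in> A" for w u x y
      by (rule insert.prems(7,8)[OF insertI2[OF that(1)] insertI2[OF that(2)]])+
    show "emeasure (N (idx u)) {a..<b} \<le> ennreal (c * (b - a))" if "u \<in> A" for u a b
      using that by (intro insert.prems insertI2)
  qed
  also have "\<dots> = (\<integral>\<^sup>+x. (\<Prod>v\<in>insert v A. ?L v x) * k x \<partial>PiM I N)"
    using insert.hyps by (intro nn_integral_cong) (simp add: mult_ac)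
  finally show ?case .
qed

section \<open>Interactions of edges\<close>

definition interaction :: "(reward_index \<Rightarrow> real) \<Rightarrow> nat \<times> nat \<Rightarrow> real" where
  "interaction \<phi> = (\<lambda>(u, v). \<phi> (Edge_Reward u v 0 0) - \<phi> (Edge_Reward u v 0 1)
     - \<phi> (Edge_Reward u v 1 0) + \<phi> (Edge_Reward u v 1 1))"

definition edges_at :: "(nat \<times> nat) set \<Rightarrow> nat \<Rightarrow> (nat \<times> nat) set" where
  "edges_at E v = {e \<in> E. v = fst e \<or> v = snd e}"

definition field_lower :: "nat \<Rightarrow> (nat \<times> nat) set \<Rightarrow> nat \<Rightarrow> (reward_index \<Rightarrow> real) \<Rightarrow> real" where
  "field_lower n E v \<phi> = (\<Sum>(u, w)\<leftarrow>incident v (couplings_of n E \<phi>). lower_jump w)"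

definition field_upper :: "nat \<Rightarrow> (nat \<times> nat) set \<Rightarrow> nat \<Rightarrow> (reward_index \<Rightarrow> real) \<Rightarrow> real" where
  "field_upper n E v \<phi> = (\<Sum>(u, w)\<leftarrow>incident v (couplings_of n E \<phi>). upper_jump w)"

text \<open>
  A star contains edges in both orientations; for a symmetric function the orientation can be
  forgotten.
\<close>
lemma sum_incident_symmetric:
  assumes "\<And>w. g (\<lambda>x y. w y x) = g w" "distinct L"
  shows "(\<Sum>(u, w)\<leftarrow>incident v (map (\<lambda>(a, b). (a, b, W a b)) L). g w) =
     (\<Sum>(a, b)\<in>{e \<in> set L. v = fst e \<or> v = snd e}. g (W a b) :: real)"
proof -
  have "(\<Sum>(u, w)\<leftarrow>incident v (map (\<lambda>(a, b). (a, b, W a b)) L). g w) =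
     (\<Sum>e\<leftarrow>L. if v = fst e \<or> v = snd e then g (W (fst e) (snd e)) else 0)"
  proof (induction L)
    case (Cons e L)
    obtain a b where e: "e = (a, b)" by force
    show ?case using Cons assms(1)[of "W a b"] by (auto simp: e)
  qed simp
  also have "\<dots> = (\<Sum>e\<in>set L. if v = fst e \<or> v = snd e then g (W (fst e) (snd e)) else 0)"
    by (simp add: sum_list_distinct_conv_sum_set assms(2))
  also have "\<dots> = (\<Sum>(a, b)\<in>{e \<in> set L. v = fst e \<or> v = snd e}. g (W a b))"
    by (simp add: sum.inter_filter split_def)
  finally show ?thesis .
qed

lemma field_width:
  assumes "simple_graph n E"
  shows "field_upper n E v \<phi> - field_lower n E v \<phi> = (\<Sum>e\<in>edges_at E v. \<bar>interaction \<phi> e\<bar>)"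
proof -
  define g where "g w = \<bar>w False False - w False True - w True False + w True True\<bar>" for w :: weight
  have "upper_jump w - lower_jump w = g w" for w
    by (auto simp: upper_jump_def lower_jump_def jump_def g_def)
  then have "field_upper n E v \<phi> - field_lower n E v \<phi> =
      (\<Sum>(u, w)\<leftarrow>incident v (couplings_of n E \<phi>). g w)"
    by (simp add: field_upper_def field_lower_def split_def flip: sum_list_subtractf)
  also have "\<dots> = (\<Sum>(a, b)\<in>edges_at E v. g (edge_weight \<phi> a b))"
    unfolding couplings_of_def edges_at_def
    by (subst sum_incident_symmetric)
       (simp_all add: g_def distinct_edge_list algebra_simps set_edge_list[OF assms])
  also have "\<dots> = (\<Sum>e\<in>edges_at E v. \<bar>interaction \<phi> e\<bar>)"
    by (intro sum.cong) (auto simp: interaction_def g_def edge_weight_def)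
  finally show ?thesis .
qed

lemma undecided_window:
  assumes "v < n" "\<phi> (Node_Reward v 1) = 0"
    and "\<not> decided (fields_of n \<phi>) (couplings_of n E \<phi>) v"
  shows "field_lower n E v \<phi> \<le> \<phi> (Node_Reward v 0) \<and> \<phi> (Node_Reward v 0) < field_upper n E v \<phi>"
proof -
  have "field_at (fields_of n \<phi>) v = - \<phi> (Node_Reward v 0)"
    using assms(1,2)
    by (simp add: field_at_def fields_of_def comp_def interv_sum_list_conv_sum_set_nat)
  with assms(3) show ?thesis
    by (auto simp: decided_def lower_def upper_def field_lower_def field_upper_def)
qed

lemma couplings_of_cong:
  assumes "simple_graph n E" "\<And>u v x y. (u, v) \<in> E \<Longrightarrow> x < 2 \<Longrightarrow> y < 2 \<Longrightarrow>
     \<phi> (Edge_Reward u v x y) = \<psi> (Edge_Reward u v x y)"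
  shows "couplings_of n E \<phi> = couplings_of n E \<psi>"
  using assms by (auto simp: couplings_of_def set_edge_list edge_weight_def fun_eq_iff)

lemma measurable_star_jumps:
  assumes "random_star M I"
  shows "(\<lambda>\<omega>. \<Sum>(u, w)\<leftarrow>I \<omega>. lower_jump w) \<in> borel_measurable M"
    and "(\<lambda>\<omega>. \<Sum>(u, w)\<leftarrow>I \<omega>. upper_jump w) \<in> borel_measurable M"
  using assms
proof (induction rule: random_star.induct)
  case (2 w I u)
  note [measurable] = 2(1)
  { case 1 show ?case using 2 by (simp add: lower_jump_def jump_def) }
  { case 2 show ?case using "2.IH" by (simp add: upper_jump_def jump_def) }
qed simp_all

lemma card_edges_at:
  assumes "simple_graph n E" "\<forall>v<n. node_degree E v \<le> \<Delta>" "v < n"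
  shows "finite (edges_at E v)" "card (edges_at E v) \<le> \<Delta>"
proof -
  show "finite (edges_at E v)"
    using finite_simple_graph[OF assms(1)] by (simp add: edges_at_def)
  have "edges_at E v \<subseteq> (\<lambda>w. (min v w, max v w)) ` neighbours E v"
  proof
    fix e assume "e \<in> edges_at E v"
    then obtain a b where e: "e = (a, b)" "(a, b) \<in> E" "v = a \<or> v = b" "a < b"
      using simple_graphD[OF assms(1)] by (cases e) (auto simp: edges_at_def)
    from e(3) show "e \<in> (\<lambda>w. (min v w, max v w)) ` neighbours E v"
    proof
      assume "v = a"
      with e show ?thesis by (intro image_eqI[of _ _ b]) (auto simp: neighbours_def)
    next
      assume "v = b"
      with e show ?thesis by (intro image_eqI[of _ _ a]) (auto simp: neighbours_def)
    qed
  qed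
  then have "card (edges_at E v) \<le> card (neighbours E v)"
    using finite_neighbours[OF assms(1)] surj_card_le by blast
  also have "\<dots> \<le> \<Delta>" using assms(2,3) by (auto simp: node_degree_def neighbours_def)
  finally show "card (edges_at E v) \<le> \<Delta>" .
qed

text \<open>
  For \<open>m = 1\<close> the exact value is \<open>s * sqrt (2 / pi)\<close>, for \<open>m = 2\<close> it is \<open>s\<^sup>2\<close>.
\<close>
lemma gaussian_absolute_moments:
  assumes X: "distributed M lborel X (normal_density 0 s)" "s > 0" and "m \<le> 2" and "prob_space M"
  shows "(\<integral>\<^sup>+\<omega>. ennreal \<bar>X \<omega>\<bar> ^ m \<partial>M) \<le> ennreal s ^ m"
proof -
  interpret prob_space M by fact
  have "(\<integral>\<^sup>+\<omega>. ennreal \<bar>X \<omega>\<bar> ^ m \<partial>M) = (\<integral>\<^sup>+x. ennreal (normal_density 0 s x) * ennreal \<bar>x\<bar> ^ m \<partial>lborel)"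
    by (rule distributed_nn_integral[OF X(1), symmetric]) simp
  also have "\<dots> = (\<integral>\<^sup>+x. ennreal (normal_density 0 s x * \<bar>x - 0\<bar> ^ m) \<partial>lborel)"
    by (simp add: ennreal_mult' ennreal_power)
  also have "\<dots> = ennreal (\<integral>x. normal_density 0 s x * \<bar>x - 0\<bar> ^ m \<partial>lborel)"
    by (intro nn_integral_eq_integral integrable_normal_moment_abs X(2)) auto
  also have "(\<integral>x. normal_density 0 s x * \<bar>x - 0\<bar> ^ m \<partial>lborel) \<le> s ^ m"
  proof -
    consider "m = 0" | "m = 1" | "m = 2" using \<open>m \<le> 2\<close> by linarith
    then show ?thesis
    proof cases
      case 1
      then show ?thesis using X(2) by simp
    next
      case 2
      have "sqrt (2 / pi) \<le> 1" using pi_ge_two by simp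
      then have "s * sqrt (2 / pi) \<le> s * 1" using X(2) by (intro mult_left_mono) auto
      then show ?thesis
        using 2 integral_normal_moment_abs_odd[OF X(2), of 0 0] by simp
    next
      case 3
      then show ?thesis
        using integral_normal_moment_even[OF X(2), of 0 1] X(2) by (simp add: fact_numeral)
    qed
  qed
  finally show ?thesis using X(2) by (simp add: ennreal_power ennreal_leI)
qed

definition edge_indices :: "nat \<times> nat \<Rightarrow> reward_index set" where
  "edge_indices = (\<lambda>(u, v). {Edge_Reward u v 0 0, Edge_Reward u v 0 1, Edge_Reward u v 1 0, Edge_Reward u v 1 1})"

definition sign_of :: "reward_index \<Rightarrow> real" where
  "sign_of i = (case i of Edge_Reward u v x y \<Rightarrow> if x = y then 1 else - 1 | Node_Reward v x \<Rightarrow> 1)"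

lemma interaction_eq_sum: "interaction \<phi> e = (\<Sum>i\<in>edge_indices e. sign_of i * \<phi> i)"
  by (cases e) (simp add: interaction_def edge_indices_def sign_of_def)

lemma edge_indices_subset: "e \<in> E \<Longrightarrow> edge_indices e \<subseteq> reward_indices 2 n E"
  by (cases e) (auto simp: edge_indices_def reward_indices_def)

lemma card_edge_indices: "finite (edge_indices e)" "card (edge_indices e) = 4"
  by (cases e; simp add: edge_indices_def)+

lemma finite_reward_indices: "finite E \<Longrightarrow> finite (reward_indices T n E)"
proof -
  assume "finite E"
  have "reward_indices T n E \<subseteq>
     (\<lambda>((u, v), x, y). Edge_Reward u v x y) ` (E \<times> {..<T} \<times> {..<T}) \<union>
     (\<lambda>(v, x). Node_Reward v x) ` ({..<n} \<times> {..<T})"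
    by (force simp: reward_indices_def)
  then show ?thesis by (rule finite_subset) (use \<open>finite E\<close> in auto)
qed

lemma gaussian_networkD:
  assumes "gaussian_network \<Delta> \<sigma>\<^sub>e \<sigma>\<^sub>p M n E \<Phi>"
  shows "prob_space M" "simple_graph n E" "\<forall>v<n. node_degree E v \<le> \<Delta>"
    and "prob_space.indep_vars M (\<lambda>_. borel) \<Phi> (reward_indices 2 n E)"
    and "\<And>i. i \<in> reward_indices 2 n E \<Longrightarrow> \<Phi> i \<in> borel_measurable M"
    and "\<And>e i. e \<in> E \<Longrightarrow> i \<in> edge_indices e \<Longrightarrow> distributed M lborel (\<Phi> i) (normal_density 0 \<sigma>\<^sub>e)"
    and "\<And>v. v < n \<Longrightarrow> distributed M lborel (\<Phi> (Node_Reward v 0)) (normal_density 0 \<sigma>\<^sub>p)"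
    and "\<And>v \<omega>. v < n \<Longrightarrow> \<omega> \<in> space M \<Longrightarrow> \<Phi> (Node_Reward v 1) \<omega> = 0"
proof -
  note net = assms[unfolded gaussian_network_def]
  show "prob_space M" and graph: "simple_graph n E" and "\<forall>v<n. node_degree E v \<le> \<Delta>"
    and "\<And>v. v < n \<Longrightarrow> distributed M lborel (\<Phi> (Node_Reward v 0)) (normal_density 0 \<sigma>\<^sub>p)"
    and "\<And>v \<omega>. v < n \<Longrightarrow> \<omega> \<in> space M \<Longrightarrow> \<Phi> (Node_Reward v 1) \<omega> = 0"
    and indep: "prob_space.indep_vars M (\<lambda>_. borel) \<Phi> (reward_indices 2 n E)"
    using net by auto
  show "\<And>i. i \<in> reward_indices 2 n E \<Longrightarrow> \<Phi> i \<in> borel_measurable M"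
    using indep prob_space.indep_vars_def[OF \<open>prob_space M\<close>] by metis
  show "\<And>e i. e \<in> E \<Longrightarrow> i \<in> edge_indices e \<Longrightarrow> distributed M lborel (\<Phi> i) (normal_density 0 \<sigma>\<^sub>e)"
  proof -
    fix e i assume "e \<in> E" "i \<in> edge_indices e"
    then obtain u v x y where "e = (u, v)" "(u, v) \<in> E" "i = Edge_Reward u v x y" "x < 2" "y < 2"
      by (cases e) (auto simp: edge_indices_def)
    then show "distributed M lborel (\<Phi> i) (normal_density 0 \<sigma>\<^sub>e)" using net by blast
  qed
qed

lemma interaction_gaussian:
  assumes net: "gaussian_network \<Delta> \<sigma>\<^sub>e \<sigma>\<^sub>p M n E \<Phi>" and "\<sigma>\<^sub>e > 0" "e \<in> E"
  shows "distributed M lborel (\<lambda>\<omega>. interaction (\<lambda>i. \<Phi> i \<omega>) e) (normal_density 0 (2 * \<sigma>\<^sub>e))"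
proof -
  interpret prob_space M by (rule gaussian_networkD(1)[OF net])
  have "indep_vars (\<lambda>_. borel) \<Phi> (edge_indices e)"
    by (rule indep_vars_subset[OF gaussian_networkD(4)[OF net] edge_indices_subset[OF assms(3)]])
  then have indep: "indep_vars (\<lambda>_. borel) (\<lambda>i \<omega>. sign_of i * \<Phi> i \<omega>) (edge_indices e)"
    by (rule indep_vars_compose2) simp
  have "distributed M lborel (\<lambda>\<omega>. sign_of i * \<Phi> i \<omega>) (normal_density 0 \<sigma>\<^sub>e)"
    if "i \<in> edge_indices e" for i
    using normal_density_affine[OF gaussian_networkD(6)[OF net assms(3) that] assms(2), of "sign_of i" 0]
    by (auto simp: sign_of_def split: reward_index.splits if_splits)
  from sum_indep_normal[OF _ _ indep assms(2) this] show ?thesis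
    using card_edge_indices[of e] assms(2) by (force simp: interaction_eq_sum real_sqrt_mult)
qed

text \<open>
  Interactions of different edges are functions of disjoint blocks of rewards.
\<close>
lemma interactions_independent:
  assumes net: "gaussian_network \<Delta> \<sigma>\<^sub>e \<sigma>\<^sub>p M n E \<Phi>"
  shows "prob_space.indep_vars M (\<lambda>_. borel) (\<lambda>e \<omega>. interaction (\<lambda>i. \<Phi> i \<omega>) e) E"
proof -
  interpret prob_space M by (rule gaussian_networkD(1)[OF net])
  have "disjoint_family_on edge_indices E"
    by (auto simp: disjoint_family_on_def edge_indices_def)
  from indep_vars_restrict[OF gaussian_networkD(4)[OF net] edge_indices_subset this]
  have "indep_vars (\<lambda>e. PiM (edge_indices e) (\<lambda>_. borel))
      (\<lambda>e \<omega>. restrict (\<lambda>i. \<Phi> i \<omega>) (edge_indices e)) E" .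
  then have "indep_vars (\<lambda>_. borel)
      (\<lambda>e \<omega>. interaction (restrict (\<lambda>i. \<Phi> i \<omega>) (edge_indices e)) e) E"
    by (rule indep_vars_compose2)
       (auto simp: interaction_eq_sum[abs_def] intro!: borel_measurable_sum borel_measurable_times
         measurable_component_singleton)
  then show ?thesis by (simp add: interaction_eq_sum cong: sum.cong)
qed

lemma prod_mono_ennreal:
  fixes f g :: "'a \<Rightarrow> ennreal"
  assumes "\<And>i. i \<in> A \<Longrightarrow> f i \<le> g i"
  shows "prod f A \<le> prod g A"
  using assms by (induction A rule: infinite_finite_induct) (auto intro: mult_mono)

text \<open>
  Grouping the factors by edges gives powers of independent variables.  Their exponents are at
  most 2 because only the endpoints of an edge can select it.
\<close>
lemma product_moment_bound:
  assumes net: "gaussian_network \<Delta> \<sigma>\<^sub>e \<sigma>\<^sub>p M n E \<Phi>" and "\<sigma>\<^sub>e > 0" and "finite A"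
    and g: "\<And>v. v \<in> A \<Longrightarrow> g v \<in> edges_at E v"
  shows "(\<integral>\<^sup>+\<omega>. (\<Prod>v\<in>A. ennreal \<bar>interaction (\<lambda>i. \<Phi> i \<omega>) (g v)\<bar>) \<partial>M) \<le> ennreal (2 * \<sigma>\<^sub>e) ^ card A"
proof -
  interpret prob_space M by (rule gaussian_networkD(1)[OF net])
  have finE: "finite E" by (rule finite_simple_graph[OF gaussian_networkD(2)[OF net]])
  define m where "m e = card {v \<in> A. g v = e}" for e
  have gE: "g ` A \<subseteq> E" using g by (auto simp: edges_at_def)
  have m: "m e \<le> 2" for e
  proof -
    have "{v \<in> A. g v = e} \<subseteq> {fst e, snd e}" using g by (auto simp: edges_at_def)
    then have "m e \<le> card {fst e, snd e}" unfolding m_def by (intro card_mono) auto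
    also have "\<dots> \<le> 2" by (simp add: card_insert_if)
    finally show ?thesis .
  qed
  have regroup: "(\<Prod>v\<in>A. f (g v)) = (\<Prod>e\<in>E. f e ^ m e)" for f :: "nat \<times> nat \<Rightarrow> ennreal"
  proof -
    have "(\<Prod>v\<in>A. f (g v)) = (\<Prod>e\<in>E. \<Prod>v\<in>{v \<in> A. g v = e}. f (g v))"
      by (rule prod.group[OF assms(3) finE gE, symmetric])
    also have "\<dots> = (\<Prod>e\<in>E. f e ^ m e)" by (simp add: m_def)
    finally show ?thesis .
  qed
  have indep: "indep_vars (\<lambda>_. borel) (\<lambda>e \<omega>. ennreal \<bar>interaction (\<lambda>i. \<Phi> i \<omega>) e\<bar> ^ m e) E"
    by (rule indep_vars_compose2[OF interactions_independent[OF net]]) simp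
  have "(\<integral>\<^sup>+\<omega>. (\<Prod>v\<in>A. ennreal \<bar>interaction (\<lambda>i. \<Phi> i \<omega>) (g v)\<bar>) \<partial>M) =
      (\<integral>\<^sup>+\<omega>. (\<Prod>e\<in>E. ennreal \<bar>interaction (\<lambda>i. \<Phi> i \<omega>) e\<bar> ^ m e) \<partial>M)"
    by (simp add: regroup[of "\<lambda>e. ennreal \<bar>interaction (\<lambda>i. \<Phi> i _) e\<bar>"])
  also have "\<dots> = (\<Prod>e\<in>E. \<integral>\<^sup>+\<omega>. ennreal \<bar>interaction (\<lambda>i. \<Phi> i \<omega>) e\<bar> ^ m e \<partial>M)"
    by (rule indep_vars_nn_integral[OF finE indep]) simp
  also have "\<dots> \<le> (\<Prod>e\<in>E. ennreal (2 * \<sigma>\<^sub>e) ^ m e)"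
    using assms(2)
    by (intro prod_mono_ennreal gaussian_absolute_moments interaction_gaussian[OF net] m prob_space_axioms) auto
  also have "\<dots> = ennreal (2 * \<sigma>\<^sub>e) ^ card A"
    using regroup[of "\<lambda>_. ennreal (2 * \<sigma>\<^sub>e)"] by simp
  finally show ?thesis .
qed

text \<open>
  Expand the product of sums over all ways to select one incident edge for every node.
\<close>
lemma product_width_bound:
  assumes net: "gaussian_network \<Delta> \<sigma>\<^sub>e \<sigma>\<^sub>p M n E \<Phi>" and "\<sigma>\<^sub>e > 0" and A: "A \<subseteq> {..<n}"
  shows "(\<integral>\<^sup>+\<omega>. (\<Prod>v\<in>A. \<Sum>e\<in>edges_at E v. ennreal \<bar>interaction (\<lambda>i. \<Phi> i \<omega>) e\<bar>) \<partial>M)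
          \<le> ennreal (real \<Delta> * (2 * \<sigma>\<^sub>e)) ^ card A"
proof -
  interpret prob_space M by (rule gaussian_networkD(1)[OF net])
  have finA: "finite A" using A finite_subset by blast
  note edges = card_edges_at[OF gaussian_networkD(2,3)[OF net]]
  have fin: "finite (edges_at E v)" if "v \<in> A" for v using edges(1) A that by auto
  have [measurable]: "(\<lambda>\<omega>. interaction (\<lambda>i. \<Phi> i \<omega>) e) \<in> borel_measurable M" if "e \<in> E" for e
    using interaction_gaussian[OF net assms(2) that] by (simp add: distributed_def)
  have meas: "(\<lambda>\<omega>. \<Prod>v\<in>A. ennreal \<bar>interaction (\<lambda>i. \<Phi> i \<omega>) (g v)\<bar>) \<in> borel_measurable M"
    if "g \<in> PiE A (edges_at E)" for g
    using that by (intro borel_measurable_prod_ennreal) (auto simp: edges_at_def dest!: PiE_mem)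
  have "(\<integral>\<^sup>+\<omega>. (\<Prod>v\<in>A. \<Sum>e\<in>edges_at E v. ennreal \<bar>interaction (\<lambda>i. \<Phi> i \<omega>) e\<bar>) \<partial>M) =
     (\<integral>\<^sup>+\<omega>. (\<Sum>g\<in>PiE A (edges_at E). \<Prod>v\<in>A. ennreal \<bar>interaction (\<lambda>i. \<Phi> i \<omega>) (g v)\<bar>) \<partial>M)"
    using finA fin by (intro nn_integral_cong prod_sum_PiE) auto
  also have "\<dots> = (\<Sum>g\<in>PiE A (edges_at E). \<integral>\<^sup>+\<omega>. (\<Prod>v\<in>A. ennreal \<bar>interaction (\<lambda>i. \<Phi> i \<omega>) (g v)\<bar>) \<partial>M)"
    by (intro nn_integral_sum meas)
  also have "\<dots> \<le> (\<Sum>g\<in>PiE A (edges_at E). ennreal (2 * \<sigma>\<^sub>e) ^ card A)"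
    by (intro sum_mono product_moment_bound[OF net assms(2) finA]) auto
  also have "\<dots> = of_nat (\<Prod>v\<in>A. card (edges_at E v)) * ennreal (2 * \<sigma>\<^sub>e) ^ card A"
    by (simp add: card_PiE[OF finA])
  also have "\<dots> \<le> of_nat (\<Delta> ^ card A) * ennreal (2 * \<sigma>\<^sub>e) ^ card A"
  proof (intro mult_right_mono)
    have "(\<Prod>v\<in>A. card (edges_at E v)) \<le> (\<Prod>v\<in>A. \<Delta>)"
      using edges(2) A by (intro prod_mono) auto
    then show "of_nat (\<Prod>v\<in>A. card (edges_at E v)) \<le> (of_nat (\<Delta> ^ card A) :: ennreal)"
      by (intro of_nat_mono) simp
  qed simp
  also have "\<dots> = ennreal (real \<Delta> * (2 * \<sigma>\<^sub>e)) ^ card A"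
    using assms(2)
    by (simp add: ennreal_mult' power_mult_distrib ennreal_of_nat_eq_real_of_nat ennreal_power)
  finally show ?thesis .
qed

section \<open>The probability that given nodes are undecided\<close>

definition in_window :: "nat \<Rightarrow> (nat \<times> nat) set \<Rightarrow> (reward_index \<Rightarrow> real) \<Rightarrow> nat \<Rightarrow> bool" where
  "in_window n E \<phi> v \<longleftrightarrow> field_lower n E v \<phi> \<le> \<phi> (Node_Reward v 0) \<and> \<phi> (Node_Reward v 0) < field_upper n E v \<phi>"

lemma measurable_field_range:
  assumes "simple_graph n E" "\<And>i. i \<in> reward_indices 2 n E \<Longrightarrow> \<Phi> i \<in> borel_measurable M"
  shows "(\<lambda>\<omega>. field_lower n E v (\<lambda>i. \<Phi> i \<omega>)) \<in> borel_measurable M"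
    and "(\<lambda>\<omega>. field_upper n E v (\<lambda>i. \<Phi> i \<omega>)) \<in> borel_measurable M"
  unfolding field_lower_def field_upper_def
  by (intro measurable_star_jumps random_incident random_couplings_of assms; assumption)+

lemma in_window_measurable:
  assumes "simple_graph n E" "\<And>i. i \<in> reward_indices 2 n E \<Longrightarrow> \<Phi> i \<in> borel_measurable M" "A \<subseteq> {..<n}"
  shows "{\<omega> \<in> space M. \<forall>v\<in>A. in_window n E (\<lambda>i. \<Phi> i \<omega>) v} \<in> sets M"
proof -
  have "finite A" using assms(3) finite_subset by blast
  moreover have "{\<omega> \<in> space M. in_window n E (\<lambda>i. \<Phi> i \<omega>) v} \<in> sets M" if "v \<in> A" for v
    unfolding in_window_def using assms(3) that
    by (intro sets.sets_Collect_conj borel_measurable_le borel_measurable_less measurable_field_range assms Node_Reward_in)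
       auto
  ultimately show ?thesis by (intro sets.sets_Collect_finite_All)
qed

lemma field_range_update_node:
  "field_lower n E v (\<phi>(Node_Reward u x := y)) = field_lower n E v \<phi>"
  "field_upper n E v (\<phi>(Node_Reward u x := y)) = field_upper n E v \<phi>"
proof -
  have "couplings_of n E (\<phi>(Node_Reward u x := y)) = couplings_of n E \<phi>"
    by (simp add: couplings_of_def edge_weight_def[abs_def])
  then show "field_lower n E v (\<phi>(Node_Reward u x := y)) = field_lower n E v \<phi>"
    "field_upper n E v (\<phi>(Node_Reward u x := y)) = field_upper n E v \<phi>"
    by (simp_all add: field_lower_def field_upper_def)
qed

lemma field_range_restrict:
  assumes "simple_graph n E"
  shows "field_lower n E v (restrict \<phi> (reward_indices 2 n E)) = field_lower n E v \<phi>"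
    "field_upper n E v (restrict \<phi> (reward_indices 2 n E)) = field_upper n E v \<phi>"
proof -
  have "couplings_of n E (restrict \<phi> (reward_indices 2 n E)) = couplings_of n E \<phi>"
    by (rule couplings_of_cong[OF assms]) (simp add: Edge_Reward_in)
  then show "field_lower n E v (restrict \<phi> (reward_indices 2 n E)) = field_lower n E v \<phi>"
    "field_upper n E v (restrict \<phi> (reward_indices 2 n E)) = field_upper n E v \<phi>"
    by (simp_all add: field_lower_def field_upper_def)
qed

text \<open>
  Pass to the product space of the rewards.  The windows of the node rewards depend on edge
  rewards only, so the window lemma replaces the event by a product of widths.
\<close>
lemma prob_in_window:
  assumes net: "gaussian_network \<Delta> \<sigma>\<^sub>e \<sigma>\<^sub>p M n E \<Phi>" and pos: "\<sigma>\<^sub>e > 0" "\<sigma>\<^sub>p > 0" and A: "A \<subseteq> {..<n}"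
  shows "measure M {\<omega> \<in> space M. \<forall>v\<in>A. in_window n E (\<lambda>i. \<Phi> i \<omega>) v} \<le> (real \<Delta> * \<sigma>\<^sub>e / \<sigma>\<^sub>p) ^ card A"
proof (cases "A = {}")
  case True
  then show ?thesis using prob_space.prob_space[OF gaussian_networkD(1)[OF net]] by simp
next
  case False
  interpret prob_space M by (rule gaussian_networkD(1)[OF net])
  let ?I = "reward_indices 2 n E" and ?\<phi> = "\<lambda>\<omega> i. \<Phi> i \<omega>"
  let ?idx = "\<lambda>v. Node_Reward v 0"
  let ?W = "\<lambda>\<phi>. \<Prod>v\<in>A. if field_lower n E v \<phi> \<le> \<phi> (?idx v) \<and> \<phi> (?idx v) < field_upper n E v \<phi> then 1 else 0 :: ennreal"
  let ?c = "1 / (2 * \<sigma>\<^sub>p)"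
  let ?B = "\<lambda>\<phi>. \<Prod>v\<in>A. ennreal (?c * (field_upper n E v \<phi> - field_lower n E v \<phi>))"
  note graph = gaussian_networkD(2)[OF net] and rv = gaussian_networkD(5)[OF net]
  have finA: "finite A" using A finite_subset by blast
  have idx: "?idx ` A \<subseteq> ?I" using A by (auto simp: Node_Reward_in)
  have "?I \<noteq> {}" using idx False by auto
  have finI: "finite ?I" by (rule finite_reward_indices[OF finite_simple_graph[OF graph]])
  \<comment> \<open>Outside of the index set the rewards need not be measurable, so a dummy distribution is put there.\<close>
  define N where "N i = (if i \<in> ?I then distr M borel (\<Phi> i) else distr M borel (\<lambda>_. 0))" for i
  have N: "prob_space (N i)" "sets (N i) = sets borel" for i
    by (auto simp: N_def intro!: prob_space_distr prob_space_return rv)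
  have distr: "distr M (PiM ?I (\<lambda>_. borel)) (\<lambda>\<omega>. restrict (?\<phi> \<omega>) ?I) = PiM ?I N"
    using gaussian_networkD(4)[OF net] indep_vars_iff_distr_eq_PiM'[OF \<open>?I \<noteq> {}\<close>, where M' = "\<lambda>_. borel" and X = \<Phi>] rv
    by (simp add: N_def cong: PiM_cong)
  have restr: "(\<lambda>\<omega>. restrict (?\<phi> \<omega>) ?I) \<in> measurable M (PiM ?I (\<lambda>_. borel))"
    by (intro measurable_restrict rv)
  have comp: "(\<lambda>x. x i) \<in> borel_measurable (PiM ?I N)" if "i \<in> ?I" for i
    by (subst measurable_cong_sets[OF refl N(2)[of i, symmetric]]) (rule measurable_component_singleton[OF that])
  note range_meas = measurable_field_range[where \<Phi> = "\<lambda>i x. x i" and M = "PiM ?I N", OF graph comp]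
  have W_meas: "?W \<in> borel_measurable (PiM ?I N)"
    using idx by (intro borel_measurable_prod_ennreal component_in_window[OF N(2)] range_meas) auto
  have B_meas: "?B \<in> borel_measurable (PiM ?I N)"
    by (intro borel_measurable_prod_ennreal measurable_compose[OF _ measurable_ennreal] borel_measurable_times
        borel_measurable_diff range_meas) auto
  have transfer: "(\<integral>\<^sup>+x. f x \<partial>PiM ?I N) = (\<integral>\<^sup>+\<omega>. f (restrict (?\<phi> \<omega>) ?I) \<partial>M)"
    if "f \<in> borel_measurable (PiM ?I N)" for f
    unfolding distr[symmetric] by (rule nn_integral_distr[OF restr]) (use that distr in simp)
  have W_restr: "?W (restrict \<phi> ?I) = ?W \<phi>" for \<phi>
    using A by (intro prod.cong refl) (auto simp: field_range_restrict[OF graph] Node_Reward_in)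
  have B_restr: "?B (restrict \<phi> ?I) = ?B \<phi>" for \<phi>
    by (simp add: field_range_restrict[OF graph])
  have "emeasure M {\<omega> \<in> space M. \<forall>v\<in>A. in_window n E (?\<phi> \<omega>) v} =
      (\<integral>\<^sup>+\<omega>. indicator {\<omega> \<in> space M. \<forall>v\<in>A. in_window n E (?\<phi> \<omega>) v} \<omega> \<partial>M)"
    using in_window_measurable[OF graph rv A] by simp
  also have "\<dots> = (\<integral>\<^sup>+\<omega>. ?W (?\<phi> \<omega>) \<partial>M)"
  proof (rule nn_integral_cong)
    fix \<omega> assume \<omega>: "\<omega> \<in> space M"
    show "indicator {\<omega> \<in> space M. \<forall>v\<in>A. in_window n E (?\<phi> \<omega>) v} \<omega> = ?W (?\<phi> \<omega>)"
    proof (cases "\<forall>v\<in>A. in_window n E (?\<phi> \<omega>) v")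
      case True
      then show ?thesis using \<omega> by (simp add: in_window_def)
    next
      case False
      then have "?W (?\<phi> \<omega>) = 0" using finA by (auto simp: in_window_def intro!: prod_zero)
      with False show ?thesis by simp
    qed
  qed
  also have "\<dots> = (\<integral>\<^sup>+x. ?W x * 1 \<partial>PiM ?I N)"
    using transfer[OF W_meas] by (simp only: W_restr mult_1_right)
  also have "\<dots> \<le> (\<integral>\<^sup>+x. ?B x * 1 \<partial>PiM ?I N)"
  proof (rule nn_integral_windows[OF N finI finA idx])
    show "inj_on ?idx A" by (auto simp: inj_on_def)
    show "emeasure (N (?idx v)) {a..<b} \<le> ennreal (?c * (b - a))" if "v \<in> A" for v a b
      using emeasure_normal_window[OF gaussian_networkD(7)[OF net] pos(2)] A that
      by (auto simp: N_def Node_Reward_in)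
  qed (auto intro: range_meas field_range_update_node)
  also have "\<dots> = (\<integral>\<^sup>+\<omega>. ?B (?\<phi> \<omega>) \<partial>M)"
    using transfer[OF B_meas] by (simp only: B_restr mult_1_right)
  also have "\<dots> = (\<integral>\<^sup>+\<omega>. ennreal ?c ^ card A *
      (\<Prod>v\<in>A. \<Sum>e\<in>edges_at E v. ennreal \<bar>interaction (?\<phi> \<omega>) e\<bar>) \<partial>M)"
  proof -
    have "ennreal (?c * (field_upper n E v \<phi> - field_lower n E v \<phi>)) =
        ennreal ?c * (\<Sum>e\<in>edges_at E v. ennreal \<bar>interaction \<phi> e\<bar>)" for v \<phi>
      unfolding field_width[OF graph] using pos(2) by (subst ennreal_mult) (auto simp: sum_nonneg)
    then show ?thesis by (simp only: prod.distrib prod_constant)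
  qed
  also have "\<dots> = ennreal ?c ^ card A *
      (\<integral>\<^sup>+\<omega>. (\<Prod>v\<in>A. \<Sum>e\<in>edges_at E v. ennreal \<bar>interaction (?\<phi> \<omega>) e\<bar>) \<partial>M)"
  proof (rule nn_integral_cmult)
    have [measurable]: "(\<lambda>\<omega>. interaction (?\<phi> \<omega>) e) \<in> borel_measurable M" if "e \<in> E" for e
      using interaction_gaussian[OF net pos(1) that] by (simp add: distributed_def)
    show "(\<lambda>\<omega>. \<Prod>v\<in>A. \<Sum>e\<in>edges_at E v. ennreal \<bar>interaction (?\<phi> \<omega>) e\<bar>) \<in> borel_measurable M"
      by (intro borel_measurable_prod_ennreal borel_measurable_sum) (auto simp: edges_at_def)
  qed
  also have "\<dots> \<le> ennreal ?c ^ card A * ennreal (real \<Delta> * (2 * \<sigma>\<^sub>e)) ^ card A"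
    by (intro mult_left_mono product_width_bound[OF net pos(1) A]) simp
  also have "\<dots> = ennreal ((?c * (real \<Delta> * (2 * \<sigma>\<^sub>e))) ^ card A)"
  proof -
    have "ennreal ?c * ennreal (real \<Delta> * (2 * \<sigma>\<^sub>e)) = ennreal (?c * (real \<Delta> * (2 * \<sigma>\<^sub>e)))"
      using pos by (intro ennreal_mult[symmetric]) auto
    then show ?thesis using pos by (simp only: power_mult_distrib[symmetric]) (rule ennreal_power, simp)
  qed
  also have "?c * (real \<Delta> * (2 * \<sigma>\<^sub>e)) = real \<Delta> * \<sigma>\<^sub>e / \<sigma>\<^sub>p" by simp
  finally show ?thesis
    using pos by (simp add: emeasure_eq_measure)
qed

section \<open>Choice of parameters\<close>

text \<open>
  The claim is trivial for \<open>\<Delta> \<le> 1\<close>.  With \<open>D = \<Delta> - 1 \<ge> 1\<close> the hypothesis forces \<open>\<beta> * D\<^sup>2 < 2 / 5\<close>, and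
  the ratio \<open>\<rho>\<close> of the standard deviations satisfies \<open>\<rho>\<^sup>2 = \<beta>\<^sup>2 / (1 - \<beta>\<^sup>2)\<close>.  Then \<open>D * (D + 1) \<le> 2 * D\<^sup>2\<close> gives the claim, as
  \<open>5 * (2 / 5)\<^sup>2 < 1\<close>.
\<close>
lemma contraction_rate:
  fixes \<Delta> :: nat and \<sigma>\<^sub>e \<sigma>\<^sub>p \<beta> :: real
  assumes pos: "\<sigma>\<^sub>e > 0" "\<sigma>\<^sub>p > 0"
    and \<beta>: "\<beta> = sqrt (\<sigma>\<^sub>e\<^sup>2 / (\<sigma>\<^sub>e\<^sup>2 + \<sigma>\<^sub>p\<^sup>2))"
    and small: "\<beta> * (real \<Delta> - 1) + sqrt (\<beta> * (real \<Delta> - 1) ^ 3) < 1"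
  shows "real (\<Delta> - 1) * (real \<Delta> * \<sigma>\<^sub>e / \<sigma>\<^sub>p) < 1"
proof (cases "\<Delta> \<le> 1")
  case True
  then show ?thesis by simp
next
  case False
  define D where "D = real \<Delta> - 1"
  have D: "D \<ge> 1" "real (\<Delta> - 1) = D" "real \<Delta> = D + 1" using False by (auto simp: D_def of_nat_diff)
  have \<beta>0: "\<beta> \<ge> 0" by (simp add: \<beta>)
  have small: "\<beta> * D + sqrt (\<beta> * D ^ 3) < 1" using small by (simp add: D_def)
  have a: "\<beta> * D\<^sup>2 < 2 / 5"
  proof (rule ccontr)
    assume "\<not> \<beta> * D\<^sup>2 < 2 / 5"
    then have a: "\<beta> * D\<^sup>2 \<ge> 2 / 5" by simp
    have 1: "\<beta> * D \<ge> 2 / (5 * D)"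
      using a D(1) by (simp add: field_simps power2_eq_square)
    \<comment> \<open>Expanding around \<open>D = 1\<close> shows that the difference is positive.\<close>
    have "(5 * D - 2)\<^sup>2 \<le> 10 * D ^ 3"
    proof -
      have "10 * D ^ 3 - (5 * D - 2)\<^sup>2 = 1 + 5 * (D - 1)\<^sup>2 + 10 * (D - 1) ^ 3"
        by (simp add: power2_eq_square power3_eq_cube algebra_simps)
      moreover have "1 + 5 * (D - 1)\<^sup>2 + 10 * (D - 1) ^ 3 \<ge> 0" using D(1) by simp
      ultimately show ?thesis by linarith
    qed
    then have "(1 - 2 / (5 * D))\<^sup>2 \<le> 2 / 5 * D"
      using D(1) by (simp add: field_simps power2_eq_square power3_eq_cube)
    also have "\<dots> \<le> \<beta> * D\<^sup>2 * D" using a D(1) by (intro mult_right_mono) auto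
    also have "\<dots> = \<beta> * D ^ 3" by (simp add: power2_eq_square power3_eq_cube)
    finally have "1 - 2 / (5 * D) \<le> sqrt (\<beta> * D ^ 3)" by (rule real_le_rsqrt)
    with 1 small show False by linarith
  qed
  define \<rho> where "\<rho> = \<sigma>\<^sub>e / \<sigma>\<^sub>p"
  have \<rho>: "\<rho> > 0" using pos by (simp add: \<rho>_def)
  have "\<beta>\<^sup>2 = \<sigma>\<^sub>e\<^sup>2 / (\<sigma>\<^sub>e\<^sup>2 + \<sigma>\<^sub>p\<^sup>2)" by (simp add: \<beta>)
  moreover have "\<sigma>\<^sub>e\<^sup>2 + \<sigma>\<^sub>p\<^sup>2 > 0" using pos by (simp add: add_pos_pos)
  ultimately have \<rho>\<beta>: "\<rho>\<^sup>2 * (1 - \<beta>\<^sup>2) = \<beta>\<^sup>2"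
    using pos by (simp add: \<rho>_def field_simps)
  have "(\<beta> * D\<^sup>2)\<^sup>2 \<le> (2 / 5)\<^sup>2" using a \<beta>0 by (intro power_mono) auto
  moreover have "(\<beta> * D\<^sup>2)\<^sup>2 = \<beta>\<^sup>2 * D ^ 4" by (simp add: power_mult_distrib flip: power_mult)
  ultimately have b4: "\<beta>\<^sup>2 * D ^ 4 \<le> 4 / 25" by (simp add: power_divide)
  have "\<beta>\<^sup>2 * 1 \<le> \<beta>\<^sup>2 * D ^ 4" using D(1) by (intro mult_left_mono) auto
  with b4 have b2: "\<beta>\<^sup>2 \<le> 4 / 25" by linarith
  have "D * (D + 1) \<le> 2 * D\<^sup>2" using D(1) by (simp add: power2_eq_square algebra_simps)
  then have "(D * (D + 1))\<^sup>2 \<le> (2 * D\<^sup>2)\<^sup>2" using D(1) by (intro power_mono) auto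
  also have "\<dots> = 4 * D ^ 4" by (simp add: power_mult_distrib flip: power_mult)
  finally have "\<beta>\<^sup>2 * (D * (D + 1))\<^sup>2 \<le> \<beta>\<^sup>2 * (4 * D ^ 4)" by (intro mult_left_mono) auto
  with b4 have "\<beta>\<^sup>2 * (D * (D + 1))\<^sup>2 < 1 - \<beta>\<^sup>2" using b2 by linarith
  moreover have "(D * (D + 1) * \<rho>)\<^sup>2 * (1 - \<beta>\<^sup>2) = (D * (D + 1))\<^sup>2 * (\<rho>\<^sup>2 * (1 - \<beta>\<^sup>2))"
    by (simp only: power_mult_distrib mult.assoc)
  ultimately have "(D * (D + 1) * \<rho>)\<^sup>2 * (1 - \<beta>\<^sup>2) < 1 * (1 - \<beta>\<^sup>2)"
    using \<rho>\<beta> by (simp add: mult.commute)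
  moreover have "1 - \<beta>\<^sup>2 > 0" using b2 by linarith
  ultimately have "(D * (D + 1) * \<rho>)\<^sup>2 < 1" using mult_less_cancel_right_pos by blast
  then have "D * (D + 1) * \<rho> < 1" by (simp add: power2_less_1_iff abs_less_iff)
  then show ?thesis by (simp only: D(2,3) \<rho>_def mult.assoc times_divide_eq_right)
qed

lemma depth_exists:
  assumes "0 < real_of_rat \<theta>" "real_of_rat \<theta> < 1"
  shows "\<exists>k. depth \<theta> r k"
proof -
  have step: "\<exists>k. depth \<theta> r k" if "r * real_of_rat \<theta> ^ m < 1" for m r
    using that
  proof (induction m arbitrary: r)
    case 0
    then show ?case by (intro exI[of _ 0]) simp
  next
    case (Suc m)
    show ?case
    proof (cases "r < 1")
      case True
      then show ?thesis by (intro exI[of _ 0]) simp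
    next
      case False
      obtain k where "depth \<theta> (r * real_of_rat \<theta>) k"
        using Suc.IH[of "r * real_of_rat \<theta>"] Suc.prems by (auto simp: mult.assoc)
      with False show ?thesis by (intro exI[of _ "Suc k"]) simp
    qed
  qed
  show ?thesis
  proof (cases "r \<le> 0")
    case True
    then show ?thesis by (intro exI[of _ 0]) simp
  next
    case False
    obtain m where "real_of_rat \<theta> ^ m < 1 / r"
      using real_arch_pow_inv[of "1 / r" "real_of_rat \<theta>"] assms False by auto
    then show ?thesis using False by (intro step[of _ m]) (simp add: field_simps)
  qed
qed

lemma depth_upper: "depth \<theta> r k \<Longrightarrow> r * real_of_rat \<theta> ^ k < 1"
proof (induction k arbitrary: r)
  case (Suc k)
  from Suc.IH[of "r * real_of_rat \<theta>"] Suc.prems show ?case by (simp add: mult.assoc)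
qed simp

lemma depth_lower: "depth \<theta> r (Suc k) \<Longrightarrow> r * real_of_rat \<theta> ^ k \<ge> 1"
proof (induction k arbitrary: r)
  case (Suc k)
  from Suc.IH[of "r * real_of_rat \<theta>"] Suc.prems show ?case by (simp add: mult.assoc)
qed simp

text \<open>
  The control number is at least 1 before the last level, so the depth is at most logarithmic
  and a power with this exponent is polynomial in \<open>R\<close>.
\<close>
lemma depth_power_le:
  assumes \<theta>: "0 < real_of_rat \<theta>" and "depth \<theta> r k" and b: "1 \<le> b" "b \<le> (1 / real_of_rat \<theta>) ^ m" and "r \<le> R" "1 \<le> R"
  shows "b ^ k \<le> b * R ^ m"
proof (cases k)
  case 0
  have "1 * 1 \<le> b * R ^ m" using assms by (intro mult_mono) auto
  with 0 show ?thesis by simp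
next
  case (Suc j)
  have "1 / real_of_rat \<theta> ^ j \<le> r"
    using depth_lower[OF assms(2)[unfolded Suc]] \<theta> by (simp add: field_simps)
  then have r: "(1 / real_of_rat \<theta>) ^ j \<le> R" using assms(5) by (simp add: power_divide)
  have "b ^ j \<le> ((1 / real_of_rat \<theta>) ^ m) ^ j" using b by (intro power_mono) auto
  also have "\<dots> = ((1 / real_of_rat \<theta>) ^ j) ^ m" by (simp add: mult.commute flip: power_mult)
  also have "\<dots> \<le> R ^ m" using r \<theta> by (intro power_mono) auto
  finally show ?thesis using b(1) by (simp add: Suc mult_left_mono)
qed

text \<open>
  Union bound over the self-avoiding paths with \<open>k\<close> nodes.  For \<open>k < 2\<close> the constant \<open>C\<close> makes the
  bound at least 1.
\<close>
lemma failure_probability: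
  assumes net: "gaussian_network \<Delta> \<sigma>\<^sub>e \<sigma>\<^sub>p M n E \<Phi>" and pos: "\<sigma>\<^sub>e > 0" "\<sigma>\<^sub>p > 0"
    and \<theta>: "0 < \<theta>" "\<theta> < 1" "real (\<Delta> - 1) * (real \<Delta> * \<sigma>\<^sub>e / \<sigma>\<^sub>p) \<le> \<theta>"
    and C: "1 \<le> C * \<theta>\<^sup>2" "real \<Delta> * (real \<Delta> * \<sigma>\<^sub>e / \<sigma>\<^sub>p)\<^sup>2 \<le> C * \<theta>\<^sup>2"
    and "\<epsilon> > 0"
  shows "measure M {\<omega>\<in>space M. optimal_reward 2 n E (\<lambda>i. \<Phi> i \<omega>)
     - total_reward n E (\<lambda>i. \<Phi> i \<omega>) (solution_of n (run_greedy k n E (\<lambda>i. \<Phi> i \<omega>))) > \<epsilon>}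
     \<le> (real n + 1) * C * \<theta> ^ k"
proof -
  interpret prob_space M by (rule gaussian_networkD(1)[OF net])
  note graph = gaussian_networkD(2)[OF net] and rv = gaussian_networkD(5)[OF net]
  define q where "q = real \<Delta> * \<sigma>\<^sub>e / \<sigma>\<^sub>p"
  have q: "q \<ge> 0" using pos by (simp add: q_def)
  have C0: "C > 0" using C(1) \<theta>(1) by (metis not_le mult_nonpos_nonneg zero_le_power2 order_trans not_one_le_zero)
  let ?F = "{\<omega>\<in>space M. optimal_reward 2 n E (\<lambda>i. \<Phi> i \<omega>)
     - total_reward n E (\<lambda>i. \<Phi> i \<omega>) (solution_of n (run_greedy k n E (\<lambda>i. \<Phi> i \<omega>))) > \<epsilon>}"
  let ?W = "\<lambda>p. {\<omega> \<in> space M. \<forall>v\<in>set p. in_window n E (\<lambda>i. \<Phi> i \<omega>) v}"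
  have W: "?W p \<in> sets M" if "p \<in> paths n E k" for p
    using that by (intro in_window_measurable[OF graph rv]) (auto simp: paths_def)
  have sub: "?F \<subseteq> (\<Union>p\<in>paths n E k. ?W p)"
  proof
    fix \<omega> assume \<omega>: "\<omega> \<in> ?F"
    let ?\<phi> = "\<lambda>i. \<Phi> i \<omega>"
    have "total_reward n E ?\<phi> (solution_of n (run_greedy k n E ?\<phi>)) \<noteq> optimal_reward 2 n E ?\<phi>"
      using \<omega> \<open>\<epsilon> > 0\<close> by auto
    with greedy_solution_optimal[OF graph, of k ?\<phi>] obtain p where p: "p \<in> paths n E k"
      "\<And>v. v \<in> set p \<Longrightarrow> \<not> decided (fields_of n ?\<phi>) (couplings_of n E ?\<phi>) v" by blast
    have "in_window n E ?\<phi> v" if "v \<in> set p" for v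
    proof -
      have "v < n" using p(1) that by (auto simp: paths_def)
      then show ?thesis
        unfolding in_window_def using gaussian_networkD(8)[OF net] \<omega> p(2)[OF that]
        by (intro undecided_window) auto
    qed
    with p(1) \<omega> show "\<omega> \<in> (\<Union>p\<in>paths n E k. ?W p)" by blast
  qed
  show ?thesis
  proof (cases "k < 2")
    case True
    have "1 \<le> C * \<theta>\<^sup>2" by (rule C(1))
    also have "\<dots> \<le> C * \<theta> ^ k" using True \<theta> C0 by (intro mult_left_mono power_decreasing) auto
    also have "\<dots> \<le> (real n + 1) * (C * \<theta> ^ k)" using C0 \<theta> by (simp add: algebra_simps)
    finally have "1 \<le> (real n + 1) * C * \<theta> ^ k" by (simp only: mult.assoc)
    then show ?thesis by (rule order_trans[OF prob_le_1])
  next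
    case False
    then obtain j where k: "k = j + 2" by (metis add.commute le_Suc_ex not_less)
    have "prob ?F \<le> prob (\<Union>p\<in>paths n E k. ?W p)"
      using W finite_paths by (intro finite_measure_mono[OF sub]) auto
    also have "\<dots> \<le> (\<Sum>p\<in>paths n E k. prob (?W p))"
      using W by (intro finite_measure_subadditive_finite finite_paths) auto
    also have "\<dots> \<le> (\<Sum>p\<in>paths n E k. q ^ k)"
    proof (rule sum_mono)
      fix p assume p: "p \<in> paths n E k"
      then have "card (set p) = k" "set p \<subseteq> {..<n}" by (auto simp: paths_def distinct_card)
      then show "prob (?W p) \<le> q ^ k"
        using prob_in_window[OF net pos, of "set p"] by (simp add: q_def)
    qed
    also have "\<dots> = real (card (paths n E k)) * q ^ k" by simp
    also have "\<dots> \<le> real (n * \<Delta> * (\<Delta> - 1) ^ j) * q ^ k"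
      using card_paths[OF graph gaussian_networkD(3)[OF net], of j] q
      by (intro mult_right_mono) (simp_all only: k of_nat_le_iff zero_le_power)
    also have "\<dots> = real n * (real \<Delta> * q\<^sup>2) * (real (\<Delta> - 1) * q) ^ j"
      by (simp add: k power_add power_mult_distrib power2_eq_square mult_ac)
    also have "\<dots> \<le> (real n + 1) * (C * \<theta>\<^sup>2) * \<theta> ^ j"
    proof (rule mult_mono)
      show "real n * (real \<Delta> * q\<^sup>2) \<le> (real n + 1) * (C * \<theta>\<^sup>2)"
        using C(2) q by (intro mult_mono[of "real n" "real n + 1"]) (simp_all add: q_def)
      show "(real (\<Delta> - 1) * q) ^ j \<le> \<theta> ^ j"
        using \<theta>(3) q unfolding q_def[symmetric] by (intro power_mono mult_nonneg_nonneg) auto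
    qed (use C0 q in simp_all)
    also have "\<dots> = (real n + 1) * C * \<theta> ^ k"
      by (simp add: k power_add power2_eq_square mult_ac)
    finally show ?thesis .
  qed
qed

lemma running_time:
  assumes \<theta>: "0 < real_of_rat \<theta>" and c: "1 \<le> real c" and "0 < \<epsilon>"
    and depth: "depth \<theta> (real c * (real n + 1) / \<epsilon>) k"
    and m: "2 * real \<Delta> + 2 \<le> (1 / real_of_rat \<theta>) ^ m" and L: "L \<le> n * n"
  shows "real ((n + 2) * (2 * gap_cost \<Delta> (n + L) k))
     \<le> (1600 * (2 * real \<Delta> + 2) * real c ^ m) * (1 + real n + 1 / \<epsilon>) ^ (2 * m + 3)"
proof -
  define X where "X = 1 + real n + 1 / \<epsilon>"
  have X: "1 \<le> X" "1 + real n \<le> X" "1 / \<epsilon> \<le> X" using \<open>0 < \<epsilon>\<close> by (auto simp: X_def)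
  have "(real n + 1) * (1 / \<epsilon>) \<le> X * X" using X \<open>0 < \<epsilon>\<close> by (intro mult_mono) auto
  then have "real c * ((real n + 1) * (1 / \<epsilon>)) \<le> real c * (X * X)" by (intro mult_left_mono) auto
  then have R: "real c * (real n + 1) / \<epsilon> \<le> real c * X\<^sup>2" by (simp add: power2_eq_square)
  have "1 * 1 \<le> real c * X\<^sup>2" using c X(1) by (intro mult_mono) auto
  then have P: "(2 * real \<Delta> + 2) ^ k \<le> (2 * real \<Delta> + 2) * (real c * X\<^sup>2) ^ m"
    by (intro depth_power_le[OF \<theta> depth _ m R]) auto
  have "real (n + L) + 1 \<le> real n + real n * real n + 1"
    using L by (simp flip: of_nat_mult)
  also have "\<dots> \<le> (1 + real n) * (1 + real n)" by (simp add: algebra_simps)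
  also have "\<dots> \<le> X * X" using X by (intro mult_mono) auto
  finally have N: "real (n + L) + 1 \<le> X\<^sup>2" by (simp add: power2_eq_square)
  have "real ((n + 2) * (2 * gap_cost \<Delta> (n + L) k)) =
     800 * (real n + 2) * ((real (n + L) + 1) * (2 * real \<Delta> + 2) ^ k)"
    by (simp add: gap_cost_def algebra_simps)
  also have "\<dots> \<le> 800 * (2 * X) * (X\<^sup>2 * ((2 * real \<Delta> + 2) * (real c * X\<^sup>2) ^ m))"
    using X N P by (intro mult_mono) auto
  also have "\<dots> = (1600 * (2 * real \<Delta> + 2) * real c ^ m) * X ^ (2 * m + 3)"
    by (simp add: power_mult_distrib power_add power3_eq_cube power2_eq_square mult_ac flip: power_mult)
       (simp add: power_mult power2_eq_square mult_ac)
  finally show ?thesis by (simp add: X_def)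
qed

theorem theorem2:
  fixes \<Delta> :: nat and \<sigma>\<^sub>e \<sigma>\<^sub>p \<beta> :: real
  assumes "\<sigma>\<^sub>e > 0" and "\<sigma>\<^sub>p > 0"
    and "\<beta> = sqrt (\<sigma>\<^sub>e\<^sup>2 / (\<sigma>\<^sub>e\<^sup>2 + \<sigma>\<^sub>p\<^sup>2))"
    and "\<beta> * (real \<Delta> - 1) + sqrt (\<beta> * (real \<Delta> - 1) ^ 3) < 1"
  shows "\<exists>P. additive_fptas_whp 2 (gaussian_network \<Delta> \<sigma>\<^sub>e \<sigma>\<^sub>p :: 'w network_class) P"
proof -
  define q where "q = real \<Delta> * \<sigma>\<^sub>e / \<sigma>\<^sub>p"
  \<comment> \<open>The lower bound 1/2 keeps \<open>\<theta>\<close> positive when the first term vanishes.\<close>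
  have "max (real (\<Delta> - 1) * q) (1 / 2) < 1"
    using contraction_rate[OF assms] by (simp add: q_def)
  then obtain \<theta> :: rat where \<theta>: "max (real (\<Delta> - 1) * q) (1 / 2) < real_of_rat \<theta>" "real_of_rat \<theta> < 1"
    using of_rat_dense by blast
  let ?\<theta> = "real_of_rat \<theta>"
  have "1 / 2 < ?\<theta>" using \<theta>(1) by (simp only: max_less_iff_conj)
  then have \<theta>0: "0 < ?\<theta>" "real (\<Delta> - 1) * q \<le> ?\<theta>" using \<theta>(1) by linarith+
  \<comment> \<open>The cost grows by \<open>2 * \<Delta> + 2\<close> per level while the control number shrinks by \<open>\<theta>\<close>, so the
    cost is at most about the \<open>m\<close>-th power of the initial control number.\<close>
  obtain m where m: "2 * real \<Delta> + 2 \<le> (1 / ?\<theta>) ^ m"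
    using real_arch_pow[of "1 / ?\<theta>" "2 * real \<Delta> + 2"] \<theta>0 \<theta>(2) by (auto intro: less_imp_le)
  \<comment> \<open>\<open>c\<close> is the constant in front of the decaying failure probability; the initial control number
    \<open>c * (n + 1) / \<epsilon>\<close> absorbs it.\<close>
  obtain c :: nat where c: "max 1 (real \<Delta> * q\<^sup>2) / ?\<theta>\<^sup>2 \<le> real c"
    using real_arch_simple by blast
  then have C: "max 1 (real \<Delta> * q\<^sup>2) \<le> real c * ?\<theta>\<^sup>2"
    using \<theta>0 by (simp add: pos_divide_le_eq)
  have "?\<theta>\<^sup>2 \<le> 1" using \<theta>0 \<theta>(2) by (intro power_le_one) auto
  then have "real c * ?\<theta>\<^sup>2 \<le> real c" by (simp add: mult_left_le)
  then have c1: "1 \<le> real c" using C by simp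
  define K where "K n \<epsilon> = (SOME k. depth \<theta> (real c * (real n + 1) / \<epsilon>) k)" for n :: nat and \<epsilon> :: real
  have K: "depth \<theta> (real c * (real n + 1) / \<epsilon>) (K n \<epsilon>)" for n \<epsilon>
    unfolding K_def using depth_exists[OF \<theta>0(1) \<theta>(2)] by (rule someI_ex)
  define T where "T = 1600 * (2 * real \<Delta> + 2) * real c ^ m"
  have "additive_fptas_whp 2 (gaussian_network \<Delta> \<sigma>\<^sub>e \<sigma>\<^sub>p :: 'w network_class) (optimizer \<theta> (of_nat c))"
    unfolding additive_fptas_whp_def
  proof (intro exI allI impI)
    fix M :: "'w measure" and n E \<Phi> and \<epsilon> :: real
    assume net: "gaussian_network \<Delta> \<sigma>\<^sub>e \<sigma>\<^sub>p M n E \<Phi>" and \<epsilon>: "\<epsilon> > 0"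
    note graph = gaussian_networkD(2)[OF net] and rv = gaussian_networkD(5)[OF net]
    let ?k = "K n \<epsilon>"
    let ?bs = "\<lambda>\<omega>. run_greedy ?k n E (\<lambda>i. \<Phi> i \<omega>)"
    let ?x = "\<lambda>\<omega>. solution_of n (?bs \<omega>)"
    have run: "\<exists>t. runs (optimizer \<theta> (of_nat c)) (encode_input 2 n E \<phi> \<epsilon>)
          (encode_solution n (solution_of n (run_greedy ?k n E \<phi>))) t
        \<and> real t \<le> T * (1 + real n + 1 / \<epsilon>) ^ (2 * m + 3)" for \<phi>
    proof -
      let ?ps = "map (\<lambda>v. (\<phi> (Node_Reward v 0), \<phi> (Node_Reward v 1))) [0..<n]"
      let ?C = "couplings_of n E \<phi>"
      have h: "fields_of n \<phi> = zip [0..<length ?ps] (map (\<lambda>(a, b). b - a) ?ps)"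
        by (rule nth_equalityI) (auto simp: fields_of_def)
      have L: "length ?C \<le> n * n" using length_edge_list by (simp add: couplings_of_def)
      obtain t where t: "runs (optimizer \<theta> (of_nat c)) (encode_input 2 n E \<phi> \<epsilon>)
          (val_of_list (map (\<lambda>b. VNum (of_bool b)) (run_greedy ?k n E \<phi>))) t"
        "t \<le> (n + 2) * (2 * gap_cost \<Delta> (n + length ?C) ?k)"
        using optimizer_runs[of \<theta> "of_nat c" ?ps \<epsilon> ?k ?C \<Delta> "fields_of n \<phi>"] K[of n \<epsilon>] h
          length_incident_couplings_of[OF graph gaussian_networkD(3)[OF net]]
        unfolding encode_input_eq run_greedy_def by (auto simp: add.commute)
      have "real t \<le> real ((n + 2) * (2 * gap_cost \<Delta> (n + length ?C) ?k))"
        using t(2) by (simp only: of_nat_le_iff)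
      also have "\<dots> \<le> T * (1 + real n + 1 / \<epsilon>) ^ (2 * m + 3)"
        unfolding T_def by (rule running_time[OF \<theta>0(1) c1 \<epsilon> K m L])
      finally show ?thesis
        using t(1) by (auto simp: encode_solution_of run_greedy_def)
    qed
    have "measure M {\<omega>\<in>space M. optimal_reward 2 n E (\<lambda>i. \<Phi> i \<omega>) - total_reward n E (\<lambda>i. \<Phi> i \<omega>) (?x \<omega>) > \<epsilon>}
        \<le> (real n + 1) * real c * ?\<theta> ^ ?k"
      using \<theta>0 \<theta>(2) C by (intro failure_probability[OF net assms(1,2) _ _ _ _ _ \<epsilon>]) (auto simp: q_def)
    also have "\<dots> < \<epsilon>"
      using depth_upper[OF K[of n \<epsilon>]] \<epsilon> by (simp add: field_simps)
    finally have fail: "measure M {\<omega>\<in>space M. optimal_reward 2 n E (\<lambda>i. \<Phi> i \<omega>) - total_reward n E (\<lambda>i. \<Phi> i \<omega>) (?x \<omega>) > \<epsilon>} < \<epsilon>" .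
    show "(\<forall>\<omega>\<in>space M. ?x \<omega> \<in> solutions 2 n \<and>
             (\<exists>t. runs (optimizer \<theta> (of_nat c)) (encode_input 2 n E (\<lambda>i. \<Phi> i \<omega>) \<epsilon>) (encode_solution n (?x \<omega>)) t \<and>
                  real t \<le> T * (1 + real n + 1 / \<epsilon>) ^ (2 * m + 3))) \<and>
          (let failure = {\<omega>\<in>space M. optimal_reward 2 n E (\<lambda>i. \<Phi> i \<omega>)
                            - total_reward n E (\<lambda>i. \<Phi> i \<omega>) (?x \<omega>) > \<epsilon>}
           in failure \<in> sets M \<and> measure M failure < \<epsilon>)"
      unfolding Let_def
      by (intro conjI ballI solution_of_in run fail measurable_failure[OF graph rv])
  qed
  then show ?thesis by blast
qed

end
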